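(* For a finite group $G$ the following statements are equivalent: (1) All cyclic primary subgroups of $G$ (that is, all cyclic subgroups of $G$ of prime power order) are $\mathbb{P}$-subnormal in $G$. (2) All subgroups of $G$ with nilpotent derived subgroup are supersoluble. (3) For all $x,y\in G$ there is a natural number $k\ge 1$ such that $\ddot{u}_k(x,y)=1$.
   Context: Only finite groups are considered. A subgroup $H$ of a group $G$ is called $\mathbb{P}$-subnormal in $G$ if either $H=G$ or there is a maximal chain of subgroups $H=H_0\subset H_1\subset\dots\subset H_n=G$ such that $|H_i:H_{i-1}|$ is a prime for $i=1,\dots,n$. The words $\ddot{u}_k(x,y)$ are defined recursively by $\ddot{u}_1(x,y)=[x,y]$ and $\ddot{u}_{k+1}(x,y)=\ddot{u}_k(x,y)^{-k}\,[\ddot{u}_k(x,y),y]$ for $k\ge 1$, where $[a,b]=a^{-1}b^{-1}ab$ is the commutator. The derived subgroup of a group $H$ is $H'=[H,H]$. A finite group is supersoluble if it has a normal series with cyclic factors in which every term is normal in the whole group. *)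

theory Defs
  imports "HOL-Algebra.Algebra" "HOL-Number_Theory.Prime_Powers"
begin

definition commutator :: "('a, 'b) monoid_scheme \<Rightarrow> 'a \<Rightarrow> 'a \<Rightarrow> 'a" where
  "commutator G a b = inv\<^bsub>G\<^esub> a \<otimes>\<^bsub>G\<^esub> inv\<^bsub>G\<^esub> b \<otimes>\<^bsub>G\<^esub> a \<otimes>\<^bsub>G\<^esub> b"

text \<open>In the following definition \<open>rcosets\<close> is formed inside the subgroup \<open>C (Suc i)\<close>, so its cardinality
  is the index of \<open>C i\<close> in \<open>C (Suc i)\<close>. A maximal chain is one without refinements, so no
  subgroup of \<open>G\<close> lies strictly between consecutive members.\<close>

definition P_subnormal :: "('a, 'b) monoid_scheme \<Rightarrow> 'a set \<Rightarrow> bool" where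
  "P_subnormal G H \<longleftrightarrow> subgroup H G \<and>
     (H = carrier G \<or>
      (\<exists>(C :: nat \<Rightarrow> 'a set) n.
         C 0 = H \<and> C n = carrier G \<and>
         (\<forall>i\<le>n. subgroup (C i) G) \<and>
         (\<forall>i<n. C i \<subset> C (Suc i) \<and>
                (\<forall>K. subgroup K G \<and> C i \<subseteq> K \<and> K \<subseteq> C (Suc i) \<longrightarrow> K = C i \<or> K = C (Suc i)) \<and>
                Factorial_Ring.prime (card (rcosets\<^bsub>G\<lparr>carrier := C (Suc i)\<rparr>\<^esub> (C i))))))"

text \<open>Nilpotency: existence of a finite central series. The commutator condition says that
  \<open>K (Suc i)\<close> is central modulo \<open>K i\<close>.\<close>

definition nilpotent_group :: "('a, 'b) monoid_scheme \<Rightarrow> bool" where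
  "nilpotent_group G \<longleftrightarrow> group G \<and>
     (\<exists>(K :: nat \<Rightarrow> 'a set) n.
        K 0 = {\<one>\<^bsub>G\<^esub>} \<and> K n = carrier G \<and>
        (\<forall>i\<le>n. K i \<lhd> G) \<and>
        (\<forall>i<n. K i \<subseteq> K (Suc i) \<and>
               (\<forall>x\<in>K (Suc i). \<forall>g\<in>carrier G. commutator G x g \<in> K i)))"

definition supersoluble_group :: "('a, 'b) monoid_scheme \<Rightarrow> bool" where
  "supersoluble_group G \<longleftrightarrow> group G \<and>
     (\<exists>(K :: nat \<Rightarrow> 'a set) n.
        K 0 = {\<one>\<^bsub>G\<^esub>} \<and> K n = carrier G \<and>
        (\<forall>i\<le>n. K i \<lhd> G) \<and>
        (\<forall>i<n. K i \<subseteq> K (Suc i) \<and>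
               cyclic_group (G\<lparr>carrier := K (Suc i)\<rparr> Mod K i)))"

text \<open>The words are indexed from 1. The clause for 0 only makes the function total; it is chosen so
  that the recursion also holds at 0.\<close>

fun u_word :: "('a, 'b) monoid_scheme \<Rightarrow> 'a \<Rightarrow> 'a \<Rightarrow> nat \<Rightarrow> 'a" where
  "u_word G x y 0 = x"
| "u_word G x y (Suc 0) = commutator G x y"
| "u_word G x y (Suc (Suc k)) =
     (u_word G x y (Suc k) [^]\<^bsub>G\<^esub> (- int (Suc k)))
       \<otimes>\<^bsub>G\<^esub> commutator G (u_word G x y (Suc k)) y"

end

theory Submission
  imports Defs "HOL-Number_Theory.Cong"
begin

text \<open>The three conditions are linked by the cycle \<open>(2) \<Longrightarrow> (1) \<Longrightarrow> (3) \<Longrightarrow> (2)\<close>. Behind it lies one computation.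
Let \<open>y\<close> act by conjugation on an abelian normal subgroup \<open>N\<close> written additively. Then \<open>[u, y] = u\<^sup>y - u\<close>, so
inside \<open>N\<close> the recursion is \<open>u\<^sub>k \<mapsto> u\<^sub>k (y - 1 - k)\<close>, and for \<open>x \<in> N\<close> the words are
\<open>u\<^sub>k = x (y - 1) (y - 2) \<dots> (y - k)\<close>. They vanish eventually for all \<open>x \<in> N\<close> if and only if \<open>N\<close> has a \<open>y\<close>-invariant series on
whose factors \<open>y\<close> acts by power maps, in other words if all eigenvalues of \<open>y\<close> are integers.

\<open>(2) \<Longrightarrow> (1)\<close>. Condition (2) is applied to the groups \<open>P\<langle>y\<rangle>\<close>, where \<open>P\<close> is a \<open>p\<close>-subgroup normalized by \<open>y\<close>:
the derived subgroup lies in \<open>P\<close>, so \<open>P\<langle>y\<rangle>\<close> is supersoluble, and in a supersoluble group every subgroup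
is joined to the top by a chain with prime indices (\<open>supersoluble_prime_chain\<close>). If \<open>p\<close> is the least prime
divisor of the order and \<open>y\<close> has order a power of another prime, then the chain from \<open>\<langle>y\<rangle>\<close> to \<open>P\<langle>y\<rangle>\<close> puts \<open>y\<close>
into a normal subgroup of order prime to \<open>p\<close> (\<open>prime_chain_p_core\<close>), so \<open>y\<close> centralizes \<open>P\<close>. This is the hypothesis of
Frobenius' theorem on normal \<open>p\<close>-complements (\<open>normal_p_complement\<close>), proved here by fusion
(\<open>sylow_controls_fusion\<close>) and transfer (\<open>transfer\<close>). Thus \<open>G\<close> has a tower of normal Hall subgroups, and the
chains inside the groups \<open>P\<langle>y\<rangle>\<close>, for suitable Sylow subgroups \<open>P\<close> of the layers, are glued along this tower
to a chain from \<open>\<langle>y\<rangle>\<close> to \<open>G\<close> (\<open>primary_prime_chain\<close>).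

\<open>(1) \<Longrightarrow> (3)\<close>. For the greatest prime divisor \<open>p\<close>, the chains starting at \<open>p\<close>-elements produce a nontrivial normal
\<open>p\<close>-subgroup, hence a nontrivial abelian normal subgroup \<open>N\<close>. For a primary element \<open>z\<close>, the chain from \<open>\<langle>z\<rangle>\<close> to
\<open>G\<close> meets \<open>N\<close> in a \<open>z\<close>-invariant chain with prime indices, which supplies eigenvectors of \<open>z\<close>
(\<open>primary_eigenvector\<close>). Since an arbitrary \<open>y\<close> is a product of commuting primary elements, the eigenvectors of
these combine (\<open>cyclic_scalar\<close>), and the words that have entered \<open>N\<close> eventually vanish
(\<open>word_trivial_on_abelian\<close>). As (1) passes to quotients, induction finishes the argument.

\<open>(3) \<Longrightarrow> (2)\<close>. Let \<open>H'\<close> be nilpotent and \<open>N\<close> a minimal normal subgroup of \<open>H\<close>. Then \<open>N\<close> is abelian and centralized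
by \<open>H'\<close>. The last word before the identity is an eigenvector in \<open>N\<close> of the given \<open>y\<close>; because \<open>H'\<close>
centralizes \<open>N\<close>, the eigenspace is normal in \<open>H\<close> and so equals \<open>N\<close>. Every element of \<open>H\<close> thus acts on \<open>N\<close>
by a power map, and every cyclic subgroup of \<open>N\<close> is normal in \<open>H\<close> (\<open>nontrivial_cyclic_normal\<close>). Repeating this in the
quotients gives a series with cyclic factors.\<close>

hide_const (open) Divisibility.prime

section \<open>Conjugation and subgroups of finite groups\<close>

abbreviation (input) substructure :: "('a, 'b) monoid_scheme \<Rightarrow> 'a set \<Rightarrow> ('a, 'b) monoid_scheme"
    (infixl \<open>\<restriction>\<close> 70)
  where "G \<restriction> H \<equiv> G\<lparr>carrier := H\<rparr>"

definition conjg :: "('a, 'b) monoid_scheme \<Rightarrow> 'a \<Rightarrow> 'a \<Rightarrow> 'a" where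
  "conjg G g x = g \<otimes>\<^bsub>G\<^esub> x \<otimes>\<^bsub>G\<^esub> inv\<^bsub>G\<^esub> g"

context group
begin

lemma sub_mem: "subgroup H G \<Longrightarrow> x \<in> H \<Longrightarrow> x \<in> carrier G"
  by (rule subgroup.mem_carrier)

lemma sub_car: "subgroup H G \<Longrightarrow> H \<subseteq> carrier G"
  by (rule subgroup.subset)

lemma normal_sub: "N \<lhd> G \<Longrightarrow> subgroup N G"
  by (rule normal_imp_subgroup)

lemma conjg_closed [simp]: "g \<in> carrier G \<Longrightarrow> x \<in> carrier G \<Longrightarrow> conjg G g x \<in> carrier G"
  by (simp add: conjg_def)

lemma conjg_mult:
  "g \<in> carrier G \<Longrightarrow> x \<in> carrier G \<Longrightarrow> y \<in> carrier G
    \<Longrightarrow> conjg G g (x \<otimes> y) = conjg G g x \<otimes> conjg G g y"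
  by (simp add: conjg_def m_assoc inv_solve_left)

lemma conjg_one [simp]: "x \<in> carrier G \<Longrightarrow> conjg G \<one> x = x"
  by (simp add: conjg_def)

lemma conjg_conjg:
  "g \<in> carrier G \<Longrightarrow> h \<in> carrier G \<Longrightarrow> x \<in> carrier G
    \<Longrightarrow> conjg G g (conjg G h x) = conjg G (g \<otimes> h) x"
  by (simp add: conjg_def m_assoc inv_mult_group)

lemma conjg_inv_cancel [simp]:
  "g \<in> carrier G \<Longrightarrow> x \<in> carrier G \<Longrightarrow> conjg G (inv g) (conjg G g x) = x"
  "g \<in> carrier G \<Longrightarrow> x \<in> carrier G \<Longrightarrow> conjg G g (conjg G (inv g) x) = x"
  by (simp_all add: conjg_conjg)

lemma group_hom_conjg: "g \<in> carrier G \<Longrightarrow> group_hom G G (conjg G g)"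
  by (intro group_hom.intro group_hom_axioms.intro homI)
     (auto simp: conjg_mult is_group)

lemma inj_on_conjg: "g \<in> carrier G \<Longrightarrow> inj_on (conjg G g) (carrier G)"
  by (rule inj_on_inverseI[where g = "conjg G (inv g)"]) simp

lemma conjg_subgroup:
  "g \<in> carrier G \<Longrightarrow> subgroup H G \<Longrightarrow> subgroup (conjg G g ` H) G"
  by (rule group_hom.subgroup_img_is_subgroup[OF group_hom_conjg])

lemma card_conjg:
  "g \<in> carrier G \<Longrightarrow> H \<subseteq> carrier G \<Longrightarrow> card (conjg G g ` H) = card H"
  by (meson card_image inj_on_conjg inj_on_subset)

lemma conjg_image_conjg:
  "g \<in> carrier G \<Longrightarrow> h \<in> carrier G \<Longrightarrow> H \<subseteq> carrier G
    \<Longrightarrow> conjg G g ` conjg G h ` H = conjg G (g \<otimes> h) ` H"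
  unfolding image_image by (rule image_cong) (auto simp: conjg_conjg)

lemma conjg_image_one: "H \<subseteq> carrier G \<Longrightarrow> conjg G \<one> ` H = H"
  by (force simp: image_iff)

lemma conjg_consistent:
  "subgroup H G \<Longrightarrow> g \<in> H \<Longrightarrow> conjg (G\<restriction>H) g x = conjg G g x"
  by (simp add: conjg_def)

lemma conjg_in_subgroup: "subgroup H G \<Longrightarrow> g \<in> H \<Longrightarrow> x \<in> H \<Longrightarrow> conjg G g x \<in> H"
  by (simp add: conjg_def subgroup.m_closed subgroup.m_inv_closed)

lemma conjg_eq_iff_commute:
  "g \<in> carrier G \<Longrightarrow> x \<in> carrier G \<Longrightarrow> conjg G g x = x \<longleftrightarrow> g \<otimes> x = x \<otimes> g"
  by (metis conjg_def inv_solve_right m_closed)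

lemma conjg_normal: "N \<lhd> G \<Longrightarrow> g \<in> carrier G \<Longrightarrow> x \<in> N \<Longrightarrow> conjg G g x \<in> N"
  by (simp add: conjg_def normal_invE(2))

lemma normal_conjgI:
  "subgroup N G \<Longrightarrow> (\<And>g x. g \<in> carrier G \<Longrightarrow> x \<in> N \<Longrightarrow> conjg G g x \<in> N) \<Longrightarrow> N \<lhd> G"
  by (rule normal_invI) (auto simp: conjg_def)

end

lemma (in group_hom) group_hom_restrict:
  assumes D: "subgroup D G" shows "group_hom (G\<restriction>D) (H\<lparr>carrier := h ` D\<rparr>) h"
proof (intro group_hom.intro group_hom_axioms.intro homI)
  show "group (G\<restriction>D)" by (rule G.subgroup_imp_group[OF D])
  show "group (H\<lparr>carrier := h ` D\<rparr>)" by (rule H.subgroup_imp_group[OF subgroup_img_is_subgroup[OF D]])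
qed (use G.sub_mem[OF D] in auto)

locale finite_group = group G for G (structure) +
  assumes fin: "finite (carrier G)"
begin

lemma finite_sub: "H \<subseteq> carrier G \<Longrightarrow> finite H"
  using fin finite_subset by blast

lemma finite_subgroup: "subgroup H G \<Longrightarrow> finite H"
  using subgroup.subset finite_sub by blast

lemma card_pos: "subgroup H G \<Longrightarrow> 0 < card H"
  by (metis card_gt_0_iff empty_iff finite_subgroup subgroup.one_closed)

lemma subgroup_finite_group: "subgroup H G \<Longrightarrow> finite_group (G\<restriction>H)"
  by (simp add: finite_group_axioms_def finite_group_def finite_subgroup subgroup_imp_group)

lemma card_subgroup_dvd:
  assumes "subgroup H G" "subgroup K G" "H \<subseteq> K" shows "card H dvd card K"
proof -
  interpret K: finite_group "G\<restriction>K" using assms subgroup_finite_group by blast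
  show ?thesis
    using K.lagrange[OF subgroup_incl[OF assms]] by (intro dvdI[where k = "card (rcosets\<^bsub>G\<restriction>K\<^esub> H)"]) (simp add: order_def mult.commute)
qed

lemma card_subgroup_dvd_order: "subgroup H G \<Longrightarrow> card H dvd card (carrier G)"
  using card_subgroup_dvd subgroup.subset subgroup_self by blast

lemma subgroup_eqI:
  "subgroup H G \<Longrightarrow> subgroup K G \<Longrightarrow> H \<subseteq> K \<Longrightarrow> card K \<le> card H \<Longrightarrow> H = K"
  by (simp add: card_seteq finite_subgroup)

lemma card_set_mult:
  assumes H: "subgroup H G" and K: "subgroup K G"
  shows "card (H <#> K) * card (H \<inter> K) = card H * card K"
proof -
  interpret H: subgroup H G by fact
  interpret K: subgroup K G by fact
  let ?f = "\<lambda>(h,k). h \<otimes> k"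
  have img: "?f ` (H \<times> K) = H <#> K" by (auto simp: set_mult_def)
  have fH: "finite H" "finite K" using H K finite_subgroup by auto
  have fib: "card {z \<in> H \<times> K. ?f z = x} = card (H \<inter> K)" if x: "x \<in> H <#> K" for x
  proof -
    obtain h0 k0 where 0: "h0 \<in> H" "k0 \<in> K" "x = h0 \<otimes> k0" using x by (auto simp: set_mult_def)
    have "bij_betw (\<lambda>t. (h0 \<otimes> t, inv t \<otimes> k0)) (H \<inter> K) {z \<in> H \<times> K. ?f z = x}"
    proof (rule bij_betw_byWitness[where f' = "\<lambda>(h,k). inv h0 \<otimes> h"])
      show "\<forall>a\<in>H \<inter> K. (\<lambda>(h,k). inv h0 \<otimes> h) (h0 \<otimes> a, inv a \<otimes> k0) = a"
        using 0 by (auto simp flip: m_assoc)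
      show "\<forall>a'\<in>{z \<in> H \<times> K. ?f z = x}.
         (\<lambda>t. (h0 \<otimes> t, inv t \<otimes> k0)) ((\<lambda>(h,k). inv h0 \<otimes> h) a') = a'"
      proof
        fix z assume "z \<in> {z \<in> H \<times> K. ?f z = x}"
        then obtain h k where a: "h \<in> H" "k \<in> K" "h \<otimes> k = x" "z = (h, k)" by auto
        have "h \<in> carrier G" "k \<in> carrier G" "h0 \<in> carrier G" "k0 \<in> carrier G" using 0 a by auto
        then have "h0 \<otimes> (inv h0 \<otimes> h) = h \<and> inv (inv h0 \<otimes> h) \<otimes> k0 = k"
          using a 0 by (metis inv_closed inv_inv inv_mult_group inv_solve_left m_assoc m_closed)
        thus "(\<lambda>t. (h0 \<otimes> t, inv t \<otimes> k0)) ((\<lambda>(h,k). inv h0 \<otimes> h) z) = z" using a by simp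
      qed
      show "(\<lambda>t. (h0 \<otimes> t, inv t \<otimes> k0)) ` (H \<inter> K) \<subseteq> {z \<in> H \<times> K. ?f z = x}"
      proof (rule image_subsetI)
        fix t assume t: "t \<in> H \<inter> K"
        hence "t \<otimes> (inv t \<otimes> k0) = k0" using 0 by (simp flip: m_assoc)
        hence "(h0 \<otimes> t) \<otimes> (inv t \<otimes> k0) = x" using t 0 by (simp add: m_assoc)
        thus "(h0 \<otimes> t, inv t \<otimes> k0) \<in> {z \<in> H \<times> K. ?f z = x}" using t 0 by simp
      qed
      show "(\<lambda>(h, k). inv h0 \<otimes> h) ` {z \<in> H \<times> K. ?f z = x} \<subseteq> H \<inter> K"
      proof (rule image_subsetI)
        fix z assume "z \<in> {z \<in> H \<times> K. ?f z = x}"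
        then obtain h k where a: "h \<in> H" "k \<in> K" "h \<otimes> k = x" "z = (h, k)" by (cases z) auto
        have c: "h \<in> carrier G" "k \<in> carrier G" "h0 \<in> carrier G" "k0 \<in> carrier G" using 0 a by auto
        have "h0 \<otimes> (k0 \<otimes> inv k) = (h0 \<otimes> k0) \<otimes> inv k" using c by (simp add: m_assoc)
        also have "\<dots> = (h \<otimes> k) \<otimes> inv k" using a(3) 0(3) by simp
        also have "\<dots> = h" using c by (simp add: m_assoc)
        finally have "h0 \<otimes> (k0 \<otimes> inv k) = h" .
        hence "inv h0 \<otimes> h = k0 \<otimes> inv k" using c by (metis inv_closed inv_solve_left' m_closed)
        moreover have "inv h0 \<otimes> h \<in> H" "k0 \<otimes> inv k \<in> K" using a(1,2) 0(1,2) by auto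
        ultimately show "(\<lambda>(h, k). inv h0 \<otimes> h) z \<in> H \<inter> K" using a(4) by simp
      qed
    qed
    thus ?thesis by (rule bij_betw_same_card[symmetric])
  qed
  have "card H * card K = (\<Sum>z\<in>H \<times> K. 1)" by (simp add: card_cartesian_product)
  also have "\<dots> = (\<Sum>x\<in>H <#> K. card {z \<in> H \<times> K. ?f z = x})"
    using sum.image_gen[of "H \<times> K" "\<lambda>_. 1::nat" ?f] fH img by simp
  also have "\<dots> = card (H <#> K) * card (H \<inter> K)" using fib by simp
  finally show ?thesis by simp
qed

lemma subgroup_normalized_mult:
  assumes N: "subgroup N G" and H: "subgroup H G"
    and norm: "\<And>h x. h \<in> H \<Longrightarrow> x \<in> N \<Longrightarrow> conjg G h x \<in> N"
  shows "subgroup (N <#> H) G"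
proof -
  interpret N: subgroup N G by fact
  interpret H: subgroup H G by fact
  show ?thesis
  proof (rule subgroupI)
    show "N <#> H \<subseteq> carrier G" by (simp add: N.subset H.subset setmult_subset_G)
    show "N <#> H \<noteq> {}" using N.one_closed H.one_closed unfolding set_mult_def by blast
    fix a b assume a: "a \<in> N <#> H"
    then obtain n h where 1: "n \<in> N" "h \<in> H" "a = n \<otimes> h" by (auto simp: set_mult_def)
    have "inv a = conjg G (inv h) (inv n) \<otimes> inv h"
      using 1 by (simp add: conjg_def inv_mult_group m_assoc)
    thus "inv a \<in> N <#> H" using 1 norm by (auto simp: set_mult_def)
    assume b: "b \<in> N <#> H"
    then obtain n' h' where 2: "n' \<in> N" "h' \<in> H" "b = n' \<otimes> h'" by (auto simp: set_mult_def)
    have c: "n \<in> carrier G" "h \<in> carrier G" "n' \<in> carrier G" "h' \<in> carrier G" using 1 2 by auto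
    have "a \<otimes> b = (n \<otimes> conjg G h n') \<otimes> (h \<otimes> h')"
      using 1 2 c by (simp add: conjg_def m_assoc inv_solve_left)
    moreover have "n \<otimes> conjg G h n' \<in> N" "h \<otimes> h' \<in> H" using 1 2 norm by auto
    ultimately show "a \<otimes> b \<in> N <#> H" by (auto simp: set_mult_def)
  qed
qed

lemma set_mult_incl:
  assumes "subgroup N G" "subgroup H G"
  shows "N \<subseteq> N <#> H" "H \<subseteq> N <#> H"
proof -
  interpret N: subgroup N G by fact
  interpret H: subgroup H G by fact
  show "N \<subseteq> N <#> H"
  proof
    fix x assume x: "x \<in> N"
    have "x \<otimes> \<one> \<in> N <#> H" using x H.one_closed unfolding set_mult_def by blast
    thus "x \<in> N <#> H" using x by simp
  qed
  show "H \<subseteq> N <#> H"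
  proof
    fix x assume x: "x \<in> H"
    have "\<one> \<otimes> x \<in> N <#> H" using x N.one_closed unfolding set_mult_def by blast
    thus "x \<in> N <#> H" using x by simp
  qed
qed

lemma set_mult_least: "subgroup L G \<Longrightarrow> N \<subseteq> L \<Longrightarrow> H \<subseteq> L \<Longrightarrow> N <#> H \<subseteq> L"
  by (auto simp: set_mult_def subgroup.m_closed subset_iff)

lemma card_set_mult_coprime:
  assumes "subgroup H G" "subgroup K G" "coprime (card H) (card K)"
  shows "card (H <#> K) = card H * card K" "H \<inter> K = {\<one>}"
proof -
  have s: "subgroup (H \<inter> K) G" using assms subgroups_Inter_pair by blast
  have "card (H \<inter> K) dvd card H" "card (H \<inter> K) dvd card K"
    using s assms by (auto intro: card_subgroup_dvd)
  hence c: "card (H \<inter> K) = 1" using assms(3) coprime_common_divisor_nat by blast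
  thus "card (H <#> K) = card H * card K" using card_set_mult[OF assms(1,2)] by simp
  show "H \<inter> K = {\<one>}" using c s by (metis card_1_singletonE singletonD subgroup.one_closed)
qed

lemma sylow_exists:
  assumes "prime p" "p ^ a dvd card (carrier G)"
  shows "\<exists>S. subgroup S G \<and> card S = p ^ a"
  using assms sylow_thm[of p G a] fin by (auto simp: order_def dvd_def)

lemma sylow_in_subgroup:
  assumes "prime p" "subgroup H G" "p ^ a dvd card H"
  shows "\<exists>S. subgroup S G \<and> S \<subseteq> H \<and> card S = p ^ a"
proof -
  interpret H: finite_group "G\<restriction>H" using assms subgroup_finite_group by blast
  obtain S where "subgroup S (G\<restriction>H)" "card S = p ^ a"
    using H.sylow_exists[of p a] assms by auto
  thus ?thesis using incl_subgroup[OF assms(2)] subgroup.subset by fastforce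
qed

lemma generate_cyclic:
  assumes "x \<in> carrier G"
  shows "subgroup (generate G {x}) G" "x \<in> generate G {x}"
  using assms generate_is_subgroup by (auto intro: generate.incl)

lemma generate_nat:
  assumes "x \<in> carrier G"
  shows "generate G {x} = {x [^] k | k :: nat. True}"
proof -
  have "ord x \<noteq> 0" using assms by (metis card_0_eq empty_iff finite_subgroup generate_cyclic generate_pow_card)
  thus ?thesis using generate_pow_nat[OF assms] by simp
qed

text \<open>This replaces the decomposition of an element into its primary parts: a subgroup that contains a Sylow
subgroup for each prime, for instance because it contains all primary elements, is the whole group.\<close>

lemma subgroup_eq_carrierI:
  assumes Z: "subgroup Z G"
    and "\<And>q n. prime q \<Longrightarrow> q ^ n dvd card (carrier G) \<Longrightarrow> q ^ n dvd card Z"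
  shows "Z = carrier G"
proof -
  have "card (carrier G) dvd card Z"
  proof (rule multiplicity_le_imp_dvd)
    show "card (carrier G) \<noteq> 0" using card_pos subgroup_self by fastforce
    fix p :: nat assume p: "prime p"
    have "p ^ multiplicity p (card (carrier G)) dvd card Z"
      using assms(2) p multiplicity_dvd by blast
    thus "multiplicity p (card (carrier G)) \<le> multiplicity p (card Z)"
      by (metis Z card_pos multiplicity_geI neq0_conv not_prime_unit p)
  qed
  thus ?thesis using subgroup_eqI[OF Z subgroup_self] Z card_pos
    by (simp add: dvd_imp_le subgroup.subset)
qed

end

section \<open>Fixed points of p-groups\<close>

lemma (in group) group_actionI:
  assumes "\<And>g x. g \<in> carrier G \<Longrightarrow> x \<in> E \<Longrightarrow> f g x \<in> E"
    and "\<And>x. x \<in> E \<Longrightarrow> f \<one> x = x"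
    and "\<And>g h x. g \<in> carrier G \<Longrightarrow> h \<in> carrier G \<Longrightarrow> x \<in> E \<Longrightarrow> f (g \<otimes> h) x = f g (f h x)"
  shows "group_action G E (\<lambda>g. restrict (f g) E)"
proof -
  have inv: "f (inv g) (f g x) = x" "f g (f (inv g) x) = x" if "g \<in> carrier G" "x \<in> E" for g x
    using that assms by (metis inv_closed l_inv r_inv)+
  have "bij_betw (f g) E E" if "g \<in> carrier G" for g
    by (rule bij_betw_byWitness[where f' = "f (inv g)"]) (use that assms inv in auto)
  hence "restrict (f g) E \<in> Bij E" if "g \<in> carrier G" for g
    using that by (simp add: Bij_def bij_betw_restrict_eq)
  thus ?thesis
    unfolding group_action_def
    by (intro group_hom.intro group_hom_axioms.intro is_group group_BijGroup homI)
       (use assms in \<open>auto simp: BijGroup_def compose_def fun_eq_iff\<close>)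
qed

lemma (in finite_group) fixed_points_cong:
  assumes p: "prime p" and card: "card (carrier G) = p ^ n" and E: "finite E"
    and a1: "\<And>g x. g \<in> carrier G \<Longrightarrow> x \<in> E \<Longrightarrow> f g x \<in> E"
    and a2: "\<And>x. x \<in> E \<Longrightarrow> f \<one> x = x"
    and a3: "\<And>g h x. g \<in> carrier G \<Longrightarrow> h \<in> carrier G \<Longrightarrow> x \<in> E \<Longrightarrow> f (g \<otimes> h) x = f g (f h x)"
  shows "card {x \<in> E. \<forall>g\<in>carrier G. f g x = x} mod p = card E mod p"
proof -
  let ?\<phi> = "\<lambda>g. restrict (f g) E" and ?F = "{x \<in> E. \<forall>g\<in>carrier G. f g x = x}"
  interpret action: group_action G E ?\<phi> by (rule group_actionI) (use assms in auto)
  let ?o = "\<lambda>x. orbit G ?\<phi> x"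
  have oE: "?o x \<subseteq> E" if "x \<in> E" for x using that a1 by (auto simp: orbit_def)
  have self: "x \<in> ?o x" if "x \<in> E" for x using action.orbit_refl that .
  have sub: "?o y \<subseteq> ?o x" if x: "x \<in> E" and y: "y \<in> ?o x" for x y
  proof
    fix z assume z: "z \<in> ?o y"
    have "y \<in> E" "z \<in> E" using oE x y z by blast+
    thus "z \<in> ?o x" using action.orbit_trans x y z by blast
  qed
  have eq: "?o z = ?o x" if x: "x \<in> E" and z: "z \<in> ?o x" for x z
  proof -
    have "z \<in> E" using oE x z by blast
    thus ?thesis using sub x z action.orbit_sym by blast
  qed
  have same: "?o x = ?o y" if "x \<in> E" "y \<in> E" "z \<in> ?o x" "z \<in> ?o y" for x y z
    using that eq by metis
  have dv: "p dvd card (?o x)" if x: "x \<in> E - ?F" for x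
  proof -
    have xE: "x \<in> E" using x by blast
    have "card (?o x) * card (stabilizer G ?\<phi> x) = p ^ n"
      using action.orbit_stabilizer_theorem[OF xE] card by (simp add: order_def)
    hence "card (?o x) dvd p ^ n" by (rule dvdI[OF sym])
    then obtain i where i: "card (?o x) = p ^ i" using p divides_primepow_nat by blast
    have "i \<noteq> 0"
    proof
      assume "i = 0"
      hence "card (?o x) = 1" using i by simp
      then obtain z where "?o x = {z}" by (rule card_1_singletonE)
      hence "?o x = {x}" using self[OF xE] by simp
      moreover have "f g x \<in> ?o x" if g: "g \<in> carrier G" for g
      proof -
        have "?\<phi> g x \<in> ?o x" using g unfolding orbit_def by blast
        thus ?thesis using x by simp
      qed
      ultimately show False using x by auto
    qed
    thus ?thesis using i by simp
  qed
  have un: "\<Union>(?o ` (E - ?F)) = E - ?F"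
  proof
    show "E - ?F \<subseteq> \<Union>(?o ` (E - ?F))" using self by auto
    show "\<Union>(?o ` (E - ?F)) \<subseteq> E - ?F"
    proof
      fix y assume "y \<in> \<Union>(?o ` (E - ?F))"
      then obtain x where x: "x \<in> E - ?F" "y \<in> ?o x" by blast
      have yE: "y \<in> E" using x oE by blast
      have "y \<notin> ?F"
      proof
        assume y: "y \<in> ?F"
        have "x \<in> ?o y" using x action.orbit_sym yE by blast
        hence "x = y" using y by (auto simp: orbit_def)
        thus False using x y by blast
      qed
      thus "y \<in> E - ?F" using yE by blast
    qed
  qed
  have "p dvd card (\<Union>(?o ` (E - ?F)))"
  proof (rule dvd_partition)
    show "finite (\<Union>(?o ` (E - ?F)))" unfolding un using E by simp
    show "\<forall>c\<in>?o ` (E - ?F). p dvd card c" using dv by auto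
    show "\<forall>c1\<in>?o ` (E - ?F). \<forall>c2\<in>?o ` (E - ?F). c1 \<noteq> c2 \<longrightarrow> c1 \<inter> c2 = {}"
      using same by blast
  qed
  hence "p dvd card (E - ?F)" unfolding un .
  then obtain k where k: "card (E - ?F) = p * k" by (rule dvdE)
  have "E \<inter> ?F = ?F" by blast
  hence "card E = card ?F + p * k" using card_Int_Diff[OF E, of ?F] k by (simp only:)
  thus ?thesis by simp
qed

context finite_group
begin

text \<open>The group \<open>R\<close> acts on the right cosets of \<open>H\<close> by multiplication, and \<open>H g\<close> is fixed exactly if
\<open>g R g\<^sup>-\<^sup>1 \<subseteq> H\<close>. With suitable \<open>H\<close> and \<open>R\<close> this one congruence gives Sylow's containment theorem, the growth of
normalizers in \<open>p\<close>-groups and the behaviour of \<open>p\<close>-subgroups along chains of prime index.\<close>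

lemma fixed_cosets_cong:
  assumes p: "prime p" and R: "subgroup R G" "card R = p ^ n" and H: "subgroup H G"
  shows "card {H #> g | g. g \<in> carrier G \<and> conjg G g ` R \<subseteq> H} mod p = card (rcosets H) mod p"
proof -
  interpret R: subgroup R G by fact
  interpret H: subgroup H G by fact
  interpret RG: finite_group "G\<restriction>R" using R subgroup_finite_group by blast
  have fE: "finite (rcosets H)" using fin by (simp add: RCOSETS_def)
  have cl: "C \<subseteq> carrier G" if "C \<in> rcosets H" for C using that H.rcosets_carrier is_group by blast
  \<comment> \<open>The inverse turns the right multiplication into a left action.\<close>
  have "card {C \<in> rcosets H. \<forall>r\<in>carrier (G\<restriction>R). C #> inv r = C} mod p = card (rcosets H) mod p"
  proof (rule RG.fixed_points_cong[OF p _ fE])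
    show "card (carrier (G\<restriction>R)) = p ^ n" using R by simp
    fix C assume C: "C \<in> rcosets H"
    show "C #> inv \<one>\<^bsub>G\<restriction>R\<^esub> = C" using cl[OF C] by simp
    fix g assume g: "g \<in> carrier (G\<restriction>R)"
    show "C #> inv g \<in> rcosets H"
      using C g H.subset by (auto simp: RCOSETS_def coset_mult_assoc)
    fix h assume h: "h \<in> carrier (G\<restriction>R)"
    show "C #> inv (g \<otimes>\<^bsub>G\<restriction>R\<^esub> h) = C #> inv h #> inv g"
      using g h cl[OF C] by (simp add: inv_mult_group coset_mult_assoc)
  qed
  moreover have "{C \<in> rcosets H. \<forall>r\<in>carrier (G\<restriction>R). C #> inv r = C}
      = {H #> g | g. g \<in> carrier G \<and> conjg G g ` R \<subseteq> H}" (is "?A = ?B")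
  proof -
    have key: "(\<forall>r\<in>R. H #> g #> inv r = H #> g) \<longleftrightarrow> conjg G g ` R \<subseteq> H" if g: "g \<in> carrier G" for g
    proof -
      have "H #> g #> inv r = H #> g \<longleftrightarrow> conjg G g r \<in> H" if r: "r \<in> R" for r
      proof -
        have "H #> g #> inv r = H #> (g \<otimes> inv r)" using g r H.subset by (simp add: coset_mult_assoc)
        moreover have "H #> (g \<otimes> inv r) = H #> g \<longleftrightarrow> g \<in> H #> (g \<otimes> inv r)"
          using g r repr_independence[OF _ _ H, of g "g \<otimes> inv r"] rcos_self[OF g H] by auto
        moreover have "g \<in> H #> (g \<otimes> inv r) \<longleftrightarrow> conjg G g r \<in> H"
          using g r H.rcos_module[OF is_group, of "g \<otimes> inv r" g] by (simp add: conjg_def inv_mult_group m_assoc)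
        ultimately show ?thesis by simp
      qed
      thus ?thesis by auto
    qed
    show ?thesis
    proof
      show "?A \<subseteq> ?B" using key by (auto simp: RCOSETS_def)
      show "?B \<subseteq> ?A" using key H.subset by (auto simp: rcosetsI)
    qed
  qed
  ultimately show ?thesis by simp
qed

lemma sylow_contain:
  assumes p: "prime p" and R: "subgroup R G" "card R = p ^ n" and H: "subgroup H G"
    and ndvd: "\<not> p dvd card (carrier G) div card H"
  shows "\<exists>g\<in>carrier G. conjg G g ` R \<subseteq> H"
proof -
  have "card (rcosets H) = card (carrier G) div card H"
    using lagrange[OF H] card_pos[OF H] by (metis div_mult_self_is_m order_def)
  hence "card {H #> g | g. g \<in> carrier G \<and> conjg G g ` R \<subseteq> H} mod p \<noteq> 0"
    using fixed_cosets_cong[OF p R H] ndvd by (simp add: dvd_eq_mod_eq_0)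
  hence "{H #> g | g. g \<in> carrier G \<and> conjg G g ` R \<subseteq> H} \<noteq> {}" by (metis card.empty mod_0)
  thus ?thesis by blast
qed

end

section \<open>Quotients and normalizers\<close>

lemma finite_max_card:
  assumes "finite P" "A \<in> P" shows "\<exists>S\<in>P. \<forall>T\<in>P. card T \<le> card S"
proof -
  have "Max (card ` P) \<in> card ` P" using assms by (intro Max_in) auto
  then obtain S where "S \<in> P" "Max (card ` P) = card S" by blast
  thus ?thesis using assms Max_ge[of "card ` P"] by (metis finite_imageI imageI)
qed

lemma (in group) conjg_eq_conj:
  assumes "g \<in> carrier G" "c \<in> carrier G" "s \<in> carrier G"
  shows "conjg G g (conjg G (conjg G (inv g) c) s) = conjg G c (conjg G g s)"
proof -
  have "g \<otimes> conjg G (inv g) c = c \<otimes> g"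
    using assms by (simp add: conjg_def flip: m_assoc)
  thus ?thesis using assms by (simp add: conjg_conjg)
qed

lemma (in group) group_hom_Mod: "N \<lhd> G \<Longrightarrow> group_hom G (G Mod N) (\<lambda>x. N #> x)"
  by (intro group_hom.intro group_hom_axioms.intro is_group normal.factorgroup_is_group normal.r_coset_hom_Mod)

lemma (in group) Mod_one_iff:
  assumes "N \<lhd> G" "x \<in> carrier G"
  shows "N #> x = \<one>\<^bsub>G Mod N\<^esub> \<longleftrightarrow> x \<in> N"
proof -
  have N: "subgroup N G" using assms(1) by (rule normal_imp_subgroup)
  have "\<one>\<^bsub>G Mod N\<^esub> = N" by (simp add: FactGroup_def)
  thus ?thesis using coset_join1[OF _ assms(2) N] coset_join2[OF assms(2) N] by metis
qed

lemma carrier_Mod: "carrier (G Mod N) = (\<lambda>x. N #>\<^bsub>G\<^esub> x) ` carrier G"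
  by (auto simp: FactGroup_def RCOSETS_def)

context finite_group
begin

lemma finite_group_Mod:
  assumes "N \<lhd> G" shows "finite_group (G Mod N)"
  using normal.factorgroup_is_group[OF assms] fin
  by (simp add: finite_group_def finite_group_axioms_def carrier_Mod)

lemma card_Mod:
  assumes "N \<lhd> G" shows "card (carrier (G Mod N)) * card N = card (carrier G)"
  using lagrange[OF normal_imp_subgroup[OF assms]] by (simp add: FactGroup_def order_def)

text \<open>Inductions on the group order cannot enter a quotient, whose elements have another type. Subgroups found in a quotient are
therefore replaced by their preimages.\<close>

lemma Mod_preimage:
  assumes N: "N \<lhd> G" and A: "subgroup A (G Mod N)"
  shows "subgroup (\<Union>A) G" "N \<subseteq> \<Union>A" "card (\<Union>A) = card A * card N"
    and "\<Union>A = {x \<in> carrier G. N #> x \<in> A}"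
proof -
  interpret normal N G by fact
  show s: "subgroup (\<Union>A) G" by (rule factgroup_subgroup_union_subgroup[OF A])
  have "N \<in> A" using subgroup.one_closed[OF A] by (simp add: FactGroup_def)
  thus NA: "N \<subseteq> \<Union>A" by blast
  show "\<Union>A = {x \<in> carrier G. N #> x \<in> A}" by (rule factgroup_subgroup_union_char[OF A])
  interpret U: finite_group "G\<lparr>carrier := \<Union>A\<rparr>" using s subgroup_finite_group by blast
  have "card (rcosets\<^bsub>G\<lparr>carrier := \<Union>A\<rparr>\<^esub> N) * card N = card (\<Union>A)"
    using U.lagrange[OF subgroup_incl[OF subgroup_axioms s NA]] by (simp add: order_def)
  thus "card (\<Union>A) = card A * card N"
    using factgroup_subgroup_union_factor[OF A] by simp
qed

lemma prime_over_normal: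
  assumes N: "N \<lhd> G" and p: "prime p" and d: "p * card N dvd card (carrier G)"
  shows "\<exists>L. subgroup L G \<and> N \<subseteq> L \<and> card L = p * card N"
proof -
  interpret Q: finite_group "G Mod N" using finite_group_Mod[OF N] .
  have "0 < card N" using N normal_imp_subgroup card_pos by blast
  hence "p dvd card (carrier (G Mod N))" using d card_Mod[OF N] by (metis dvd_mult_cancel2 nat_dvd_1_iff_1 nat_mult_dvd_cancel_disj mult.commute not_gr_zero)
  then obtain A where "subgroup A (G Mod N)" "card A = p ^ 1"
    using Q.sylow_exists[OF p, of 1] by auto
  thus ?thesis using Mod_preimage[OF N] by (metis power_one_right)
qed

end

definition normalizer_of :: "('a, 'b) monoid_scheme \<Rightarrow> 'a set \<Rightarrow> 'a set" where
  "normalizer_of G H = {g \<in> carrier G. conjg G g ` H \<subseteq> H}"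

context finite_group
begin

lemma normalizer_eq:
  assumes "g \<in> normalizer_of G H" "H \<subseteq> carrier G" shows "conjg G g ` H = H"
  using assms card_conjg[of g H] finite_sub[of H]
  by (simp add: normalizer_of_def card_subset_eq)

lemma normalizer_subgroup:
  assumes "H \<subseteq> carrier G" shows "subgroup (normalizer_of G H) G"
proof (rule subgroupI)
  show "normalizer_of G H \<subseteq> carrier G" by (auto simp: normalizer_of_def)
  have "\<one> \<in> normalizer_of G H" using assms by (auto simp: normalizer_of_def)
  thus "normalizer_of G H \<noteq> {}" by blast
  fix a assume a: "a \<in> normalizer_of G H"
  hence c: "a \<in> carrier G" by (simp add: normalizer_of_def)
  have "conjg G (inv a) ` H = conjg G (inv a) ` conjg G a ` H" using normalizer_eq[OF a assms] by simp
  also have "\<dots> = H" using c assms by (simp add: conjg_image_conjg conjg_image_one)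
  finally show "inv a \<in> normalizer_of G H" using c by (simp add: normalizer_of_def)
  fix b assume b: "b \<in> normalizer_of G H"
  hence bc: "b \<in> carrier G" by (simp add: normalizer_of_def)
  have "conjg G (a \<otimes> b) ` H = conjg G a ` conjg G b ` H"
    using c bc assms by (simp only: conjg_image_conjg)
  also have "\<dots> = H" using normalizer_eq[OF a assms] normalizer_eq[OF b assms] by simp
  finally show "a \<otimes> b \<in> normalizer_of G H" using c bc by (simp add: normalizer_of_def)
qed

lemma normalizer_incl: "subgroup H G \<Longrightarrow> H \<subseteq> normalizer_of G H"
  by (auto simp: normalizer_of_def subgroup.mem_carrier conjg_in_subgroup)

lemma normal_in_normalizer:
  assumes "subgroup H G" shows "H \<lhd> G\<restriction>normalizer_of G H"
proof -
  note N = normalizer_subgroup[OF subgroup.subset[OF assms]]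
  interpret N: group "G\<restriction>normalizer_of G H" using N subgroup_imp_group by blast
  show ?thesis
  proof (rule N.normal_conjgI)
    show "subgroup H (G\<restriction>normalizer_of G H)"
      using subgroup_incl[OF assms N normalizer_incl[OF assms]] .
  qed (use N in \<open>auto simp: conjg_consistent normalizer_of_def\<close>)
qed

lemma mult_normal_subgroup: "M \<lhd> G \<Longrightarrow> subgroup H G \<Longrightarrow> subgroup (M <#> H) G"
  by (rule subgroup_normalized_mult) (auto simp: normal_imp_subgroup conjg_normal subgroup.mem_carrier)

text \<open>Modulo \<open>M\<close> this is the statement that a proper subgroup of a \<open>p\<close>-group has index \<open>p\<close> in a subgroup of its normalizer.
A Sylow \<open>p\<close>-subgroup \<open>R\<close> of \<open>H\<close> satisfies \<open>M R = H\<close>, and \<open>M\<close> fixes all cosets of \<open>H\<close>, so the cosets of \<open>H\<close> fixed by \<open>R\<close> form the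
quotient of the normalizer by \<open>H\<close>. Their number is divisible by \<open>p\<close>, and \<open>H\<close> itself is one of them.\<close>

lemma index_p_above:
  assumes p: "prime p" and M: "M \<lhd> G" and card: "card (carrier G) = p ^ k * card M"
    and H: "subgroup H G" "M \<subseteq> H" "H \<noteq> carrier G"
  shows "\<exists>L. subgroup L G \<and> H \<subseteq> L \<and> card L = p * card H \<and> L \<subseteq> normalizer_of G H"
proof -
  have Ms: "subgroup M G" using M normal_imp_subgroup by blast
  have M0: "card M > 0" "card H > 0" using card_pos Ms H by auto
  obtain u where u: "card H = card M * u" using card_subgroup_dvd[OF Ms H(1,2)] by blast
  obtain v where v: "card (carrier G) = card H * v" using card_subgroup_dvd_order[OF H(1)] by blast
  have "p ^ k = u * v" using card u v M0 by auto
  then obtain j where j: "u = p ^ j" using p divides_primepow_nat by (metis dvd_triv_left)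
  have div_p: "p dvd w" if "w dvd v" "w \<noteq> 1" for w
  proof -
    have "w dvd p ^ k" using that \<open>p ^ k = u * v\<close> by simp
    then obtain i where "w = p ^ i" using p divides_primepow_nat by blast
    thus ?thesis using that by (cases i) auto
  qed
  define a where "a = multiplicity p (card H)"
  obtain R where R: "subgroup R G" "R \<subseteq> H" "card R = p ^ a"
    using sylow_in_subgroup[OF p H(1)] multiplicity_dvd unfolding a_def by blast
  interpret HG: finite_group "G\<restriction>H" using H subgroup_finite_group by blast
  have MR: "subgroup (M <#> R) G" by (rule mult_normal_subgroup[OF M R(1)])
  have MRH: "M <#> R = H"
  proof -
    have "M <#> R = carrier (G\<restriction>H)"
    proof (rule HG.subgroup_eq_carrierI)
      show "subgroup (M <#> R) (G\<restriction>H)"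
        by (rule subgroup_incl[OF MR H(1) set_mult_least[OF H(1,2) R(2)]])
      fix q n assume q: "prime q" and n: "q ^ n dvd card (carrier (G\<restriction>H))"
      have dv: "card M dvd card (M <#> R)" "card R dvd card (M <#> R)"
        using set_mult_incl[OF Ms R(1)] Ms R(1) MR card_subgroup_dvd by blast+
      show "q ^ n dvd card (M <#> R)"
      proof (cases "q = p")
        case True
        have "n \<le> a" unfolding a_def
          by (rule multiplicity_geI) (use n True M0 prime_gt_1_nat[OF p] in auto)
        thus ?thesis using True R dv le_imp_power_dvd dvd_trans by metis
      next
        case False
        hence "coprime (q ^ n) (p ^ j)" using p q primes_coprime by auto
        hence "q ^ n dvd card M" using n u j by (simp add: coprime_dvd_mult_left_iff)
        thus ?thesis using dv dvd_trans by blast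
      qed
    qed
    thus ?thesis by simp
  qed
  let ?F = "{H #> g | g. g \<in> carrier G \<and> conjg G g ` R \<subseteq> H}"
  have "card (rcosets H) * card H = card H * v" using lagrange[OF H(1)] v by (simp add: order_def)
  hence rc: "card (rcosets H) = v" using M0 by simp
  have "v \<noteq> 1" using v H subgroup_eqI[OF H(1) subgroup_self] subgroup.subset by fastforce
  hence "p dvd card ?F" using fixed_cosets_cong[OF p R(1,3) H(1)] div_p[of v] rc by (simp add: mod_eq_0_iff_dvd)
  have HF: "H \<in> ?F" using R H subgroup.subset[OF H(1)] subgroup.subset[OF R(1)] conjg_image_one[of R]
      coset_mult_one[of H] by (metis (mono_tags, lifting) mem_Collect_eq one_closed)
  have "?F \<noteq> {H}" using \<open>p dvd card ?F\<close> p by auto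
  then obtain g where g: "g \<in> carrier G" "conjg G g ` R \<subseteq> H" "H #> g \<noteq> H" using HF by blast
  have gH: "g \<notin> H" using g coset_join2[OF g(1) H(1)] by blast
  have gN: "g \<in> normalizer_of G H"
  proof -
    have "conjg G g (m \<otimes> r) \<in> H" if "m \<in> M" "r \<in> R" for m r
    proof -
      have "m \<in> carrier G" "r \<in> carrier G" using that Ms R by (auto intro: sub_mem)
      moreover have "conjg G g m \<in> H" using that M H g conjg_normal by blast
      moreover have "conjg G g r \<in> H" using that g by blast
      ultimately show ?thesis using g H by (simp add: conjg_mult subgroup.m_closed)
    qed
    hence "conjg G g ` (M <#> R) \<subseteq> H" by (auto simp: set_mult_def)
    thus ?thesis using g unfolding MRH normalizer_of_def by blast
  qed
  let ?N = "normalizer_of G H"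
  have N: "subgroup ?N G" using normalizer_subgroup subgroup.subset[OF H(1)] by blast
  interpret NG: finite_group "G\<restriction>?N" using N subgroup_finite_group by blast
  obtain w where w: "card ?N = card H * w" using card_subgroup_dvd[OF H(1) N normalizer_incl[OF H(1)]] by blast
  have "card H * w dvd card H * v" using card_subgroup_dvd_order[OF N] w v by simp
  hence "w dvd v" using M0 by simp
  moreover have "w \<noteq> 1" using subgroup_eqI[OF H(1) N normalizer_incl[OF H(1)]] w gN gH by auto
  ultimately have "p dvd w" using div_p by blast
  hence "p * card H dvd card (carrier (G\<restriction>?N))" using w by simp
  then obtain L where "subgroup L (G\<restriction>?N)" "H \<subseteq> L" "card L = p * card H"
    using NG.prime_over_normal[OF normal_in_normalizer[OF H(1)] p] by blast
  thus ?thesis using incl_subgroup[OF N] subgroup.subset by fastforce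
qed

lemma prime_index_between:
  assumes "subgroup H G" "subgroup K G" "prime q" "card K = q * card H"
    and "subgroup Z G" "H \<subseteq> Z" "Z \<subseteq> K"
  shows "Z = H \<or> Z = K"
proof -
  have h: "card H > 0" using assms card_pos by blast
  obtain u where u: "card Z = card H * u" using card_subgroup_dvd[of H Z] assms by blast
  have "card H * u dvd card H * q" using card_subgroup_dvd[of Z K] assms u by (simp add: mult.commute)
  hence "u dvd q" using h by simp
  hence "u = 1 \<or> u = q" using assms(3) prime_nat_iff by blast
  thus ?thesis using subgroup_eqI[of H Z] subgroup_eqI[of Z K] assms u by auto
qed

end

section \<open>Chains of prime index\<close>

text \<open>A subgroup of prime index is maximal, so the maximality demanded in the definition of P-subnormality
holds automatically (\<open>P_subnormal_iff_prime_chain\<close>). The upper end is kept variable in order to glue chains.\<close>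

inductive prime_chain :: "('a, 'b) monoid_scheme \<Rightarrow> 'a set \<Rightarrow> 'a set \<Rightarrow> bool" for G H where
  refl: "subgroup H G \<Longrightarrow> prime_chain G H H"
| step: "prime_chain G H K \<Longrightarrow> subgroup L G \<Longrightarrow> K \<subseteq> L \<Longrightarrow> prime q
          \<Longrightarrow> card L = q * card K \<Longrightarrow> prime_chain G H L"

lemma prime_chain_subgroups:
  "prime_chain G H K \<Longrightarrow> subgroup H G \<and> subgroup K G \<and> H \<subseteq> K"
  by (induction rule: prime_chain.induct) auto

lemma prime_chain_trans:
  "prime_chain G K L \<Longrightarrow> prime_chain G H K \<Longrightarrow> prime_chain G H L"
  by (induction rule: prime_chain.induct) (auto intro: prime_chain.step)

lemma prime_chain_step_le:
  assumes "prime_chain G H K" "subgroup L G" "K \<subseteq> L" "L = K \<or> (\<exists>q. prime q \<and> card L = q * card K)"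
  shows "prime_chain G H L"
  using assms prime_chain.step by blast

context group
begin

lemma prime_chain_from_subgroup:
  assumes "prime_chain (G\<restriction>K) H L" "subgroup K G" shows "prime_chain G H L"
  using assms(1)
  by (induction rule: prime_chain.induct) (auto intro: prime_chain.intros incl_subgroup[OF assms(2)])

lemma prime_chain_in_subgroup:
  assumes "prime_chain G H L" "subgroup K G" "L \<subseteq> K" shows "prime_chain (G\<restriction>K) H L"
  using assms(1,3)
proof (induction rule: prime_chain.induct)
  case refl thus ?case using assms(2) subgroup_incl by (blast intro: prime_chain.refl)
next
  case (step L' L q)
  have "subgroup L (G\<restriction>K)" using step assms(2) subgroup_incl by blast
  thus ?case using step by (blast intro: prime_chain.step)
qed

end

context finite_group
begin

lemma prime_chain_normal_mult:
  assumes L: "L \<lhd> G" and "prime_chain G H K"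
  shows "prime_chain G (L <#> H) (L <#> K)"
  using assms(2)
proof (induction rule: prime_chain.induct)
  case refl thus ?case using L mult_normal_subgroup by (blast intro: prime_chain.refl)
next
  case (step K M q)
  have Ls: "subgroup L G" using L normal_imp_subgroup by blast
  have K: "subgroup K G" using step prime_chain_subgroups by blast
  have LK: "subgroup (L <#> K) G" and LM: "subgroup (L <#> M) G"
    using mult_normal_subgroup L K step by auto
  have "M \<inter> (L <#> K) = K \<or> M \<inter> (L <#> K) = M"
    by (rule prime_index_between[OF K \<open>subgroup M G\<close> \<open>prime q\<close> \<open>card M = _\<close>])
       (use step LK subgroups_Inter_pair set_mult_incl[OF Ls K] in auto)
  hence "L <#> M = L <#> K \<or> card (L <#> M) = q * card (L <#> K)"
  proof
    assume a: "M \<inter> (L <#> K) = M"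
    hence "L <#> M \<subseteq> L <#> K" using set_mult_least[OF LK] set_mult_incl[OF Ls K] by blast
    moreover have "L <#> K \<subseteq> L <#> M" using step by (simp add: mono_set_mult)
    ultimately show ?thesis by blast
  next
    assume a: "M \<inter> (L <#> K) = K"
    have "L \<inter> M = L \<inter> K" using a set_mult_incl[OF Ls K] step by blast
    moreover have "0 < card (L \<inter> K)" using card_pos subgroups_Inter_pair Ls K by blast
    moreover have "card (L <#> M) * card (L \<inter> K) = card L * (q * card K)"
      using card_set_mult[OF Ls \<open>subgroup M G\<close>] \<open>card M = _\<close> calculation(1) by simp
    moreover have "(q * card (L <#> K)) * card (L \<inter> K) = card L * (q * card K)"
      using card_set_mult[OF Ls K] by (simp add: mult.assoc)
    ultimately have "card (L <#> M) = q * card (L <#> K)"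
      by (metis mult_cancel_right neq0_conv)
    thus ?thesis ..
  qed
  thus ?case using step LM by (intro prime_chain_step_le[OF step.IH LM]) (auto simp: mono_set_mult)
qed

lemma card_hom_image:
  assumes "group_hom G Q f" "subgroup K G"
  shows "card (f ` K) * card {x \<in> K. f x = \<one>\<^bsub>Q\<^esub>} = card K"
proof -
  interpret f0: group_hom G Q f by fact
  interpret f: group_hom "G\<restriction>K" "Q\<lparr>carrier := f ` K\<rparr>" f
    by (rule f0.group_hom_restrict[OF assms(2)])
  interpret KG: finite_group "G\<restriction>K" using assms subgroup_finite_group by blast
  let ?N = "kernel (G\<restriction>K) (Q\<lparr>carrier := f ` K\<rparr>) f"
  have "order (G\<restriction>K Mod ?N) = order (Q\<lparr>carrier := f ` K\<rparr>)"
    by (rule iso_same_order[OF f.FactGroup_iso_set]) simp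
  thus ?thesis using KG.card_Mod[OF f.normal_kernel] by (simp add: order_def kernel_def)
qed

text \<open>\<open>N H\<close> lies between \<open>H\<close> and \<open>K\<close>, so it is one of the two. Hence intersecting with a normal subgroup, or factoring it
out, turns a prime index into the same prime or into 1.\<close>

lemma prime_index_normal_inter:
  assumes H: "subgroup H G" and K: "subgroup K G" and HK: "H \<subseteq> K" and q: "prime q"
    and card: "card K = q * card H" and N: "N \<lhd> G\<restriction>K"
  shows "N \<subseteq> H \<or> card N = q * card (N \<inter> H)"
proof -
  interpret KG: finite_group "G\<restriction>K" using K subgroup_finite_group by blast
  have HKs: "subgroup H (G\<restriction>K)" using subgroup_incl[OF H K HK] .
  have Ns: "subgroup N (G\<restriction>K)" using N normal_imp_subgroup by blast
  have "subgroup (N <#> H) (G\<restriction>K)" using KG.mult_normal_subgroup[OF N HKs] by simp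
  moreover have i: "N \<subseteq> N <#> H" "H \<subseteq> N <#> H" using KG.set_mult_incl[OF Ns HKs] by auto
  ultimately have "N <#> H = H \<or> N <#> H = K"
    using KG.prime_index_between[OF HKs KG.subgroup_self q] card subgroup.subset by fastforce
  thus ?thesis
  proof
    assume "N <#> H = K"
    moreover have "0 < card H" using H card_pos by blast
    ultimately show ?thesis using KG.card_set_mult[OF Ns HKs] card by (simp add: mult.commute)
  qed (use i in auto)
qed

lemma prime_chain_image:
  assumes f: "group_hom G Q f" and c: "prime_chain G H K"
  shows "prime_chain Q (f ` H) (f ` K)"
  using c
proof (induction rule: prime_chain.induct)
  case refl thus ?case using group_hom.subgroup_img_is_subgroup[OF f] by (blast intro: prime_chain.refl)
next
  case (step K M q)
  have K: "subgroup K G" using step prime_chain_subgroups by blast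
  interpret M: finite_group "G\<restriction>M" using step subgroup_finite_group by blast
  interpret fM: group_hom "G\<restriction>M" Q f using group_hom.induced_group_hom'[OF f \<open>subgroup M G\<close>] .
  let ?N = "kernel (G\<restriction>M) Q f"
  have Ndef: "?N = {x \<in> M. f x = \<one>\<^bsub>Q\<^esub>}" "?N \<inter> K = {x \<in> K. f x = \<one>\<^bsub>Q\<^esub>}" using step by (auto simp: kernel_def)
  have "?N \<subseteq> K \<or> card ?N = q * card (?N \<inter> K)"
    by (rule prime_index_normal_inter[OF K \<open>subgroup M G\<close> \<open>K \<subseteq> M\<close> \<open>prime q\<close> \<open>card M = _\<close> fM.normal_kernel])
  moreover have c1: "card (f ` M) * card ?N = card M" using card_hom_image[OF f \<open>subgroup M G\<close>] Ndef by simp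
  moreover have c2: "card (f ` K) * card (?N \<inter> K) = card K" using card_hom_image[OF f K] Ndef by simp
  moreover have pos: "0 < card ?N" "0 < card (?N \<inter> K)" "0 < q"
    using c1 c2 card_pos[OF \<open>subgroup M G\<close>] card_pos[OF K] \<open>prime q\<close>
    by (auto simp: prime_gt_0_nat intro!: Nat.gr0I)
  have "f ` M = f ` K \<or> card (f ` M) = q * card (f ` K)"
    using calculation(1)
  proof
    assume "?N \<subseteq> K"
    hence "?N \<inter> K = ?N" by blast
    hence "card (f ` M) * card ?N = (q * card (f ` K)) * card ?N"
      using c1 c2 \<open>card M = _\<close> by (metis mult.assoc)
    thus ?thesis using pos by auto
  next
    assume a: "card ?N = q * card (?N \<inter> K)"
    have "card (f ` M) * (q * card (?N \<inter> K)) = card (f ` K) * (q * card (?N \<inter> K))"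
      using c1 c2 a \<open>card M = _\<close> by (metis mult.left_commute)
    hence "card (f ` M) = card (f ` K)" using pos by auto
    thus ?thesis using \<open>K \<subseteq> M\<close> finite_subgroup[OF \<open>subgroup M G\<close>] by (metis card_subset_eq finite_imageI image_mono)
  qed
  thus ?case using step group_hom.subgroup_img_is_subgroup[OF f] by (intro prime_chain_step_le[OF step.IH]) auto
qed

lemma prime_chain_above_normal:
  assumes p: "prime p" and M: "M \<lhd> G" and card: "card (carrier G) = p ^ k * card M"
    and H: "subgroup H G" "M \<subseteq> H"
  shows "prime_chain G H (carrier G)"
  using H
proof (induction "card (carrier G) - card H" arbitrary: H rule: less_induct)
  case less
  show ?case
  proof (cases "H = carrier G")
    case True thus ?thesis using less by (auto intro: prime_chain.refl)
  next
    case False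
    then obtain L where L: "subgroup L G" "H \<subseteq> L" "card L = p * card H"
      using index_p_above[OF p M card less.prems] by blast
    have "card L \<le> card (carrier G)" by (rule card_mono[OF fin subgroup.subset[OF L(1)]])
    moreover have "card H < card L" using L card_pos[OF less.prems(1)] prime_gt_1_nat[OF p] by simp
    ultimately have "card (carrier G) - card L < card (carrier G) - card H" by linarith
    hence "prime_chain G L (carrier G)" using less L by blast
    thus ?thesis using prime_chain_trans[of G L] prime_chain.step[OF prime_chain.refl] L p less.prems by metis
  qed
qed

section \<open>Normal p-subgroups produced by chains\<close>

text \<open>The product of two normal \<open>p\<close>-subgroups is again one, so a largest one contains all others.\<close>

lemma p_core_exists:
  assumes p: "prime p"
  shows "\<exists>S m. S \<lhd> G \<and> card S = p ^ m \<and> (\<forall>T n. T \<lhd> G \<longrightarrow> card T = p ^ n \<longrightarrow> T \<subseteq> S)"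
proof -
  let ?P = "{S. S \<lhd> G \<and> (\<exists>m. card S = p ^ m)}"
  have "?P \<subseteq> Pow (carrier G)" using normal_imp_subgroup subgroup.subset by blast
  hence fP: "finite ?P" by (rule finite_subset) (simp add: fin)
  have "{\<one>} \<in> ?P" using one_is_normal by (auto intro!: exI[of _ 0])
  then obtain S where S: "S \<in> ?P" and mx: "\<And>T. T \<in> ?P \<Longrightarrow> card T \<le> card S"
    using finite_max_card[OF fP] by blast
  obtain m where m: "card S = p ^ m" and Sn: "S \<lhd> G" using S by blast
  have "T \<subseteq> S" if T: "T \<lhd> G" "card T = p ^ n" for T n
  proof -
    have s: "subgroup S G" "subgroup T G" using Sn T normal_imp_subgroup by auto
    have ST: "subgroup (S <#> T) G" by (rule mult_normal_subgroup[OF Sn s(2)])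
    have "S <#> T \<lhd> G"
    proof (rule normal_conjgI[OF ST])
      fix g x assume g: "g \<in> carrier G" and x: "x \<in> S <#> T"
      obtain a b where ab: "a \<in> S" "b \<in> T" "x = a \<otimes> b" using x by (auto simp: set_mult_def)
      hence "a \<in> carrier G" "b \<in> carrier G" using s by (auto intro: sub_mem)
      hence "conjg G g x = conjg G g a \<otimes> conjg G g b" using ab g by (simp add: conjg_mult)
      moreover have "conjg G g a \<in> S" "conjg G g b \<in> T" using ab g Sn T conjg_normal by auto
      ultimately show "conjg G g x \<in> S <#> T" by (auto simp: set_mult_def)
    qed
    moreover have "card (S <#> T) dvd p ^ (m + n)"
      using card_set_mult[OF s] m T by (metis dvd_triv_left power_add)
    then obtain i where "card (S <#> T) = p ^ i" using p divides_primepow_nat by blast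
    ultimately have "S <#> T \<in> ?P" by blast
    hence "S = S <#> T" using subgroup_eqI[OF s(1) ST set_mult_incl(1)[OF s]] mx by blast
    thus ?thesis using set_mult_incl(2)[OF s] by blast
  qed
  thus ?thesis using Sn m by blast
qed

text \<open>A \<open>p\<close>-group \<open>R \<subseteq> H\<close> acts on the \<open>q \<le> p\<close> cosets of \<open>H\<close> and fixes \<open>H\<close>. The remaining \<open>q - 1 < p\<close> cosets leave no room for a nontrivial
orbit, so \<open>R\<close> acts trivially and lies in the core \<open>C\<close> of \<open>H\<close>. Being normal in \<open>C\<close>, it lies in the largest normal
\<open>p\<close>-subgroup of \<open>C\<close>, which is normal in \<open>G\<close> because \<open>C\<close> is.\<close>

lemma p_core_step:
  assumes p: "prime p" and H: "subgroup H G" and q: "prime q" "q \<le> p"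
    and card: "card (carrier G) = q * card H"
    and R: "R \<lhd> G\<restriction>H" "card R = p ^ n"
  shows "\<exists>S m. S \<lhd> G \<and> card S = p ^ m \<and> R \<subseteq> S"
proof -
  interpret HG: finite_group "G\<restriction>H" using H subgroup_finite_group by blast
  have RH: "R \<subseteq> H" using R normal_imp_subgroup subgroup.subset by fastforce
  have Rs: "subgroup R G" using R normal_imp_subgroup incl_subgroup H by blast
  let ?F = "{H #> g | g. g \<in> carrier G \<and> conjg G g ` R \<subseteq> H}"
  have h0: "card H > 0" using H card_pos by blast
  have fE: "finite (rcosets H)" using fin by (simp add: RCOSETS_def)
  have FE: "?F \<subseteq> rcosets H" using subgroup.subset[OF H] by (auto simp: rcosetsI)
  have rc: "card (rcosets H) = q" using lagrange[OF H] card h0 by (simp add: order_def)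
  have HF: "H \<in> ?F" using RH H subgroup.subset[OF H] subgroup.subset[OF Rs] conjg_image_one[of R]
      coset_mult_one[of H] by (metis (mono_tags, lifting) mem_Collect_eq one_closed)
  have "finite ?F" using FE fE finite_subset by blast
  hence F1: "card ?F \<noteq> 0" using HF card_eq_0_iff[of ?F] by blast
  have F2: "card ?F \<le> q" using card_mono[OF fE FE] rc by simp
  have "card ?F mod p = q mod p" using fixed_cosets_cong[OF p Rs R(2) H] rc by simp
  moreover have "f = q" if "f \<noteq> 0" "f \<le> q" "f mod p = q mod p" "q \<le> p" for f :: nat
    using that by (cases "q = p") (auto dest: dvd_imp_le simp: mod_eq_0_iff_dvd)
  ultimately have "card ?F = q" using F1 F2 q by blast
  hence FE': "?F = rcosets H" using card_subset_eq[OF fE FE] rc by simp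
  have all: "conjg G g ` R \<subseteq> H" if g: "g \<in> carrier G" for g
  proof -
    have "H #> g \<in> ?F" unfolding FE' using g subgroup.subset[OF H] rcosetsI by blast
    then obtain g' where g': "g' \<in> carrier G" "conjg G g' ` R \<subseteq> H" "H #> g = H #> g'" by blast
    then obtain h where h: "h \<in> H" "g = h \<otimes> g'" using rcos_self[OF g H] by (auto simp: r_coset_def)
    have hc: "h \<in> carrier G" using h H subgroup.mem_carrier by metis
    have "conjg G g ` R = conjg G h ` conjg G g' ` R"
      using h hc g' subgroup.subset[OF Rs] by (simp add: conjg_image_conjg)
    thus ?thesis using g' h H conjg_in_subgroup by (auto simp: image_subset_iff)
  qed
  define C where "C = {x \<in> carrier G. \<forall>g\<in>carrier G. conjg G g x \<in> H}"
  have CH: "C \<subseteq> H" unfolding C_def using conjg_one one_closed by (metis (mono_tags, lifting) mem_Collect_eq subsetI)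
  have Cs: "subgroup C G"
  proof (rule subgroupI)
    show "C \<subseteq> carrier G" by (auto simp: C_def)
    have "conjg G g \<one> = \<one>" if "g \<in> carrier G" for g using that by (simp add: conjg_def)
    hence "\<one> \<in> C" using H subgroup.one_closed by (auto simp: C_def)
    thus "C \<noteq> {}" by blast
    fix a assume a: "a \<in> C"
    have "conjg G g (inv a) = inv (conjg G g a)" if "g \<in> carrier G" for g
      using that a group_hom.hom_inv[OF group_hom_conjg] by (auto simp: C_def)
    thus "inv a \<in> C" using a H subgroup.m_inv_closed by (fastforce simp: C_def)
    fix b assume "b \<in> C" thus "a \<otimes> b \<in> C" using a H by (auto simp: C_def conjg_mult subgroup.m_closed)
  qed
  have Cn: "C \<lhd> G" by (rule normal_conjgI[OF Cs]) (auto simp: C_def conjg_conjg)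
  have RC: "R \<subseteq> C" using all Rs subgroup.subset by (fastforce simp: C_def)
  interpret CG: finite_group "G\<restriction>C" using Cs subgroup_finite_group by blast
  have "R \<lhd> (G\<restriction>H)\<lparr>carrier := C\<rparr>"
    by (rule HG.normal_restrict_supergroup[OF subgroup_incl[OF Cs H CH] R(1) RC])
  hence RCn: "R \<lhd> G\<restriction>C" by simp
  obtain S m where S: "S \<lhd> G\<restriction>C" "card S = p ^ m"
    and mx: "\<And>T n. T \<lhd> G\<restriction>C \<Longrightarrow> card T = p ^ n \<Longrightarrow> T \<subseteq> S"
    using CG.p_core_exists[OF p] by blast
  have SC: "S \<subseteq> C" using S normal_imp_subgroup subgroup.subset by fastforce
  have Ss: "subgroup S G" using S normal_imp_subgroup incl_subgroup Cs by blast
  have "conjg G g ` S \<subseteq> S" if g: "g \<in> carrier G" for g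
  proof (rule mx)
    show "card (conjg G g ` S) = p ^ m" using S card_conjg[OF g subgroup.subset[OF Ss]] by simp
    have sub: "conjg G g ` S \<subseteq> C" using SC Cn g conjg_normal by blast
    show "conjg G g ` S \<lhd> G\<restriction>C"
    proof (rule CG.normal_conjgI)
      show "subgroup (conjg G g ` S) (G\<restriction>C)"
        by (rule subgroup_incl[OF conjg_subgroup[OF g Ss] Cs sub])
      fix c x assume c: "c \<in> carrier (G\<restriction>C)" and "x \<in> conjg G g ` S"
      then obtain s where s: "s \<in> S" "x = conjg G g s" by blast
      have cC: "c \<in> C" "c \<in> carrier G" "s \<in> carrier G" using c s(1) subgroup.mem_carrier[OF Cs] subgroup.mem_carrier[OF Ss] by auto
      let ?d = "conjg G (inv g) c"
      have d: "?d \<in> C" using Cn g cC conjg_normal by simp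
      have "conjg G ?d s \<in> S"
        using CG.conjg_normal[OF S(1), of ?d s] d s by (simp add: conjg_consistent[OF Cs])
      moreover have "conjg G g (conjg G ?d s) = conjg G c x"
        using conjg_eq_conj[OF g cC(2,3)] s by simp
      ultimately have "conjg G c x \<in> conjg G g ` S" by force
      thus "conjg (G\<restriction>C) c x \<in> conjg G g ` S"
        using conjg_consistent[OF Cs cC(1)] by simp
    qed
  qed
  hence "S \<lhd> G" using normal_conjgI[OF Ss] by blast
  thus ?thesis using S mx[OF RCn R(2)] by blast
qed

text \<open>For the greatest prime, lying in a normal \<open>p\<close>-subgroup is a property that climbs the chain by \<open>p_core_step\<close>.\<close>

lemma prime_chain_p_core:
  assumes p: "prime p" and big: "\<And>q. prime q \<Longrightarrow> q dvd card (carrier G) \<Longrightarrow> q \<le> p"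
    and c: "prime_chain G H K" and H: "card H = p ^ n"
  shows "\<exists>R m. R \<lhd> G\<restriction>K \<and> card R = p ^ m \<and> H \<subseteq> R"
  using c
proof (induction rule: prime_chain.induct)
  case refl
  interpret HG: group "G\<restriction>H" using refl subgroup_imp_group by blast
  show ?case using HG.normal_self H by auto
next
  case (step K L q)
  obtain R m where R: "R \<lhd> G\<restriction>K" "card R = p ^ m" "H \<subseteq> R" using step by blast
  interpret LG: finite_group "G\<restriction>L" using step subgroup_finite_group by blast
  have K: "subgroup K G" using step prime_chain_subgroups by blast
  have "q dvd card (carrier G)" using card_subgroup_dvd_order[OF \<open>subgroup L G\<close>] step by (metis dvd_mult_left)
  hence "q \<le> p" using big step by blast
  have "\<exists>S m. S \<lhd> G\<restriction>L \<and> card S = p ^ m \<and> R \<subseteq> S"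
    by (rule LG.p_core_step[OF p subgroup_incl[OF K \<open>subgroup L G\<close> \<open>K \<subseteq> L\<close>] \<open>prime q\<close> \<open>q \<le> p\<close>])
       (use step R in auto)
  thus ?case using R by blast
qed

end

section \<open>Coprime action and Sylow fusion\<close>

text \<open>What condition (2) contributes to condition (1). Unlike supersolubility it speaks of subgroups of \<open>G\<close> alone, so it passes
to subgroups at once.\<close>

definition chains_over_p_subgroups :: "('a, 'b) monoid_scheme \<Rightarrow> bool" where
  "chains_over_p_subgroups G \<longleftrightarrow> (\<forall>p P a y. prime p \<longrightarrow> subgroup P G \<longrightarrow> card P = p ^ a
      \<longrightarrow> y \<in> carrier G \<longrightarrow> conjg G y ` P \<subseteq> P
      \<longrightarrow> prime_chain G (generate G {y}) (P <#>\<^bsub>G\<^esub> generate G {y}))"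

text \<open>The hypothesis of Frobenius' theorem: the quotient of the normalizer by the centralizer is a \<open>p\<close>-group for every \<open>p\<close>-subgroup \<open>D\<close>.\<close>

definition coprime_action_trivial :: "('a, 'b) monoid_scheme \<Rightarrow> nat \<Rightarrow> bool" where
  "coprime_action_trivial G p \<longleftrightarrow> (\<forall>D a q b y. subgroup D G \<longrightarrow> card D = p ^ a
      \<longrightarrow> prime q \<longrightarrow> q \<noteq> p \<longrightarrow> y \<in> carrier G \<longrightarrow> card (generate G {y}) = q ^ b
      \<longrightarrow> conjg G y ` D \<subseteq> D \<longrightarrow> (\<forall>d\<in>D. conjg G y d = d))"

definition centralizer_of :: "('a, 'b) monoid_scheme \<Rightarrow> 'a set \<Rightarrow> 'a set" where
  "centralizer_of G D = {g \<in> carrier G. \<forall>d\<in>D. conjg G g d = d}"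

definition is_sylow :: "('a, 'b) monoid_scheme \<Rightarrow> nat \<Rightarrow> 'a set \<Rightarrow> bool" where
  "is_sylow G p S \<longleftrightarrow> subgroup S G \<and> card S = p ^ multiplicity p (card (carrier G))"

context finite_group
begin

lemma gen_in: "subgroup K G \<Longrightarrow> y \<in> K \<Longrightarrow> generate (G\<restriction>K) {y} = generate G {y}"
  by (rule generate_consistent) auto

lemma gen_sub: "subgroup K G \<Longrightarrow> y \<in> K \<Longrightarrow> generate G {y} \<subseteq> K"
  by (rule generate_subgroup_incl) auto

lemma p_subgroup_power:
  assumes "prime p" "subgroup H G" "subgroup K G" "H \<subseteq> K" "card K = p ^ a"
  obtains b where "card H = p ^ b"
  using card_subgroup_dvd[OF assms(2-4)] assms(1,5) divides_primepow_nat by metis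

lemma chains_in_subgroup:
  assumes "chains_over_p_subgroups G" and K: "subgroup K G"
  shows "chains_over_p_subgroups (G\<restriction>K)"
  unfolding chains_over_p_subgroups_def
proof (intro allI impI)
  fix p P a y
  assume p: "prime p" and P: "subgroup P (G\<restriction>K)" "card P = p ^ a"
    and y: "y \<in> carrier (G\<restriction>K)" "conjg (G\<restriction>K) y ` P \<subseteq> P"
  have yK: "y \<in> K" using y by simp
  have PG: "subgroup P G" "P \<subseteq> K" using P K incl_subgroup subgroup.subset by fastforce+
  have "conjg G y ` P \<subseteq> P" using y(2) conjg_consistent[OF K yK] by simp
  hence "prime_chain G (generate G {y}) (P <#> generate G {y})"
    using assms(1) p PG(1) P(2) sub_mem[OF K yK] unfolding chains_over_p_subgroups_def by blast
  moreover have "P <#> generate G {y} \<subseteq> K" by (rule set_mult_least[OF K PG(2) gen_sub[OF K yK]])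
  ultimately show "prime_chain (G\<restriction>K) (generate (G\<restriction>K) {y})
      (P <#>\<^bsub>G\<restriction>K\<^esub> generate (G\<restriction>K) {y})"
    using prime_chain_in_subgroup[OF _ K] gen_in[OF K yK] by simp
qed

lemma coprime_action_in_subgroup:
  assumes "coprime_action_trivial G p" and K: "subgroup K G"
  shows "coprime_action_trivial (G\<restriction>K) p"
  unfolding coprime_action_trivial_def
proof (intro allI impI)
  fix D a q b y
  assume D: "subgroup D (G\<restriction>K)" "card D = p ^ a" and q: "prime q" "q \<noteq> p"
    and y: "y \<in> carrier (G\<restriction>K)" "card (generate (G\<restriction>K) {y}) = q ^ b"
      "conjg (G\<restriction>K) y ` D \<subseteq> D"
  have yK: "y \<in> K" using y by simp
  have DG: "subgroup D G" using D K incl_subgroup by blast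
  have "card (generate G {y}) = q ^ b" "conjg G y ` D \<subseteq> D"
    using y gen_in[OF K yK] conjg_consistent[OF K yK] by simp_all
  hence "\<forall>d\<in>D. conjg G y d = d"
    using assms(1) DG D(2) q sub_mem[OF K yK] unfolding coprime_action_trivial_def by blast
  thus "\<forall>d\<in>D. conjg (G\<restriction>K) y d = d" using conjg_consistent[OF K yK] by simp
qed

lemma normalized_mult_subgroup:
  assumes "subgroup P G" "subgroup H G" "H \<subseteq> normalizer_of G P"
  shows "subgroup (P <#> H) G"
  by (rule subgroup_normalized_mult) (use assms in \<open>auto simp: normalizer_of_def\<close>)

lemma gen_normalizes:
  assumes "subgroup P G" "y \<in> carrier G" "conjg G y ` P \<subseteq> P"
  shows "generate G {y} \<subseteq> normalizer_of G P"
  by (rule gen_sub[OF normalizer_subgroup[OF sub_car]]) (use assms in \<open>auto simp: normalizer_of_def\<close>)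

text \<open>In \<open>D\<langle>y\<rangle>\<close> the prime \<open>q\<close> is the greatest one, so the chain from \<open>\<langle>y\<rangle>\<close> puts \<open>y\<close> into a normal \<open>q\<close>-subgroup \<open>R\<close>; the
commutators of \<open>y\<close> with \<open>D\<close> lie in \<open>D \<inter> R\<close>, which is trivial.\<close>

lemma chains_imp_coprime_action:
  assumes chains: "chains_over_p_subgroups G" and p: "prime p"
    and small: "\<And>q. prime q \<Longrightarrow> q dvd card (carrier G) \<Longrightarrow> p \<le> q"
  shows "coprime_action_trivial G p"
  unfolding coprime_action_trivial_def
proof (intro allI impI ballI)
  fix D a q b y d
  assume D: "subgroup D G" "card D = p ^ a" and q: "prime q" "q \<noteq> p"
    and y: "y \<in> carrier G" "card (generate G {y}) = q ^ b" "conjg G y ` D \<subseteq> D" and d: "d \<in> D"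
  let ?Y = "generate G {y}" let ?X = "D <#> generate G {y}"
  have Y: "subgroup ?Y G" "y \<in> ?Y" using generate_cyclic y by auto
  have dG: "d \<in> carrier G" using d D sub_mem by blast
  show "conjg G y d = d"
  proof (cases "b = 0")
    case True
    hence "card ?Y = 1" using y by simp
    then obtain z where "?Y = {z}" by (rule card_1_singletonE)
    hence "y = \<one>" using Y(2) subgroup.one_closed[OF Y(1)] by auto
    thus ?thesis using dG by simp
  next
    case False
    have "q dvd card ?Y" using False y(2) by simp
    hence "q dvd card (carrier G)" using card_subgroup_dvd_order[OF Y(1)] dvd_trans by blast
    hence "p \<le> q" by (rule small[OF q(1)])
    hence pq: "p < q" using q(2) by simp
    have X: "subgroup ?X G"
      by (rule normalized_mult_subgroup[OF D(1) Y(1) gen_normalizes[OF D(1) y(1,3)]])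
    interpret X: finite_group "G\<restriction>?X" using X subgroup_finite_group by blast
    have "\<not> p dvd q" using primes_dvd_imp_eq p q by blast
    hence "coprime p q" by (rule prime_imp_coprime[OF p])
    hence cop: "coprime (p ^ a) (q ^ m)" for m by simp
    have cardX: "card ?X = p ^ a * q ^ b" using card_set_mult_coprime(1)[OF D(1) Y(1)] D y cop by simp
    have big: "r \<le> q" if "prime r" "r dvd card (carrier (G\<restriction>?X))" for r
    proof -
      have "r dvd p ^ a \<or> r dvd q ^ b" using that cardX prime_dvd_mult_iff by auto
      hence "r dvd p \<or> r dvd q" using that prime_dvd_power by blast
      hence "r = p \<or> r = q" using that p q primes_dvd_imp_eq by blast
      thus ?thesis using pq by auto
    qed
    have "prime_chain G ?Y ?X" using chains p D y unfolding chains_over_p_subgroups_def by blast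
    hence "prime_chain (G\<restriction>?X) ?Y ?X" by (rule prime_chain_in_subgroup[OF _ X]) simp
    then obtain R m where R: "R \<lhd> (G\<restriction>?X)\<lparr>carrier := ?X\<rparr>" "card R = q ^ m" "?Y \<subseteq> R"
      using X.prime_chain_p_core[OF q(1) big _ y(2)] by blast
    have Rn: "R \<lhd> G\<restriction>?X" using R by simp
    have Rs: "subgroup R G" using Rn normal_imp_subgroup incl_subgroup X by blast
    have dX: "d \<in> ?X" using d set_mult_incl[OF D(1) Y(1)] by blast
    have yR: "y \<in> R" using R Y by blast
    have c: "conjg G d (inv y) \<in> R"
      using X.conjg_normal[OF Rn, of d "inv y"] dX yR Rs conjg_consistent[OF X dX]
      by (simp add: subgroup.m_inv_closed)
    have "conjg G y d \<otimes> inv d = y \<otimes> conjg G d (inv y)"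
      using y(1) dG by (simp add: conjg_def m_assoc)
    hence "conjg G y d \<otimes> inv d \<in> R" using c yR Rs by (simp add: subgroup.m_closed)
    moreover have "conjg G y d \<otimes> inv d \<in> D"
      using y d D by (auto intro!: subgroup.m_closed subgroup.m_inv_closed)
    moreover have "D \<inter> R = {\<one>}"
      by (rule card_set_mult_coprime(2)[OF D(1) Rs]) (use cop D R in \<open>simp only:\<close>)
    ultimately have "conjg G y d \<otimes> inv d = \<one>" by blast
    thus ?thesis using y dG by (metis conjg_closed inv_closed inv_inv inv_equality)
  qed
qed

lemma is_sylowD: "is_sylow G p S \<Longrightarrow> subgroup S G"
  by (simp add: is_sylow_def)

lemma is_sylow_exists: "prime p \<Longrightarrow> \<exists>S. is_sylow G p S"
  unfolding is_sylow_def using sylow_exists multiplicity_dvd by blast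

lemma order_pos: "0 < card (carrier G)"
  using card_pos subgroup_self by blast

lemma is_sylow_contain:
  assumes p: "prime p" and S: "is_sylow G p S" and R: "subgroup R G" "card R = p ^ n"
  shows "\<exists>g\<in>carrier G. conjg G g ` R \<subseteq> S"
proof (rule sylow_contain[OF p R])
  show "subgroup S G" using S by (rule is_sylowD)
  have "\<not> is_unit p" "card (carrier G) \<noteq> 0" using p order_pos prime_gt_1_nat by auto
  then obtain m where "card (carrier G) = p ^ multiplicity p (card (carrier G)) * m" "\<not> p dvd m"
    using multiplicity_decompose'[of "card (carrier G)" p] by metis
  thus "\<not> p dvd card (carrier G) div card S"
    using S prime_gt_0_nat[OF p] unfolding is_sylow_def by (metis nonzero_mult_div_cancel_left not_gr0 power_not_zero)
qed

lemma is_sylow_conjg: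
  assumes "is_sylow G p S" "g \<in> carrier G" shows "is_sylow G p (conjg G g ` S)"
  using assms conjg_subgroup[of g S] card_conjg[OF _ sub_car, of g S] by (simp add: is_sylow_def)

lemma is_sylow_over:
  assumes p: "prime p" and R: "subgroup R G" "card R = p ^ n"
  shows "\<exists>S. is_sylow G p S \<and> R \<subseteq> S"
proof -
  obtain S where S: "is_sylow G p S" using is_sylow_exists[OF p] by blast
  obtain g where g: "g \<in> carrier G" "conjg G g ` R \<subseteq> S" using is_sylow_contain[OF p S R] by blast
  have "conjg G (inv g) ` conjg G g ` R \<subseteq> conjg G (inv g) ` S" using g by blast
  hence "R \<subseteq> conjg G (inv g) ` S" using g R by (simp add: conjg_image_conjg conjg_image_one sub_car)
  thus ?thesis using is_sylow_conjg[OF S, of "inv g"] g by auto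
qed

lemma is_sylow_in:
  assumes p: "prime p" and S: "is_sylow G p S" and K: "subgroup K G" "S \<subseteq> K"
  shows "is_sylow (G\<restriction>K) p S"
proof -
  have s: "subgroup S G" "card S = p ^ multiplicity p (card (carrier G))" using S by (auto simp: is_sylow_def)
  have "card S dvd card K" using card_subgroup_dvd s K by blast
  hence "multiplicity p (card (carrier G)) \<le> multiplicity p (card K)"
    using s card_pos[OF K(1)] prime_gt_1_nat[OF p] by (intro multiplicity_geI) auto
  moreover have "multiplicity p (card K) \<le> multiplicity p (card (carrier G))"
    using dvd_imp_multiplicity_le[OF card_subgroup_dvd_order[OF K(1)]] order_pos by simp
  ultimately show ?thesis using s subgroup_incl[OF s(1) K] by (simp add: is_sylow_def)
qed

lemma centralizer_antimono: "A \<subseteq> B \<Longrightarrow> centralizer_of G B \<subseteq> centralizer_of G A"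
  by (auto simp: centralizer_of_def)

lemma centralizer_subgroup:
  assumes "D \<subseteq> carrier G" shows "subgroup (centralizer_of G D) G"
proof (rule subgroupI)
  show "centralizer_of G D \<subseteq> carrier G" by (auto simp: centralizer_of_def)
  have "\<one> \<in> centralizer_of G D" using assms by (auto simp: centralizer_of_def)
  thus "centralizer_of G D \<noteq> {}" by blast
  fix a assume a: "a \<in> centralizer_of G D"
  have "conjg G (inv a) d = d" if "d \<in> D" for d
  proof -
    have "conjg G a d = d" "a \<in> carrier G" "d \<in> carrier G"
      using a that assms by (auto simp: centralizer_of_def)
    thus ?thesis using conjg_inv_cancel(1)[of a d] by simp
  qed
  thus "inv a \<in> centralizer_of G D" using a by (auto simp: centralizer_of_def)
  fix b assume b: "b \<in> centralizer_of G D"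
  have "conjg G (a \<otimes> b) d = d" if "d \<in> D" for d
    using conjg_conjg[of a b d] a b that assms by (auto simp: centralizer_of_def)
  thus "a \<otimes> b \<in> centralizer_of G D" using a b by (auto simp: centralizer_of_def)
qed

lemma conjg_centralizer:
  assumes c: "c \<in> centralizer_of G D" and g: "g \<in> carrier G" and D: "D \<subseteq> carrier G"
    and inv: "conjg G (inv g) ` D \<subseteq> D"
  shows "conjg G g c \<in> centralizer_of G D"
proof -
  have cG: "c \<in> carrier G" using c by (simp add: centralizer_of_def)
  have "conjg G (conjg G g c) d = d" if d: "d \<in> D" for d
  proof -
    let ?e = "conjg G (inv g) d"
    have dG: "d \<in> carrier G" using d D by blast
    have e: "?e \<in> D" using inv d by blast
    have "conjg G (conjg G g c) (conjg G g ?e) = conjg G g (conjg G (conjg G (inv g) (conjg G g c)) ?e)"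
      using conjg_eq_conj[of g "conjg G g c" ?e] g cG dG by simp
    also have "\<dots> = conjg G g (conjg G c ?e)" using g cG by simp
    also have "\<dots> = conjg G g ?e" using e c by (simp add: centralizer_of_def)
    finally show ?thesis using g dG by simp
  qed
  thus ?thesis using g cG by (simp add: centralizer_of_def)
qed

lemma centralizer_normal:
  assumes D: "D \<lhd> G" shows "centralizer_of G D \<lhd> G"
proof -
  have DG: "D \<subseteq> carrier G" using D normal_sub sub_car by blast
  show ?thesis
  proof (rule normal_conjgI[OF centralizer_subgroup[OF DG]])
    fix g c assume g: "g \<in> carrier G" and c: "c \<in> centralizer_of G D"
    show "conjg G g c \<in> centralizer_of G D"
      by (rule conjg_centralizer[OF c g DG]) (use D g conjg_normal in auto)
  qed
qed

text \<open>All elements of order prime to \<open>p\<close> in the normalizer centralize \<open>D\<close>, so centralizer and Sylow \<open>p\<close>-subgroup together contain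
a Sylow subgroup for each prime.\<close>

lemma normalizer_factor:
  assumes p: "prime p" and triv: "coprime_action_trivial G p"
    and D: "subgroup D G" "card D = p ^ a"
    and S: "is_sylow (G\<restriction>normalizer_of G D) p S" and n: "n \<in> normalizer_of G D"
  shows "\<exists>c\<in>centralizer_of G D. \<exists>s\<in>S. n = c \<otimes> s"
proof -
  let ?N = "normalizer_of G D" let ?C = "centralizer_of G D"
  have DG: "D \<subseteq> carrier G" using D sub_car by blast
  have N: "subgroup ?N G" by (rule normalizer_subgroup[OF DG])
  have C: "subgroup ?C G" by (rule centralizer_subgroup[OF DG])
  have CN: "?C \<subseteq> ?N" by (auto simp: centralizer_of_def normalizer_of_def)
  interpret NG: finite_group "G\<restriction>?N" using N subgroup_finite_group by blast
  have CsN: "subgroup ?C (G\<restriction>?N)" by (rule subgroup_incl[OF C N CN])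
  have SsN: "subgroup S (G\<restriction>?N)" "card S = p ^ multiplicity p (card ?N)" using S by (auto simp: is_sylow_def)
  have CnN: "?C \<lhd> G\<restriction>?N"
  proof (rule NG.normal_conjgI[OF CsN])
    fix g x assume g: "g \<in> carrier (G\<restriction>?N)" and x: "x \<in> ?C"
    have gN: "g \<in> ?N" "g \<in> carrier G" using g by (auto simp: normalizer_of_def)
    have "inv g \<in> ?N" using N gN subgroup.m_inv_closed by metis
    hence "conjg G (inv g) ` D \<subseteq> D" by (simp add: normalizer_of_def)
    hence "conjg G g x \<in> ?C" by (rule conjg_centralizer[OF x gN(2) DG])
    thus "conjg (G\<restriction>?N) g x \<in> ?C" using conjg_consistent[OF N gN(1)] by simp
  qed
  let ?CS = "?C <#> S"
  have CS: "subgroup ?CS (G\<restriction>?N)" using NG.mult_normal_subgroup[OF CnN SsN(1)] by simp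
  have incl: "?C \<subseteq> ?CS" "S \<subseteq> ?CS" using NG.set_mult_incl[OF CsN SsN(1)] by simp_all
  have dv: "card ?C dvd card ?CS" "card S dvd card ?CS"
    using NG.card_subgroup_dvd[OF CsN CS incl(1)] NG.card_subgroup_dvd[OF SsN(1) CS incl(2)] by auto
  have "?CS = carrier (G\<restriction>?N)"
  proof (rule NG.subgroup_eq_carrierI[OF CS])
    fix q k assume q: "prime q" and k: "q ^ k dvd card (carrier (G\<restriction>?N))"
    show "q ^ k dvd card ?CS"
    proof (cases "q = p")
      case True
      have "k \<le> multiplicity p (card ?N)"
        by (rule multiplicity_geI) (use k True prime_gt_1_nat[OF p] card_pos[OF N] in auto)
      hence "q ^ k dvd card S" using SsN True le_imp_power_dvd by metis
      thus ?thesis using dv dvd_trans by blast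
    next
      case False
      obtain Q where Q: "subgroup Q G" "Q \<subseteq> ?N" "card Q = q ^ k"
        using sylow_in_subgroup[OF q N] k by auto
      have "Q \<subseteq> ?C"
      proof
        fix x assume x: "x \<in> Q"
        have xG: "x \<in> carrier G" using x Q sub_mem by blast
        obtain b where "card (generate G {x}) = q ^ b"
          using p_subgroup_power[OF q generate_cyclic(1)[OF xG] Q(1) gen_sub[OF Q(1) x] Q(3)] .
        moreover have "conjg G x ` D \<subseteq> D" using x Q by (auto simp: normalizer_of_def)
        ultimately have "\<forall>d\<in>D. conjg G x d = d"
          using triv D q False xG unfolding coprime_action_trivial_def by blast
        thus "x \<in> ?C" using xG by (simp add: centralizer_of_def)
      qed
      hence "q ^ k dvd card ?C" using card_subgroup_dvd[OF Q(1) C] Q by simp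
      thus ?thesis using dv dvd_trans by blast
    qed
  qed
  hence "n \<in> ?CS" using n by simp
  thus ?thesis by (auto simp: set_mult_def)
qed

lemma p_group_grow:
  assumes p: "prime p" and P: "subgroup P G" "card P = p ^ a"
    and D: "subgroup D G" "D \<subseteq> P" "D \<noteq> P"
  shows "\<exists>L. subgroup L G \<and> D \<subseteq> L \<and> L \<subseteq> P \<and> L \<subseteq> normalizer_of G D \<and> card L = p * card D"
proof -
  interpret PG: finite_group "G\<restriction>P" using P subgroup_finite_group by blast
  have "\<exists>L. subgroup L (G\<restriction>P) \<and> D \<subseteq> L \<and> card L = p * card D \<and> L \<subseteq> normalizer_of (G\<restriction>P) D"
    by (rule PG.index_p_above[OF p PG.one_is_normal])
       (use P D subgroup.one_closed subgroup_incl in auto)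
  then obtain L where L: "subgroup L (G\<restriction>P)" "D \<subseteq> L" "card L = p * card D" "L \<subseteq> normalizer_of (G\<restriction>P) D"
    by blast
  have "L \<subseteq> P" using L subgroup.subset by fastforce
  moreover have "normalizer_of (G\<restriction>P) D \<subseteq> normalizer_of G D"
    using conjg_consistent[OF P(1)] sub_mem[OF P(1)] by (auto simp: normalizer_of_def image_subset_iff)
  ultimately show ?thesis using L incl_subgroup[OF P(1)] by blast
qed

text \<open>Downward induction on the intersection \<open>D\<close>. If \<open>P \<noteq> Q\<close>, then \<open>D\<close> grows inside \<open>P\<close> and inside \<open>Q\<close>
within its normalizer. There both enlargements lie in Sylow subgroups which are conjugate, and the conjugating
element can be taken in the centralizer of \<open>D\<close> by \<open>normalizer_factor\<close>. Sylow subgroups of \<open>G\<close> above these meet \<open>P\<close> and \<open>Q\<close>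
in more than \<open>D\<close>, and the induction hypothesis connects them with \<open>P\<close> and \<open>Q\<close>.\<close>

lemma sylow_fusion_conj:
  assumes p: "prime p" and triv: "coprime_action_trivial G p"
    and "is_sylow G p P" "is_sylow G p Q"
  shows "\<exists>c\<in>centralizer_of G (P \<inter> Q). Q = conjg G c ` P"
  using assms(3,4)
proof (induction "card (carrier G) - card (P \<inter> Q)" arbitrary: P Q rule: less_induct)
  case less
  let ?D = "P \<inter> Q" let ?N = "normalizer_of G ?D"
  have P: "subgroup P G" and Q: "subgroup Q G" using less is_sylowD by auto
  have cPQ: "card P = card Q" using less by (simp add: is_sylow_def)
  have D: "subgroup ?D G" using P Q subgroups_Inter_pair by blast
  have DG: "?D \<subseteq> carrier G" using D sub_car by blast
  show ?case
  proof (cases "P = Q")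
    case True
    have "\<one> \<in> centralizer_of G ?D" using subgroup.one_closed[OF centralizer_subgroup[OF DG]] .
    moreover have "Q = conjg G \<one> ` P" using True conjg_image_one[OF sub_car[OF P]] by simp
    ultimately show ?thesis by blast
  next
    case False
    obtain a where a: "card P = p ^ a" "card Q = p ^ a" using less by (auto simp: is_sylow_def)
    have DP: "?D \<noteq> P" using False subgroup_eqI[OF P Q] cPQ by auto
    have DQ: "?D \<noteq> Q" using False subgroup_eqI[OF Q P] cPQ by auto
    obtain d where d: "card ?D = p ^ d" using p_subgroup_power[OF p D P _ a(1)] by blast
    obtain LP where LP: "subgroup LP G" "?D \<subseteq> LP" "LP \<subseteq> P" "LP \<subseteq> ?N" "card LP = p * card ?D"
      using p_group_grow[OF p P a(1) D _ DP] by blast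
    obtain LQ where LQ: "subgroup LQ G" "?D \<subseteq> LQ" "LQ \<subseteq> Q" "LQ \<subseteq> ?N" "card LQ = p * card ?D"
      using p_group_grow[OF p Q a(2) D _ DQ] by blast
    have big: "card (carrier G) - card Z < card (carrier G) - card ?D" if "subgroup Z G" "subgroup L G" "L \<subseteq> Z" "card L = p * card ?D" for Z L
    proof -
      have "card L \<le> card Z" "card Z \<le> card (carrier G)"
        using card_mono[OF finite_subgroup[OF that(1)] that(3)] card_mono[OF fin sub_car[OF that(1)]] by auto
      moreover have "card ?D < card L" using that card_pos[OF D] prime_gt_1_nat[OF p] by simp
      ultimately show ?thesis by linarith
    qed
    have N: "subgroup ?N G" by (rule normalizer_subgroup[OF DG])
    interpret NG: finite_group "G\<restriction>?N" using N subgroup_finite_group by blast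
    have LPN: "subgroup LP (G\<restriction>?N)" "card LP = p ^ Suc d" using subgroup_incl[OF LP(1) N LP(4)] LP d by auto
    have LQN: "subgroup LQ (G\<restriction>?N)" "card LQ = p ^ Suc d" using subgroup_incl[OF LQ(1) N LQ(4)] LQ d by auto
    obtain S where S: "is_sylow (G\<restriction>?N) p S" "LP \<subseteq> S" using NG.is_sylow_over[OF p LPN] by blast
    obtain n where n: "n \<in> ?N" "conjg G n ` LQ \<subseteq> S"
      using NG.is_sylow_contain[OF p S(1) LQN] conjg_consistent[OF N] by auto
    have nG: "n \<in> carrier G" using n by (simp add: normalizer_of_def)
    have "inv n \<in> ?N" using N n subgroup.m_inv_closed by metis
    then obtain c s where cs: "c \<in> centralizer_of G ?D" "s \<in> S" "inv n = c \<otimes> s"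
      using normalizer_factor[OF p triv D d S(1)] by blast
    have SG: "subgroup S G" "card S = p ^ multiplicity p (card ?N)" using S incl_subgroup[OF N] by (auto simp: is_sylow_def)
    have cG: "c \<in> carrier G" "s \<in> carrier G" using cs sub_mem[OF SG(1)] by (auto simp: centralizer_of_def)
    have "LQ = conjg G (inv n) ` conjg G n ` LQ"
      using nG LQ(1) by (simp add: conjg_image_conjg conjg_image_one sub_car)
    also have "\<dots> \<subseteq> conjg G (inv n) ` S" using n by blast
    also have "\<dots> = conjg G c ` conjg G s ` S" using cs cG SG by (simp add: conjg_image_conjg sub_car)
    also have "\<dots> \<subseteq> conjg G c ` S" using cs SG conjg_in_subgroup by blast
    finally have LQS: "LQ \<subseteq> conjg G c ` S" .
    obtain R where R: "is_sylow G p R" "S \<subseteq> R" using is_sylow_over[OF p SG] by blast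
    let ?R' = "conjg G c ` R"
    have R': "is_sylow G p ?R'" by (rule is_sylow_conjg[OF R(1) cG(1)])
    have RG: "subgroup R G" "subgroup ?R' G" using R R' is_sylowD by auto
    have "\<exists>c\<in>centralizer_of G (P \<inter> R). R = conjg G c ` P"
    proof (rule less.hyps)
      show "card (carrier G) - card (P \<inter> R) < card (carrier G) - card ?D"
        by (rule big[OF _ LP(1) _ LP(5)]) (use P RG subgroups_Inter_pair LP S R in blast)+
    qed (use R less in auto)
    then obtain c1 where c1: "c1 \<in> centralizer_of G (P \<inter> R)" "R = conjg G c1 ` P" by blast
    have "\<exists>c\<in>centralizer_of G (?R' \<inter> Q). Q = conjg G c ` ?R'"
    proof (rule less.hyps)
      show "card (carrier G) - card (?R' \<inter> Q) < card (carrier G) - card ?D"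
        by (rule big[OF _ LQ(1) _ LQ(5)]) (use Q RG subgroups_Inter_pair LQ LQS R in blast)+
    qed (use R' less in auto)
    then obtain c2 where c2: "c2 \<in> centralizer_of G (?R' \<inter> Q)" "Q = conjg G c2 ` ?R'" by blast
    have "?D \<subseteq> P \<inter> R" "?D \<subseteq> ?R' \<inter> Q" using LP LQ LQS S R by blast+
    hence c12: "c1 \<in> centralizer_of G ?D" "c2 \<in> centralizer_of G ?D"
      using c1(1) c2(1) centralizer_antimono subsetD by metis+
    hence c12G: "c1 \<in> carrier G" "c2 \<in> carrier G" by (auto simp: centralizer_of_def)
    have "Q = conjg G c2 ` conjg G c ` conjg G c1 ` P" by (subst c1(2)[symmetric], rule c2(2))
    also have "\<dots> = conjg G (c2 \<otimes> (c \<otimes> c1)) ` P" using c12G cG P by (simp add: conjg_image_conjg sub_car)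
    finally have "Q = conjg G (c2 \<otimes> (c \<otimes> c1)) ` P" .
    moreover have "c2 \<otimes> (c \<otimes> c1) \<in> centralizer_of G ?D"
      using c12 cs centralizer_subgroup[OF DG] by (simp add: subgroup.m_closed)
    ultimately show ?thesis by blast
  qed
qed

text \<open>Both \<open>P\<close> and its conjugate by \<open>g\<close> contain the element in question. Correcting \<open>g\<close> by an element that centralizes it
yields an element of the normalizer of \<open>P\<close>, and the part of that element outside \<open>P\<close> centralizes \<open>P\<close>.\<close>

lemma sylow_controls_fusion:
  assumes p: "prime p" and triv: "coprime_action_trivial G p"
    and P: "is_sylow G p P" and x: "x \<in> P" and g: "g \<in> carrier G" and gx: "conjg G g x \<in> P"
  shows "\<exists>u\<in>P. conjg G g x = conjg G u x"
proof -
  have Ps: "subgroup P G" using P is_sylowD by blast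
  have xG: "x \<in> carrier G" using x Ps sub_mem by blast
  let ?Q = "conjg G g ` P" let ?z = "conjg G g x"
  obtain c where c: "c \<in> centralizer_of G (P \<inter> ?Q)" "?Q = conjg G c ` P"
    using sylow_fusion_conj[OF p triv P is_sylow_conjg[OF P g]] by blast
  have "?z \<in> P \<inter> ?Q" using x gx by (intro IntI imageI)
  hence cG: "c \<in> carrier G" and cz: "conjg G c ?z = ?z"
    using c(1) unfolding centralizer_of_def by blast+
  define n where "n = inv c \<otimes> g"
  have nG: "n \<in> carrier G" using cG g n_def by simp
  have PG: "P \<subseteq> carrier G" using Ps sub_car by blast
  have "conjg G n ` P = conjg G (inv c) ` ?Q" using cG g PG by (simp add: conjg_image_conjg n_def)
  also have "\<dots> = conjg G (inv c) ` conjg G c ` P" using c by simp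
  also have "\<dots> = P" using cG PG by (simp add: conjg_image_conjg conjg_image_one)
  finally have nN: "n \<in> normalizer_of G P" using nG by (simp add: normalizer_of_def)
  have cP: "card P = p ^ multiplicity p (card (carrier G))" using P by (simp add: is_sylow_def)
  obtain e u where eu: "e \<in> centralizer_of G P" "u \<in> P" "n = e \<otimes> u"
    using normalizer_factor[OF p triv Ps cP is_sylow_in[OF p P normalizer_subgroup[OF PG] normalizer_incl[OF Ps]] nN] by blast
  have euG: "e \<in> carrier G" "u \<in> carrier G" using eu sub_mem[OF Ps] by (auto simp: centralizer_of_def)
  have "?z = conjg G (inv c) (conjg G c ?z)" using cG g xG by simp
  also have "\<dots> = conjg G n x" using cz cG g xG by (simp add: conjg_conjg n_def)
  also have "\<dots> = conjg G e (conjg G u x)" using eu euG xG by (simp add: conjg_conjg)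
  also have "\<dots> = conjg G u x" using eu conjg_in_subgroup[OF Ps eu(2) x] by (simp add: centralizer_of_def)
  finally show ?thesis using eu by blast
qed

end

context finite_group
begin

section \<open>Transfer and normal p-complements\<close>

lemma prime_order_comm_group:
  assumes "prime (card (carrier G))" shows "comm_group G"
proof -
  have "carrier G \<noteq> {\<one>}" using assms by auto
  then obtain x where x: "x \<in> carrier G" "x \<noteq> \<one>" by blast
  have "generate G {x} = {\<one>} \<or> generate G {x} = carrier G"
  proof (rule prime_index_between[OF triv_subgroup subgroup_self assms])
    show "subgroup (generate G {x}) G" using generate_cyclic x by blast
    thus "{\<one>} \<subseteq> generate G {x}" "generate G {x} \<subseteq> carrier G"
      using subgroup.one_closed sub_car by auto
  qed auto
  hence "generate G {x} = carrier G" using generate_cyclic(2)[OF x(1)] x(2) by auto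
  hence "carrier G = range (\<lambda>n::int. x [^] n)" using generate_pow[OF x(1)] by (simp add: full_SetCompr_eq)
  hence "cyclic_group G" unfolding cyclic_group using x(1) by blast
  thus ?thesis by (rule cyclic_imp_abelian_group)
qed

lemma normal_of_prime_index_exists:
  assumes p: "prime p" and card: "card (carrier G) = p ^ Suc a"
  shows "\<exists>W. W \<lhd> G \<and> card (carrier G) = p * card W"
proof -
  let ?P = "{W. subgroup W G \<and> W \<noteq> carrier G}"
  have "card (carrier G) \<noteq> 1" using card p prime_gt_1_nat[OF p] by (metis less_irrefl one_less_power zero_less_Suc)
  hence "{\<one>} \<noteq> carrier G" by (metis One_nat_def card.empty card.insert empty_iff finite.emptyI)
  hence "{\<one>} \<in> ?P" using triv_subgroup by auto
  moreover have "?P \<subseteq> Pow (carrier G)" using sub_car by blast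
  hence "finite ?P" by (rule finite_subset) (simp add: fin)
  ultimately obtain W where "W \<in> ?P" and mx: "\<And>V. V \<in> ?P \<Longrightarrow> card V \<le> card W"
    using finite_max_card by (metis (no_types, lifting))
  hence W: "subgroup W G" "W \<noteq> carrier G" by auto
  obtain L where L: "subgroup L G" "W \<subseteq> L" "L \<subseteq> normalizer_of G W" "card L = p * card W"
    using p_group_grow[OF p subgroup_self card W(1) sub_car[OF W(1)] W(2)] by blast
  have "card W < card L" using L card_pos[OF W(1)] prime_gt_1_nat[OF p] by simp
  hence LG: "L = carrier G" using mx[of L] L by force
  have "W \<lhd> G" by (rule normal_conjgI[OF W(1)]) (use L LG in \<open>auto simp: normalizer_of_def\<close>)
  thus ?thesis using L LG by auto
qed

end

text \<open>The transfer \<open>V\<close> of \<open>G\<close> into \<open>P / W\<close> is nontrivial on \<open>P\<close>, hence onto, and its kernel is the required subgroup. Usually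
\<open>V\<close> is evaluated on \<open>x \<in> P\<close> by decomposing the cosets into cycles of \<open>x\<close>. This is avoided by choosing the
transversal compatibly with the double cosets of \<open>P\<close>: the representative of \<open>c\<close> is \<open>s c = T c \<otimes> u c\<close>, where \<open>T c\<close>
depends only on the double coset \<open>c P\<close> and \<open>u c \<in> P\<close>. Since \<open>P\<close> controls its own fusion, the conjugation by \<open>T c\<close>
does not change values modulo \<open>W\<close>, so the factor belonging to \<open>c\<close> is the image of \<open>u c \<otimes> x \<otimes> inv (u (c #> x))\<close>. The
contributions of \<open>u\<close> cancel in the product over all cosets, and \<open>V x\<close> is the image of \<open>x\<close> raised to the index \<open>m\<close> of \<open>P\<close>, which
is prime to \<open>p\<close>.\<close>

lemma (in finite_group) transfer:
  assumes p: "prime p" and Psyl: "is_sylow G p P"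
    and W: "W \<lhd> G\<restriction>P" and cardW: "card P = p * card W"
    and fusion: "\<And>x g. x \<in> P \<Longrightarrow> g \<in> carrier G \<Longrightarrow> conjg G g x \<in> P \<Longrightarrow> \<exists>u\<in>P. conjg G g x = conjg G u x"
  shows "\<exists>K. K \<lhd> G \<and> card (carrier G) = p * card K"
proof -
  let ?E = "rcosets P"
  have P: "subgroup P G" using Psyl is_sylowD by blast
  interpret P: subgroup P G by fact
  interpret PG: finite_group "G\<restriction>P" using P subgroup_finite_group by blast
  have WP: "W \<subseteq> P" using normal_imp_subgroup[OF W] subgroup.subset by fastforce
  have W0: "card W > 0" using PG.card_pos normal_imp_subgroup[OF W] by blast
  define A where "A = G\<restriction>P Mod W"
  have cardA: "card (carrier A) = p" using PG.card_Mod[OF W] cardW W0 by (simp add: A_def)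
  interpret A: finite_group A unfolding A_def by (rule PG.finite_group_Mod[OF W])
  interpret A: comm_group A using A.prime_order_comm_group cardA p by simp
  define \<phi> where "\<phi> = (\<lambda>x. W #> x)"
  have \<phi>hom: "group_hom (G\<restriction>P) A \<phi>" using PG.group_hom_Mod[OF W] by (simp add: \<phi>_def A_def)
  interpret \<phi>: group_hom "G\<restriction>P" A \<phi> by fact
  have \<phi>c: "\<phi> x \<in> carrier A" if "x \<in> P" for x using \<phi>.hom_closed that by simp
  have \<phi>m: "\<phi> (x \<otimes> y) = \<phi> x \<otimes>\<^bsub>A\<^esub> \<phi> y" if "x \<in> P" "y \<in> P" for x y using \<phi>.hom_mult that by simp
  have \<phi>i: "\<phi> (inv x) = inv\<^bsub>A\<^esub> \<phi> x" if "x \<in> P" for x using \<phi>.hom_inv[of x] that P by simp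
  have \<phi>1: "\<phi> x = \<one>\<^bsub>A\<^esub> \<longleftrightarrow> x \<in> W" if "x \<in> P" for x
    using PG.Mod_one_iff[OF W] that by (simp add: \<phi>_def A_def)
  have stable: "\<phi> (conjg G g x) = \<phi> x" if x: "x \<in> P" and g: "g \<in> carrier G" and gx: "conjg G g x \<in> P" for g x
  proof -
    obtain u where u: "u \<in> P" "conjg G g x = conjg G u x" using fusion[OF x g gx] by blast
    have "\<phi> (conjg G u x) = \<phi> u \<otimes>\<^bsub>A\<^esub> \<phi> x \<otimes>\<^bsub>A\<^esub> inv\<^bsub>A\<^esub> \<phi> u"
      using u x by (simp add: conjg_def \<phi>m \<phi>i)
    also have "\<dots> = \<phi> x" using \<phi>c[OF u(1)] \<phi>c[OF x] by (simp add: A.m_comm[of "\<phi> u" "\<phi> x"] A.m_assoc)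
    finally show ?thesis using u by simp
  qed
  have fE: "finite ?E" using fin by (simp add: RCOSETS_def)
  have Ec: "c \<subseteq> carrier G" if "c \<in> ?E" for c using that P.rcosets_carrier[OF is_group] by blast
  have En: "c \<noteq> {}" if "c \<in> ?E" for c using that P.rcosets_non_empty by blast
  have Ex: "c #> x \<in> ?E" if "c \<in> ?E" "x \<in> carrier G" for c x
    using that P.subset by (auto simp: RCOSETS_def coset_mult_assoc)
  have Einj: "inj_on (\<lambda>c. c #> x) ?E" if x: "x \<in> carrier G" for x
    by (rule inj_on_inverseI[where g = "\<lambda>c. c #> inv x"]) (use x Ec in \<open>simp add: coset_mult_assoc\<close>)
  have Eimg: "(\<lambda>c. c #> x) ` ?E = ?E" if x: "x \<in> carrier G" for x
    using endo_inj_surj[OF fE _ Einj[OF x]] Ex x by blast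
  define T where "T c = (SOME z. z \<in> c <#> P)" for c
  define u where "u c = (SOME u. u \<in> P \<and> T c \<otimes> u \<in> c)" for c
  define s where "s c = T c \<otimes> u c" for c
  have T: "T c \<in> c <#> P" if c: "c \<in> ?E" for c
  proof -
    obtain z where "z \<in> c" using En[OF c] by blast
    hence "z \<otimes> \<one> \<in> c <#> P" using P.one_closed unfolding set_mult_def by blast
    thus ?thesis unfolding T_def by (rule someI)
  qed
  have Tc: "T c \<in> carrier G" if c: "c \<in> ?E" for c
    using T[OF c] set_mult_closed[OF Ec[OF c] P.subset] by blast
  have u: "u c \<in> P \<and> T c \<otimes> u c \<in> c" if c: "c \<in> ?E" for c
  proof -
    obtain z v where zv: "z \<in> c" "v \<in> P" "T c = z \<otimes> v" using T[OF c] by (auto simp: set_mult_def)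
    have "z \<in> carrier G" using zv Ec[OF c] by blast
    hence "T c \<otimes> inv v = z" using zv by (simp add: m_assoc)
    hence "inv v \<in> P \<and> T c \<otimes> inv v \<in> c" using zv by simp
    thus ?thesis unfolding u_def by (rule someI)
  qed
  have s: "s c \<in> c" "s c \<in> carrier G" if c: "c \<in> ?E" for c
    using u[OF c] Ec[OF c] by (auto simp: s_def)
  have Teq: "T (c #> x) = T c" if c: "c \<in> ?E" and x: "x \<in> P" for c x
  proof -
    have "(c #> x) <#> P = c <#> (x <# P)"
      using Ec[OF c] x P.subset by (simp add: r_coset_eq_set_mult l_coset_eq_set_mult set_mult_assoc)
    also have "x <# P = P" using coset_join3[OF _ P x] x by simp
    finally show ?thesis by (simp add: T_def)
  qed
  define \<tau> where "\<tau> x c = s c \<otimes> x \<otimes> inv (s (c #> x))" for x c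
  have \<tau>P: "\<tau> x c \<in> P" if c: "c \<in> ?E" and x: "x \<in> carrier G" for x c
  proof -
    have "s c \<otimes> x \<in> c #> x" using s(1)[OF c] by (auto simp: r_coset_def)
    thus ?thesis unfolding \<tau>_def
      by (intro diff_neutralizes[OF P Ex[OF c x]]) (use s(1)[OF Ex[OF c x]] in auto)
  qed
  define V where "V x = finprod A (\<lambda>c. \<phi> (\<tau> x c)) ?E" for x
  have Vc: "V x \<in> carrier A" if "x \<in> carrier G" for x
    unfolding V_def by (rule A.finprod_closed) (use \<tau>P \<phi>c that in auto)
  have Vm: "V (x \<otimes> y) = V x \<otimes>\<^bsub>A\<^esub> V y" if x: "x \<in> carrier G" and y: "y \<in> carrier G" for x y
  proof -
    have split: "\<phi> (\<tau> (x \<otimes> y) c) = \<phi> (\<tau> x c) \<otimes>\<^bsub>A\<^esub> \<phi> (\<tau> y (c #> x))" if c: "c \<in> ?E" for c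
    proof -
      have cx: "c #> x \<in> ?E" by (rule Ex[OF c x])
      have cxy: "c #> x #> y = c #> (x \<otimes> y)" using coset_mult_assoc[OF Ec[OF c] x y] .
      have S: "s c \<in> carrier G" "s (c #> x) \<in> carrier G" "s (c #> (x \<otimes> y)) \<in> carrier G"
        using s(2) c cx Ex[OF c, of "x \<otimes> y"] x y by auto
      have "\<tau> (x \<otimes> y) c = \<tau> x c \<otimes> \<tau> y (c #> x)"
        unfolding \<tau>_def cxy using S x y by (simp add: m_assoc inv_solve_left)
      thus ?thesis using \<phi>m[OF \<tau>P[OF c x] \<tau>P[OF cx y]] by simp
    qed
    have "V (x \<otimes> y) = finprod A (\<lambda>c. \<phi> (\<tau> x c) \<otimes>\<^bsub>A\<^esub> \<phi> (\<tau> y (c #> x))) ?E"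
      unfolding V_def by (rule A.finprod_cong') (use split \<tau>P \<phi>c Ex x y in auto)
    also have "\<dots> = V x \<otimes>\<^bsub>A\<^esub> finprod A (\<lambda>c. \<phi> (\<tau> y (c #> x))) ?E"
      unfolding V_def by (rule A.finprod_multf) (use \<tau>P \<phi>c Ex x y in auto)
    also have "finprod A (\<lambda>c. \<phi> (\<tau> y (c #> x))) ?E = V y"
      unfolding V_def
      using A.finprod_reindex[of "\<lambda>c. \<phi> (\<tau> y c)" "\<lambda>c. c #> x" ?E] Einj[OF x] Eimg[OF x] \<tau>P \<phi>c y by auto
    finally show ?thesis .
  qed
  have Vhom: "group_hom G A V"
    by (intro group_hom.intro group_hom_axioms.intro homI is_group A.is_group Vc Vm)
  define m where "m = card ?E"
  have pm: "\<not> p dvd m"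
  proof -
    have "m * card P = card (carrier G)" using lagrange[OF P] by (simp add: m_def order_def)
    moreover obtain k where "card (carrier G) = p ^ multiplicity p (card (carrier G)) * k" "\<not> p dvd k"
      using multiplicity_decompose'[of "card (carrier G)" p] order_pos prime_gt_1_nat[OF p] by force
    ultimately show ?thesis using Psyl prime_gt_0_nat[OF p] unfolding is_sylow_def
      by (metis mult.commute mult_cancel1 not_gr0 power_not_zero)
  qed
  have VP: "V x = \<phi> x [^]\<^bsub>A\<^esub> m" if x: "x \<in> P" for x
  proof -
    have xG: "x \<in> carrier G" using x by simp
    have trm: "\<phi> (\<tau> x c) = \<phi> x \<otimes>\<^bsub>A\<^esub> (\<phi> (u c) \<otimes>\<^bsub>A\<^esub> inv\<^bsub>A\<^esub> \<phi> (u (c #> x)))" if c: "c \<in> ?E" for c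
    proof -
      have cx: "c #> x \<in> ?E" by (rule Ex[OF c xG])
      let ?e = "u c \<otimes> x \<otimes> inv (u (c #> x))"
      have uu: "u c \<in> P" "u (c #> x) \<in> P" using u c cx by auto
      have e: "?e \<in> P" using uu x by simp
      have TG: "T c \<in> carrier G" "u c \<in> carrier G" "u (c #> x) \<in> carrier G" using Tc[OF c] uu by auto
      have "\<tau> x c = conjg G (T c) ?e"
        unfolding \<tau>_def s_def Teq[OF c x] using TG xG by (simp add: conjg_def m_assoc inv_mult_group)
      hence "\<phi> (\<tau> x c) = \<phi> ?e" using stable[OF e TG(1)] \<tau>P[OF c xG] by simp
      also have "\<dots> = \<phi> (u c) \<otimes>\<^bsub>A\<^esub> \<phi> x \<otimes>\<^bsub>A\<^esub> inv\<^bsub>A\<^esub> \<phi> (u (c #> x))"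
        using uu x by (simp add: \<phi>m \<phi>i)
      also have "\<dots> = \<phi> x \<otimes>\<^bsub>A\<^esub> (\<phi> (u c) \<otimes>\<^bsub>A\<^esub> inv\<^bsub>A\<^esub> \<phi> (u (c #> x)))"
        using \<phi>c[OF uu(1)] \<phi>c[OF uu(2)] \<phi>c[OF x] by (simp add: A.m_comm[of "\<phi> (u c)" "\<phi> x"] A.m_assoc)
      finally show ?thesis .
    qed
    let ?U = "finprod A (\<lambda>c. \<phi> (u c)) ?E" and ?U' = "finprod A (\<lambda>c. inv\<^bsub>A\<^esub> \<phi> (u c)) ?E"
    have uc: "\<phi> (u c) \<in> carrier A" if "c \<in> ?E" for c using u \<phi>c that by blast
    have ucx: "\<phi> (u (c #> x)) \<in> carrier A" if "c \<in> ?E" for c using uc Ex[OF that xG] by blast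
    have "V x = finprod A (\<lambda>c. \<phi> x \<otimes>\<^bsub>A\<^esub> (\<phi> (u c) \<otimes>\<^bsub>A\<^esub> inv\<^bsub>A\<^esub> \<phi> (u (c #> x)))) ?E"
      unfolding V_def by (rule A.finprod_cong') (use trm uc ucx \<phi>c[OF x] in auto)
    also have "\<dots> = finprod A (\<lambda>c. \<phi> x) ?E \<otimes>\<^bsub>A\<^esub> finprod A (\<lambda>c. \<phi> (u c) \<otimes>\<^bsub>A\<^esub> inv\<^bsub>A\<^esub> \<phi> (u (c #> x))) ?E"
      by (rule A.finprod_multf) (use uc ucx \<phi>c[OF x] in auto)
    also have "finprod A (\<lambda>c. \<phi> x) ?E = \<phi> x [^]\<^bsub>A\<^esub> m" using A.finprod_const[OF \<phi>c[OF x]] by (simp add: m_def)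
    also have "finprod A (\<lambda>c. \<phi> (u c) \<otimes>\<^bsub>A\<^esub> inv\<^bsub>A\<^esub> \<phi> (u (c #> x))) ?E
        = ?U \<otimes>\<^bsub>A\<^esub> finprod A (\<lambda>c. inv\<^bsub>A\<^esub> \<phi> (u (c #> x))) ?E"
      by (rule A.finprod_multf) (use uc ucx in auto)
    also have "finprod A (\<lambda>c. inv\<^bsub>A\<^esub> \<phi> (u (c #> x))) ?E = ?U'"
      using A.finprod_reindex[of "\<lambda>c. inv\<^bsub>A\<^esub> \<phi> (u c)" "\<lambda>c. c #> x" ?E] Einj[OF xG] Eimg[OF xG] uc by auto
    also have "?U \<otimes>\<^bsub>A\<^esub> ?U' = finprod A (\<lambda>c. \<phi> (u c) \<otimes>\<^bsub>A\<^esub> inv\<^bsub>A\<^esub> \<phi> (u c)) ?E"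
      by (rule A.finprod_multf[symmetric]) (use uc in auto)
    also have "\<dots> = finprod A (\<lambda>c. \<one>\<^bsub>A\<^esub>) ?E"
      by (rule A.finprod_cong') (use uc in auto)
    also have "\<dots> = \<one>\<^bsub>A\<^esub>" by (rule A.finprod_one)
    finally show ?thesis using \<phi>c[OF x] by simp
  qed
  interpret V: group_hom G A V by fact
  let ?K = "kernel G A V"
  have K: "?K \<lhd> G" by (rule V.normal_kernel)
  have cardV: "card (V ` carrier G) * card ?K = card (carrier G)"
    using card_hom_image[OF Vhom subgroup_self] by (simp add: kernel_def)
  have Vs: "subgroup (V ` carrier G) A" by (rule V.img_is_subgroup)
  have "V ` carrier G = {\<one>\<^bsub>A\<^esub>} \<or> V ` carrier G = carrier A"
    by (rule A.prime_index_between[OF A.triv_subgroup A.subgroup_self p])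
       (use cardA Vs subgroup.one_closed[OF Vs] subgroup.subset[OF Vs] in auto)
  moreover have "V ` carrier G \<noteq> {\<one>\<^bsub>A\<^esub>}"
  proof
    assume triv: "V ` carrier G = {\<one>\<^bsub>A\<^esub>}"
    have "W \<noteq> P" using cardW W0 prime_gt_1_nat[OF p] by auto
    then obtain x where x: "x \<in> P" "x \<notin> W" using WP by blast
    have xA: "\<phi> x \<in> carrier A" using \<phi>c x by blast
    have "\<phi> x [^]\<^bsub>A\<^esub> m = \<one>\<^bsub>A\<^esub>" using VP[OF x(1)] triv P.mem_carrier[OF x(1)] by blast
    hence "A.ord (\<phi> x) dvd m" using A.pow_eq_id[OF xA] by simp
    moreover have "A.ord (\<phi> x) dvd p" using A.ord_dvd_group_order[OF xA] cardA by (simp add: order_def)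
    ultimately have "A.ord (\<phi> x) = 1" using pm p by (metis prime_nat_iff)
    hence "\<phi> x = \<one>\<^bsub>A\<^esub>" using A.ord_eq_1[OF xA] by simp
    thus False using \<phi>1 x by blast
  qed
  ultimately have "card (V ` carrier G) = p" using cardA by simp
  thus ?thesis using K cardV by metis
qed

context finite_group
begin

text \<open>A normal Hall subgroup is recognized by the orders of its elements, hence invariant under all automorphisms.\<close>

lemma normal_hall_pow:
  assumes M: "M \<lhd> G" and cop: "coprime (card M) (card (carrier G) div card M)"
  shows "M = {x \<in> carrier G. x [^] card M = \<one>}"
proof
  have Ms: "subgroup M G" using M normal_sub by blast
  interpret MG: group "G\<restriction>M" using Ms subgroup_imp_group by blast
  show "M \<subseteq> {x \<in> carrier G. x [^] card M = \<one>}"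
  proof
    fix x assume x: "x \<in> M"
    have "x [^]\<^bsub>G\<restriction>M\<^esub> card M = \<one>" using MG.pow_order_eq_1[of x] x by (simp add: order_def)
    thus "x \<in> {x \<in> carrier G. x [^] card M = \<one>}"
      using x sub_mem[OF Ms] nat_pow_consistent[of x "card M" M] by simp
  qed
  interpret Q: finite_group "G Mod M" by (rule finite_group_Mod[OF M])
  interpret f: group_hom G "G Mod M" "\<lambda>x. M #> x" by (rule group_hom_Mod[OF M])
  show "{x \<in> carrier G. x [^] card M = \<one>} \<subseteq> M"
  proof
    fix x assume "x \<in> {x \<in> carrier G. x [^] card M = \<one>}"
    hence x: "x \<in> carrier G" "x [^] card M = \<one>" by auto
    have xQ: "M #> x \<in> carrier (G Mod M)" using f.hom_closed x by blast
    have "(M #> x) [^]\<^bsub>G Mod M\<^esub> card M = \<one>\<^bsub>G Mod M\<^esub>" using f.hom_nat_pow[OF x(1), of "card M"] x by simp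
    hence 1: "Q.ord (M #> x) dvd card M" using Q.pow_eq_id[OF xQ] by simp
    have "card (carrier (G Mod M)) = card (carrier G) div card M"
      using card_Mod[OF M] card_pos[OF Ms] by (metis div_mult_self_is_m)
    hence "Q.ord (M #> x) dvd card (carrier G) div card M" using Q.ord_dvd_group_order[OF xQ] by (simp add: order_def)
    hence "Q.ord (M #> x) = 1" using 1 cop coprime_common_divisor_nat by blast
    hence "M #> x = \<one>\<^bsub>G Mod M\<^esub>" using Q.ord_eq_1[OF xQ] by simp
    thus "x \<in> M" using Mod_one_iff[OF M x(1)] by simp
  qed
qed

lemma normal_hall_trans:
  assumes K: "K \<lhd> G" and M: "M \<lhd> G\<restriction>K" and cop: "coprime (card M) (card K div card M)"
  shows "M \<lhd> G"
proof -
  have Ks: "subgroup K G" using K normal_sub by blast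
  have Ms: "subgroup M G" using M normal_imp_subgroup incl_subgroup[OF Ks] by blast
  interpret KG: finite_group "G\<restriction>K" using Ks subgroup_finite_group by blast
  have Meq: "M = {x \<in> K. x [^] card M = \<one>}"
    using KG.normal_hall_pow[OF M] cop nat_pow_consistent[of _ "card M" K] by simp
  show ?thesis
  proof (rule normal_conjgI[OF Ms])
    fix g x assume g: "g \<in> carrier G" and x: "x \<in> M"
    interpret f: group_hom G G "conjg G g" by (rule group_hom_conjg[OF g])
    have xK: "x \<in> K" "x [^] card M = \<one>" "x \<in> carrier G" using x Meq sub_mem[OF Ks] by auto
    have "conjg G g x [^] card M = conjg G g (x [^] card M)" using f.hom_nat_pow[OF xK(3)] by simp
    also have "\<dots> = \<one>" using xK by simp
    finally have "conjg G g x \<in> {x \<in> K. x [^] card M = \<one>}" using conjg_normal[OF K g xK(1)] by simp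
    thus "conjg G g x \<in> M" using Meq by blast
  qed
qed

end

text \<open>Frobenius' theorem. A normal subgroup of index \<open>p\<close> comes from the transfer; its normal \<open>p\<close>-complement is a Hall subgroup
and therefore normal in \<open>G\<close>.\<close>

lemma normal_p_complement:
  assumes "finite_group G" and p: "prime p" and "coprime_action_trivial G p"
  shows "\<exists>M k. M \<lhd> G \<and> \<not> p dvd card M \<and> card (carrier G) = p ^ k * card M"
  using assms(1,3)
proof (induction "card (carrier G)" arbitrary: G rule: less_induct)
  case less
  interpret finite_group G by fact
  show ?case
  proof (cases "p dvd card (carrier G)")
    case False
    thus ?thesis using normal_self by (intro exI[of _ "carrier G"] exI[of _ 0]) simp
  next
    case True
    obtain P where P: "is_sylow G p P" using is_sylow_exists[OF p] by blast
    have Ps: "subgroup P G" using P is_sylowD by blast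
    interpret PG: finite_group "G\<restriction>P" using Ps subgroup_finite_group by blast
    have "multiplicity p (card (carrier G)) \<noteq> 0"
      using True order_pos prime_gt_1_nat[OF p] multiplicity_geI[of "card (carrier G)" p 1] by auto
    then obtain a where "card P = p ^ Suc a" using P unfolding is_sylow_def by (metis not0_implies_Suc)
    then obtain W where W: "W \<lhd> G\<restriction>P" "card P = p * card W"
      using PG.normal_of_prime_index_exists[OF p] by auto
    obtain K where K: "K \<lhd> G" "card (carrier G) = p * card K"
      using transfer[OF p P W sylow_controls_fusion[OF p less.prems(2) P]] by blast
    have Ks: "subgroup K G" using K normal_sub by blast
    have "card K < card (carrier G)" using K card_pos[OF Ks] prime_gt_1_nat[OF p] by simp
    then obtain M k where M: "M \<lhd> G\<restriction>K" "\<not> p dvd card M" "card K = p ^ k * card M"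
      using less.hyps[of "G\<restriction>K"] subgroup_finite_group[OF Ks]
        coprime_action_in_subgroup[OF less.prems(2) Ks] by auto
    have "card M > 0" using M card_pos[OF Ks] by (metis mult_0_right not_gr0)
    hence "card K div card M = p ^ k" using M by simp
    moreover have "coprime (card M) (p ^ k)" using prime_imp_coprime[OF p M(2)] by (simp add: coprime_commute)
    ultimately have "M \<lhd> G" by (intro normal_hall_trans[OF K(1) M(1)]) simp
    moreover have "card (carrier G) = p ^ Suc k * card M" using K M by simp
    ultimately show ?thesis using M by blast
  qed
qed

section \<open>Chains from cyclic primary subgroups\<close>

lemma smallest_prime_divisor:
  fixes n :: nat assumes "n \<noteq> 1"
  obtains p where "prime p" "p dvd n" "\<And>q. prime q \<Longrightarrow> q dvd n \<Longrightarrow> p \<le> q"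
proof -
  let ?P = "\<lambda>p. prime p \<and> p dvd n"
  obtain p0 where "?P p0" using prime_factor_nat[OF assms] by blast
  hence "?P (LEAST p. ?P p)" by (rule LeastI)
  moreover have "(LEAST p. ?P p) \<le> q" if "?P q" for q by (rule Least_le[of ?P, OF that])
  ultimately show ?thesis using that by blast
qed

context finite_group
begin

text \<open>Frattini's argument. It serves to find a Sylow subgroup of \<open>M\<close> normalized by a given \<open>p\<close>-group when \<open>p\<close> does not divide
the order of \<open>M\<close>: such a group fixes a coset of the normalizer.\<close>

lemma frattini_index:
  assumes M: "M \<lhd> G" and s: "prime s" and S: "is_sylow (G\<restriction>M) s S"
  shows "card (carrier G) div card (normalizer_of G S) dvd card M"
proof -
  have Ms: "subgroup M G" using M normal_sub by blast
  interpret MG: finite_group "G\<restriction>M" using Ms subgroup_finite_group by blast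
  have SM: "subgroup S (G\<restriction>M)" "S \<subseteq> M" using MG.is_sylowD[OF S] subgroup.subset by fastforce+
  have Ss: "subgroup S G" using SM incl_subgroup[OF Ms] by blast
  let ?N = "normalizer_of G S"
  have N: "subgroup ?N G" by (rule normalizer_subgroup[OF sub_car[OF Ss]])
  have "carrier G \<subseteq> M <#> ?N"
  proof
    fix g assume g: "g \<in> carrier G"
    let ?T = "conjg G g ` S"
    have TM: "?T \<subseteq> M" using SM(2) conjg_normal[OF M g] by blast
    have T: "subgroup ?T (G\<restriction>M)" by (rule subgroup_incl[OF conjg_subgroup[OF g Ss] Ms TM])
    have cT: "card ?T = s ^ multiplicity s (card (carrier (G\<restriction>M)))"
      using card_conjg[OF g sub_car[OF Ss]] S by (simp add: is_sylow_def)
    obtain m where m: "m \<in> M" "conjg G m ` ?T \<subseteq> S"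
      using MG.is_sylow_contain[OF s S T cT] conjg_consistent[OF Ms] by auto
    have mG: "m \<in> carrier G" using sub_mem[OF Ms] m by blast
    have "conjg G (m \<otimes> g) ` S \<subseteq> S" using m(2) conjg_image_conjg[OF mG g sub_car[OF Ss]] by simp
    hence "m \<otimes> g \<in> ?N" using mG g by (simp add: normalizer_of_def)
    moreover have "inv m \<in> M" using Ms m subgroup.m_inv_closed by metis
    moreover have "g = inv m \<otimes> (m \<otimes> g)" using mG g by (simp flip: m_assoc)
    ultimately show "g \<in> M <#> ?N" unfolding set_mult_def by blast
  qed
  hence "M <#> ?N = carrier G" using set_mult_closed[OF sub_car[OF Ms] sub_car[OF N]] by blast
  hence "card (carrier G) * card (M \<inter> ?N) = card M * card ?N" using card_set_mult[OF Ms N] by simp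
  moreover obtain d where d: "card (carrier G) = card ?N * d" using card_subgroup_dvd_order[OF N] by blast
  ultimately have "card ?N * (d * card (M \<inter> ?N)) = card ?N * card M" by (simp add: mult.commute mult.left_commute)
  hence "d * card (M \<inter> ?N) = card M" using card_pos[OF N] by simp
  moreover have "card (carrier G) div card ?N = d" using d card_pos[OF N] by simp
  ultimately show ?thesis by (metis dvd_triv_left)
qed

end

text \<open>Let \<open>M\<close> be a normal \<open>p\<close>-complement for the least prime \<open>p\<close>. If \<open>M\<langle>y\<rangle>\<close> is proper, induction leads up to it, and
above it only a \<open>p\<close>-group remains. Otherwise \<open>y\<close> is a \<open>p\<close>-element; with a normal \<open>s\<close>-complement \<open>L\<close> of \<open>M\<close> for the least
prime divisor \<open>s\<close> of its order and a Sylow \<open>s\<close>-subgroup \<open>S\<close> of \<open>M\<close> normalized by \<open>y\<close>, induction leads up to \<open>L\<langle>y\<rangle>\<close>, and the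
chain from \<open>\<langle>y\<rangle>\<close> to \<open>S\<langle>y\<rangle>\<close>, multiplied by \<open>L\<close>, leads from there to \<open>G\<close>.\<close>

lemma (in finite_group) primary_prime_chain_step:
  assumes chains: "chains_over_p_subgroups G" and y: "y \<in> carrier G"
    and q: "prime q" and cY: "card (generate G {y}) = q ^ b"
    and IH: "\<And>H. subgroup H G \<Longrightarrow> generate G {y} \<subseteq> H \<Longrightarrow> card H < card (carrier G)
      \<Longrightarrow> prime_chain G (generate G {y}) H"
  shows "prime_chain G (generate G {y}) (carrier G)"
proof -
  let ?Y = "generate G {y}"
  have Y: "subgroup ?Y G" "y \<in> ?Y" using generate_cyclic y by auto
  show ?thesis
  proof (cases "card (carrier G) = 1")
    case True
    hence "?Y = carrier G" using subgroup_eqI[OF Y(1) subgroup_self sub_car[OF Y(1)]] card_pos[OF Y(1)] by simp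
    thus ?thesis using prime_chain.refl[OF Y(1)] by simp
  next
    case False
    then obtain p where p: "prime p" "p dvd card (carrier G)"
      and small: "\<And>r. prime r \<Longrightarrow> r dvd card (carrier G) \<Longrightarrow> p \<le> r"
      using smallest_prime_divisor by blast
    obtain M k where M: "M \<lhd> G" "\<not> p dvd card M" "card (carrier G) = p ^ k * card M"
      using normal_p_complement[OF finite_group_axioms p(1) chains_imp_coprime_action[OF chains p(1) small]] by blast
    have Ms: "subgroup M G" using M normal_sub by blast
    let ?MY = "M <#> ?Y"
    have MY: "subgroup ?MY G" by (rule mult_normal_subgroup[OF M(1) Y(1)])
    have inMY: "M \<subseteq> ?MY" "?Y \<subseteq> ?MY" using set_mult_incl[OF Ms Y(1)] by auto
    show ?thesis
    proof (cases "?MY = carrier G")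
      case False
      have "card ?MY < card (carrier G)" using subgroup_eqI[OF MY subgroup_self sub_car[OF MY]] False by force
      hence "prime_chain G ?Y ?MY" using IH[OF MY inMY(2)] by blast
      moreover have "prime_chain G ?MY (carrier G)" by (rule prime_chain_above_normal[OF p(1) M(1,3) MY inMY(1)])
      ultimately show ?thesis using prime_chain_trans by blast
    next
      case MYG: True
      have "card (carrier G) * card (M \<inter> ?Y) = card M * q ^ b" using card_set_mult[OF Ms Y(1)] MYG cY by simp
      hence "p dvd card M * q ^ b" using p(2) by (metis dvd_mult2)
      hence "p dvd q ^ b" using M p prime_dvd_mult_iff by blast
      hence pq: "p = q" using p q prime_dvd_power primes_dvd_imp_eq by blast
      have copM: "coprime m (q ^ b)" if "m dvd card M" for m
      proof -
        have "\<not> q dvd m" using that M(2) pq dvd_trans by blast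
        thus ?thesis using prime_imp_coprime[OF q] by (simp add: coprime_commute)
      qed
      have cG: "card (carrier G) = card M * q ^ b"
        using card_set_mult_coprime(1)[OF Ms Y(1)] copM[of "card M"] cY MYG by simp
      show ?thesis
      proof (cases "card M = 1")
        case True
        hence "?Y = carrier G" using subgroup_eqI[OF Y(1) subgroup_self sub_car[OF Y(1)]] cG cY by simp
        thus ?thesis using prime_chain.refl[OF Y(1)] by simp
      next
        case False
        then obtain s where s: "prime s" "s dvd card M"
          and smalls: "\<And>r. prime r \<Longrightarrow> r dvd card M \<Longrightarrow> s \<le> r"
          using smallest_prime_divisor by blast
        interpret MG: finite_group "G\<restriction>M" using Ms subgroup_finite_group by blast
        have "coprime_action_trivial (G\<restriction>M) s"
          by (rule MG.chains_imp_coprime_action[OF chains_in_subgroup[OF chains Ms] s(1)]) (use smalls in simp)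
        then obtain L j where L: "L \<lhd> G\<restriction>M" "\<not> s dvd card L" "card M = s ^ j * card L"
          using normal_p_complement[OF subgroup_finite_group[OF Ms] s(1)] by auto
        have L0: "card L > 0" using L(3) card_pos[OF Ms] by (metis mult_0_right not_gr0)
        have cLs: "coprime (card L) (s ^ i)" for i using prime_imp_coprime[OF s(1) L(2)] by (simp add: coprime_commute)
        have LG: "L \<lhd> G" using cLs[of j] L0 L(3) by (intro normal_hall_trans[OF M(1) L(1)]) simp
        have Ls: "subgroup L G" using LG normal_sub by blast
        have "j \<noteq> 0" using s(2) L(2,3) by (cases j) auto
        hence "1 < s ^ j" using one_less_power[OF prime_gt_1_nat[OF s(1)], of j] by simp
        hence LM: "card L < card M" using L(3) L0 by simp
        obtain S0 where S0: "is_sylow (G\<restriction>M) s S0" using MG.is_sylow_exists[OF s(1)] by blast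
        have S0s: "subgroup S0 G" "S0 \<subseteq> M" "card S0 = s ^ multiplicity s (card M)"
          using S0 incl_subgroup[OF Ms] subgroup.subset by (fastforce simp: is_sylow_def)+
        have "\<not> is_unit s" using s(1) not_prime_unit by blast
        hence "multiplicity s (card M) = j"
          using multiplicity_decomposeI[OF L(3) L(2)] L0 s(1) by auto
        hence cS0: "card S0 = s ^ j" using S0s by simp
        let ?N0 = "normalizer_of G S0"
        have N0: "subgroup ?N0 G" by (rule normalizer_subgroup[OF sub_car[OF S0s(1)]])
        have "\<not> p dvd card (carrier G) div card ?N0"
          using frattini_index[OF M(1) s(1) S0] M(2) dvd_trans by blast
        then obtain g where g: "g \<in> carrier G" "conjg G g ` ?Y \<subseteq> ?N0"
          using sylow_contain[OF q Y(1) cY N0] pq by blast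
        define S where "S = conjg G (inv g) ` S0"
        have S: "subgroup S G" "card S = s ^ j"
          using conjg_subgroup[OF _ S0s(1)] card_conjg[OF _ sub_car[OF S0s(1)]] g cS0 by (auto simp: S_def)
        have SM: "S \<subseteq> M" unfolding S_def using S0s(2) conjg_normal[OF M(1), of "inv g"] g by auto
        have "conjg G y ` S \<subseteq> S"
        proof -
          have gy: "conjg G g y \<in> carrier G" "conjg G g y \<in> ?N0" using g y Y(2) by auto
          have "y \<otimes> inv g = inv g \<otimes> conjg G g y" using g y by (simp add: conjg_def flip: m_assoc)
          hence "conjg G y ` S = conjg G (inv g) ` conjg G (conjg G g y) ` S0"
            unfolding S_def using g y gy sub_car[OF S0s(1)] by (simp add: conjg_image_conjg)
          also have "conjg G (conjg G g y) ` S0 = S0" by (rule normalizer_eq[OF gy(2) sub_car[OF S0s(1)]])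
          finally show ?thesis by (simp add: S_def)
        qed
        hence "prime_chain G ?Y (S <#> ?Y)" using chains s(1) S y unfolding chains_over_p_subgroups_def by blast
        hence c1: "prime_chain G (L <#> ?Y) (L <#> (S <#> ?Y))" by (rule prime_chain_normal_mult[OF LG])
        have SY: "subgroup (S <#> ?Y) G" using prime_chain_subgroups[OF \<open>prime_chain G ?Y (S <#> ?Y)\<close>] by blast
        have LSY: "subgroup (L <#> (S <#> ?Y)) G" by (rule mult_normal_subgroup[OF LG SY])
        have sub: "L \<subseteq> L <#> (S <#> ?Y)" "S <#> ?Y \<subseteq> L <#> (S <#> ?Y)" using set_mult_incl[OF Ls SY] by auto
        have SYi: "S \<subseteq> S <#> ?Y" "?Y \<subseteq> S <#> ?Y" using set_mult_incl[OF S(1) Y(1)] by auto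
        have LS: "subgroup (L <#> S) G" by (rule mult_normal_subgroup[OF LG S(1)])
        have LM': "L \<subseteq> M" using L(1) normal_imp_subgroup subgroup.subset by fastforce
        have "card (L <#> S) = card M" using card_set_mult_coprime(1)[OF Ls S(1)] cLs S L(3) by (simp add: mult.commute)
        hence "L <#> S = M" using subgroup_eqI[OF LS Ms set_mult_least[OF Ms LM' SM]] by simp
        hence "M \<subseteq> L <#> (S <#> ?Y)" using set_mult_least[OF LSY sub(1)] sub(2) SYi(1) by blast
        hence "?MY \<subseteq> L <#> (S <#> ?Y)" using set_mult_least[OF LSY] sub(2) SYi(2) by blast
        hence full: "L <#> (S <#> ?Y) = carrier G" using MYG sub_car[OF LSY] by blast
        have LY: "subgroup (L <#> ?Y) G" by (rule mult_normal_subgroup[OF LG Y(1)])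
        have "coprime (card L) (card ?Y)" using copM[of "card L"] L(3) cY by simp
        hence "card (L <#> ?Y) = card L * q ^ b" using card_set_mult_coprime(1)[OF Ls Y(1)] cY by simp
        hence "card (L <#> ?Y) < card (carrier G)" using cG LM prime_gt_0_nat[OF q] by simp
        hence "prime_chain G ?Y (L <#> ?Y)" using IH[OF LY set_mult_incl(2)[OF Ls Y(1)]] by blast
        thus ?thesis using c1 full prime_chain_trans by metis
      qed
    qed
  qed
qed

lemma primary_prime_chain:
  assumes "finite_group G" and "chains_over_p_subgroups G" and "y \<in> carrier G"
    and q: "prime q" and "card (generate G {y}) = q ^ b"
  shows "prime_chain G (generate G {y}) (carrier G)"
  using assms(1-3,5)
proof (induction "card (carrier G)" arbitrary: G rule: less_induct)
  case less
  interpret finite_group G by fact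
  show ?case
  proof (rule primary_prime_chain_step[OF less.prems(2,3) q less.prems(4)])
    fix H assume H: "subgroup H G" "generate G {y} \<subseteq> H" "card H < card (carrier G)"
    have yH: "y \<in> H" using H generate_cyclic(2)[OF less.prems(3)] by blast
    have "prime_chain (G\<restriction>H) (generate (G\<restriction>H) {y}) (carrier (G\<restriction>H))"
      using less.hyps[OF _ subgroup_finite_group[OF H(1)] chains_in_subgroup[OF less.prems(2) H(1)]]
        H(3) yH gen_in[OF H(1) yH] less.prems(4) by simp
    thus "prime_chain G (generate G {y}) H" using prime_chain_from_subgroup[OF _ H(1)] gen_in[OF H(1) yH] by simp
  qed
qed

context finite_group
begin

section \<open>P-subnormality as a chain\<close>

lemma card_rcosets_subgroup:
  assumes "subgroup H G" "subgroup K G" "H \<subseteq> K"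
  shows "card K = card (rcosets\<^bsub>G\<restriction>K\<^esub> H) * card H"
proof -
  interpret KG: finite_group "G\<restriction>K" using assms subgroup_finite_group by blast
  show ?thesis using KG.lagrange[OF subgroup_incl[OF assms]] by (simp add: order_def)
qed

lemma P_subnormal_iff_prime_chain:
  "P_subnormal G H \<longleftrightarrow> prime_chain G H (carrier G)"
proof -
  let ?Q = "\<lambda>(C :: nat \<Rightarrow> 'a set) n. (\<forall>i\<le>n. subgroup (C i) G) \<and>
         (\<forall>i<n. C i \<subset> C (Suc i) \<and>
                (\<forall>K. subgroup K G \<and> C i \<subseteq> K \<and> K \<subseteq> C (Suc i) \<longrightarrow> K = C i \<or> K = C (Suc i)) \<and>
                prime (card (rcosets\<^bsub>G\<lparr>carrier := C (Suc i)\<rparr>\<^esub> (C i))))"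
  show ?thesis
  proof
    assume P: "P_subnormal G H"
    hence H: "subgroup H G" by (simp add: P_subnormal_def)
    show "prime_chain G H (carrier G)"
    proof (cases "H = carrier G")
      case True thus ?thesis using H prime_chain.refl by metis
    next
      case False
      have "\<exists>(C :: nat \<Rightarrow> 'a set) n. C 0 = H \<and> C n = carrier G \<and> ?Q C n"
        using P False by (simp add: P_subnormal_def)
      then obtain C n where "C 0 = H \<and> C n = carrier G \<and> ?Q C n" by (elim exE)
      hence C: "C 0 = H" "C n = carrier G" "\<And>i. i \<le> n \<Longrightarrow> subgroup (C i) G"
        "\<And>i. i < n \<Longrightarrow> C i \<subset> C (Suc i)"
        "\<And>i. i < n \<Longrightarrow> prime (card (rcosets\<^bsub>G\<lparr>carrier := C (Suc i)\<rparr>\<^esub> (C i)))"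
        by (simp_all (no_asm_simp))
      have "i \<le> n \<Longrightarrow> prime_chain G H (C i)" for i
      proof (induction i)
        case 0 thus ?case using C(1) H prime_chain.refl by metis
      next
        case (Suc i)
        show ?case
          by (rule prime_chain.step[OF _ C(3) _ C(5) card_rcosets_subgroup[OF C(3) C(3)]])
             (use Suc C(4)[of i] in auto)
      qed
      from this[of n] show ?thesis using C(2) by simp
    qed
  next
    assume c: "prime_chain G H (carrier G)"
    have "\<exists>C n. C 0 = H \<and> C n = K \<and> ?Q C n" if "prime_chain G H K" for K
      using that
    proof (induction rule: prime_chain.induct)
      case refl
      have "?Q (\<lambda>_. H) 0" using refl by simp
      thus ?case by (intro exI[of _ "\<lambda>_. H"] exI[of _ 0]) simp
    next
      case (step K L q)
      obtain C n where CC: "C 0 = H \<and> C n = K \<and> ?Q C n" using step.IH by (elim exE)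
      note C = conjunct1[OF CC] conjunct1[OF conjunct2[OF CC]] conjunct2[OF conjunct2[OF CC]]
      let ?C = "C(Suc n := L)"
      have K: "subgroup K G" using step prime_chain_subgroups by blast
      have "card L = card (rcosets\<^bsub>G\<restriction>L\<^esub> K) * card K"
        by (rule card_rcosets_subgroup) (use K step in auto)
      hence rc: "card (rcosets\<^bsub>G\<restriction>L\<^esub> K) = q" using step card_pos[OF K] by auto
      have ne: "K \<noteq> L" using step card_pos[OF K] prime_gt_1_nat[of q] by auto
      have mx: "Z = K \<or> Z = L" if "subgroup Z G" "K \<subseteq> Z" "Z \<subseteq> L" for Z
        using prime_index_between[OF K _ _ _ that] step by blast
      have "?Q ?C (Suc n)"
      proof (intro conjI allI impI)
        fix i assume "i \<le> Suc n" thus "subgroup (?C i) G" using C step by (cases "i = Suc n") auto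
      next
        fix i assume i: "i < Suc n"
        show "?C i \<subset> ?C (Suc i)" using C i step ne by (cases "i = n") auto
        show "prime (card (rcosets\<^bsub>G\<lparr>carrier := ?C (Suc i)\<rparr>\<^esub> (?C i)))"
          using C i step rc by (cases "i = n") auto
        fix Z assume Z: "subgroup Z G \<and> ?C i \<subseteq> Z \<and> Z \<subseteq> ?C (Suc i)"
        show "Z = ?C i \<or> Z = ?C (Suc i)"
        proof (cases "i = n")
          case True thus ?thesis using mx[of Z] Z C(2) by simp
        next
          case False
          hence "i < n" using i by simp
          thus ?thesis using Z C(3) by simp
        qed
      qed
      thus ?case using C by (intro exI[of _ ?C] exI[of _ "Suc n"]) simp
    qed
    from this[OF c] show "P_subnormal G H"
      unfolding P_subnormal_def using prime_chain_subgroups[OF c] by (intro conjI disjI2) auto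
  qed
qed

section \<open>Series of normal subgroups\<close>

lemma normal_series_exists:
  assumes ext: "\<And>M. M \<lhd> G \<Longrightarrow> M \<noteq> carrier G \<Longrightarrow> \<exists>N. N \<lhd> G \<and> M \<subset> N \<and> R M N"
  shows "\<exists>(K :: nat \<Rightarrow> 'a set) n. K 0 = {\<one>} \<and> K n = carrier G \<and> (\<forall>i\<le>n. K i \<lhd> G)
     \<and> (\<forall>i<n. K i \<subseteq> K (Suc i) \<and> R (K i) (K (Suc i)))"
proof -
  have "\<exists>(K :: nat \<Rightarrow> 'a set) n. K 0 = M \<and> K n = carrier G \<and> (\<forall>i\<le>n. K i \<lhd> G)
     \<and> (\<forall>i<n. K i \<subseteq> K (Suc i) \<and> R (K i) (K (Suc i)))" if "M \<lhd> G" for M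
    using that
  proof (induction "card (carrier G) - card M" arbitrary: M rule: less_induct)
    case less
    show ?case
    proof (cases "M = carrier G")
      case True thus ?thesis using less.prems by (intro exI[of _ "\<lambda>_. M"] exI[of _ 0]) simp
    next
      case False
      then obtain N where N: "N \<lhd> G" "M \<subset> N" "R M N" using ext less.prems by blast
      have NG: "N \<subseteq> carrier G" using N normal_sub sub_car by blast
      have "card M < card N" using N NG finite_sub psubset_card_mono by metis
      moreover have "card N \<le> card (carrier G)" by (rule card_mono[OF fin NG])
      ultimately have lt: "card (carrier G) - card N < card (carrier G) - card M" by linarith
      obtain K n where K: "K 0 = N" "K n = carrier G" "\<forall>i\<le>n. K i \<lhd> G"
        "\<forall>i<n. K i \<subseteq> K (Suc i) \<and> R (K i) (K (Suc i))" using less.hyps[OF lt N(1)] by blast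
      let ?K = "case_nat M K"
      have "\<forall>i\<le>Suc n. ?K i \<lhd> G" using K less.prems by (auto split: nat.split)
      moreover have "\<forall>i<Suc n. ?K i \<subseteq> ?K (Suc i) \<and> R (?K i) (?K (Suc i))"
        using K N by (auto split: nat.split)
      ultimately show ?thesis using K by (intro exI[of _ ?K] exI[of _ "Suc n"]) simp
    qed
  qed
  from this[OF one_is_normal] show ?thesis .
qed

end

lemma (in group_hom) hom_commutator:
  "a \<in> carrier G \<Longrightarrow> b \<in> carrier G \<Longrightarrow> h (commutator G a b) = commutator H (h a) (h b)"
  by (simp add: commutator_def)

context finite_group
begin

lemma commutator_closed: "a \<in> carrier G \<Longrightarrow> b \<in> carrier G \<Longrightarrow> commutator G a b \<in> carrier G"
  by (simp add: commutator_def)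

lemma commutator_one_iff:
  "a \<in> carrier G \<Longrightarrow> b \<in> carrier G \<Longrightarrow> commutator G a b = \<one> \<longleftrightarrow> a \<otimes> b = b \<otimes> a"
proof -
  assume c: "a \<in> carrier G" "b \<in> carrier G"
  have "commutator G a b = inv (b \<otimes> a) \<otimes> (a \<otimes> b)"
    using c by (simp add: commutator_def m_assoc inv_mult_group)
  thus ?thesis using c by (metis inv_closed inv_equality inv_inv l_inv m_closed)
qed

lemma p_group_center:
  assumes p: "prime p" and card: "card (carrier G) = p ^ a" and ne: "carrier G \<noteq> {\<one>}"
  shows "\<exists>Z. Z \<lhd> G \<and> Z \<noteq> {\<one>} \<and> (\<forall>z\<in>Z. \<forall>g\<in>carrier G. z \<otimes> g = g \<otimes> z)"
proof -
  let ?Z = "{z \<in> carrier G. \<forall>g\<in>carrier G. conjg G g z = z}"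
  have "card ?Z mod p = card (carrier G) mod p"
    by (rule fixed_points_cong[OF p card fin]) (auto simp: conjg_conjg)
  moreover have "a \<noteq> 0" using card ne by (metis card_1_singletonE one_closed power_0 singletonD)
  ultimately have "p dvd card ?Z" using card by (simp add: mod_eq_0_iff_dvd)
  hence ne1: "?Z \<noteq> {\<one>}" using p by auto
  have Zc: "z \<otimes> g = g \<otimes> z" if "z \<in> ?Z" "g \<in> carrier G" for z g
    using that conjg_eq_iff_commute[of g z] by simp
  have Zs: "subgroup ?Z G"
  proof (rule subgroupI)
    have "\<one> \<in> ?Z" by (simp add: conjg_def)
    thus "?Z \<noteq> {}" by blast
    fix z assume z: "z \<in> ?Z"
    have "conjg G g (inv z) = inv z" if g: "g \<in> carrier G" for g
    proof -
      interpret f: group_hom G G "conjg G g" by (rule group_hom_conjg[OF g])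
      show ?thesis using f.hom_inv[of z] z g by simp
    qed
    thus "inv z \<in> ?Z" using z by simp
    fix w assume "w \<in> ?Z" thus "z \<otimes> w \<in> ?Z" using z by (simp add: conjg_mult)
  qed auto
  have "?Z \<lhd> G" by (rule normal_conjgI[OF Zs]) simp
  thus ?thesis using ne1 Zc by blast
qed

lemma Mod_trivial_iff:
  assumes M: "M \<lhd> G" and "carrier (G Mod M) = {\<one>\<^bsub>G Mod M\<^esub>}" shows "M = carrier G"
  using normal.fact_group_trivial_iff[OF M fin] assms by blast

lemma Mod_preimage_psubset:
  assumes M: "M \<lhd> G" and A: "subgroup A (G Mod M)" and ne: "A \<noteq> {\<one>\<^bsub>G Mod M\<^esub>}"
  shows "M \<subset> \<Union>A"
proof -
  have "card A \<noteq> 1"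
  proof
    assume "card A = 1"
    then obtain x where "A = {x}" by (rule card_1_singletonE)
    thus False using ne subgroup.one_closed[OF A] by blast
  qed
  hence "card (\<Union>A) \<noteq> card M" using Mod_preimage(3)[OF M A] card_pos[OF normal_sub[OF M]] by simp
  thus ?thesis using Mod_preimage(2)[OF M A] by blast
qed

lemma p_group_nilpotent:
  assumes p: "prime p" and card: "card (carrier G) = p ^ a"
  shows "nilpotent_group G"
proof -
  have "\<exists>N. N \<lhd> G \<and> M \<subset> N \<and> (\<forall>x\<in>N. \<forall>g\<in>carrier G. commutator G x g \<in> M)"
    if M: "M \<lhd> G" "M \<noteq> carrier G" for M
  proof -
    interpret Q: finite_group "G Mod M" by (rule finite_group_Mod[OF M(1)])
    interpret f: group_hom G "G Mod M" "\<lambda>x. M #> x" by (rule group_hom_Mod[OF M(1)])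
    have "card (carrier (G Mod M)) dvd p ^ a" using card_Mod[OF M(1)] card by (metis dvd_triv_left)
    then obtain b where b: "card (carrier (G Mod M)) = p ^ b" using p divides_primepow_nat by blast
    have "carrier (G Mod M) \<noteq> {\<one>\<^bsub>G Mod M\<^esub>}" using Mod_trivial_iff M by blast
    then obtain Z where Z: "Z \<lhd> G Mod M" "Z \<noteq> {\<one>\<^bsub>G Mod M\<^esub>}"
      "\<And>z g. z \<in> Z \<Longrightarrow> g \<in> carrier (G Mod M) \<Longrightarrow> z \<otimes>\<^bsub>G Mod M\<^esub> g = g \<otimes>\<^bsub>G Mod M\<^esub> z"
      using Q.p_group_center[OF p b] by blast
    have Zs: "subgroup Z (G Mod M)" using Z Q.normal_sub by blast
    have "commutator G x g \<in> M" if x: "x \<in> \<Union>Z" and g: "g \<in> carrier G" for x g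
    proof -
      have xZ: "x \<in> carrier G" "M #> x \<in> Z" using x Mod_preimage(4)[OF M(1) Zs] by blast+
      have "M #> commutator G x g = commutator (G Mod M) (M #> x) (M #> g)" using f.hom_commutator xZ g by blast
      also have "\<dots> = \<one>\<^bsub>G Mod M\<^esub>"
        using Q.commutator_one_iff[of "M #> x" "M #> g"] Z(3)[OF xZ(2), of "M #> g"] f.hom_closed xZ g by blast
      finally show ?thesis using Mod_one_iff[OF M(1)] commutator_closed xZ g by blast
    qed
    moreover have "\<Union>Z \<lhd> G" by (rule normal.factgroup_subgroup_union_normal[OF M(1) Z(1)])
    ultimately show ?thesis using Mod_preimage_psubset[OF M(1) Zs Z(2)] by blast
  qed
  from normal_series_exists[of "\<lambda>M N. \<forall>x\<in>N. \<forall>g\<in>carrier G. commutator G x g \<in> M", OF this]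
  show ?thesis unfolding nilpotent_group_def using is_group by blast
qed

section \<open>Supersoluble groups\<close>

lemma Mod_subgroup_eq: "G\<restriction>B Mod N = (G Mod N)\<lparr>carrier := rcosets\<^bsub>G\<restriction>B\<^esub> N\<rparr>"
  by (simp add: FactGroup_def fun_eq_iff)

lemma cyclic_factor_iff:
  assumes N: "N \<lhd> G" and B: "subgroup B G" "N \<subseteq> B"
  shows "cyclic_group (G\<restriction>B Mod N) \<longleftrightarrow>
    (\<exists>\<beta>\<in>carrier (G Mod N). generate (G Mod N) {\<beta>} = rcosets\<^bsub>G\<restriction>B\<^esub> N)"
proof -
  let ?R = "rcosets\<^bsub>G\<restriction>B\<^esub> N" let ?Q = "G Mod N"
  interpret Q: finite_group ?Q by (rule finite_group_Mod[OF N])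
  have R: "subgroup ?R ?Q" by (rule normal_subgroup_factorize[OF N B(2,1)])
  have gen: "carrier (?Q\<restriction>?R) \<inter> {\<beta>} = {\<beta>} \<and> generate (?Q\<restriction>?R) {\<beta>} = generate ?Q {\<beta>}" if "\<beta> \<in> ?R" for \<beta>
    using that Q.gen_in[OF R that] by auto
  show ?thesis
  proof
    assume "cyclic_group (G\<restriction>B Mod N)"
    then obtain \<beta> where b: "\<beta> \<in> ?R" "subgroup_generated (?Q\<restriction>?R) {\<beta>} = ?Q\<restriction>?R"
      unfolding cyclic_group_def Mod_subgroup_eq by auto
    have "carrier (subgroup_generated (?Q\<restriction>?R) {\<beta>}) = ?R" using b(2) by simp
    hence "generate ?Q {\<beta>} = ?R" unfolding carrier_subgroup_generated using gen[OF b(1)] by simp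
    thus "\<exists>\<beta>\<in>carrier ?Q. generate ?Q {\<beta>} = ?R" using Q.sub_mem[OF R b(1)] by blast
  next
    assume "\<exists>\<beta>\<in>carrier ?Q. generate ?Q {\<beta>} = ?R"
    then obtain \<beta> where b: "\<beta> \<in> carrier ?Q" "generate ?Q {\<beta>} = ?R" by blast
    have bR: "\<beta> \<in> ?R" using Q.generate_cyclic(2)[OF b(1)] b(2) by simp
    have "subgroup_generated (?Q\<restriction>?R) {\<beta>} = ?Q\<restriction>?R"
      unfolding subgroup_generated_def using gen[OF bR] b(2) by simp
    thus "cyclic_group (G\<restriction>B Mod N)"
      unfolding cyclic_group_def Mod_subgroup_eq using bR by auto
  qed
qed

lemma normal_cyclic_power:
  assumes b: "b \<in> carrier G" and n: "generate G {b} \<lhd> G"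
  shows "generate G {b [^] (r::nat)} \<lhd> G"
proof (rule normal_conjgI)
  have br: "b [^] r \<in> carrier G" using b by simp
  show "subgroup (generate G {b [^] r}) G" using generate_cyclic(1)[OF br] .
  fix g x assume g: "g \<in> carrier G" and "x \<in> generate G {b [^] r}"
  then obtain k :: nat where k: "x = (b [^] r) [^] k" using generate_nat[OF br] by blast
  interpret f: group_hom G G "conjg G g" by (rule group_hom_conjg[OF g])
  have "conjg G g b \<in> generate G {b}" by (rule conjg_normal[OF n g generate_cyclic(2)[OF b]])
  then obtain j :: nat where j: "conjg G g b = b [^] j" using generate_nat[OF b] by blast
  have "conjg G g x = ((b [^] j) [^] r) [^] k" unfolding k using b br by (simp add: f.hom_nat_pow j)
  also have "\<dots> = (b [^] r) [^] (j * k)" using b by (simp add: nat_pow_pow mult.commute mult.left_commute)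
  finally show "conjg G g x \<in> generate G {b [^] r}" using generate_nat[OF br] by blast
qed

text \<open>The factor, generated by \<open>\<beta>\<close>, may be composite. Its subgroups are normal in the quotient, being powers of a normal cyclic
group, so it can be refined to prime steps; a prime step \<open>D \<subset> B\<close> between normal subgroups turns into a step
\<open>D A \<subseteq> B A\<close> of index 1 or the same prime.\<close>

lemma prime_chain_cyclic_factor:
  assumes N: "N \<lhd> G" and A: "subgroup A G"
    and "\<beta> \<in> carrier (G Mod N)" "generate (G Mod N) {\<beta>} \<lhd> G Mod N"
  shows "prime_chain G (N <#> A) (\<Union>(generate (G Mod N) {\<beta>}) <#> A)"
proof -
  let ?Q = "G Mod N"
  interpret Q: finite_group ?Q by (rule finite_group_Mod[OF N])
  show ?thesis using assms(3,4)
  proof (induction "card (generate ?Q {\<beta>})" arbitrary: \<beta> rule: less_induct)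
    case less
    have b: "\<beta> \<in> carrier ?Q" by fact
    have gb: "subgroup (generate ?Q {\<beta>}) ?Q" using Q.generate_cyclic[OF b] by blast
    let ?B = "\<Union>(generate ?Q {\<beta>})"
    have o: "Q.ord \<beta> = card (generate ?Q {\<beta>})" using Q.generate_pow_card[OF b] .
    show ?case
    proof (cases "Q.ord \<beta> = 1")
      case True
      hence "\<beta> = \<one>\<^bsub>?Q\<^esub>" using Q.ord_eq_1[OF b] by simp
      hence "generate ?Q {\<beta>} = {\<one>\<^bsub>?Q\<^esub>}" using Q.generate_one by simp
      hence "?B = N" by (simp add: FactGroup_def)
      thus ?thesis using prime_chain.refl[OF mult_normal_subgroup[OF N A]] by simp
    next
      case False
      then obtain r where r: "prime r" "r dvd Q.ord \<beta>" using prime_factor_nat by blast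
      let ?c = "\<beta> [^]\<^bsub>?Q\<^esub> r"
      have c: "?c \<in> carrier ?Q" using b by simp
      have gc: "subgroup (generate ?Q {?c}) ?Q" using Q.generate_cyclic[OF c] by blast
      have nc: "generate ?Q {?c} \<lhd> ?Q" by (rule Q.normal_cyclic_power[OF b less.prems(2)])
      have r0: "r \<noteq> 0" using prime_gt_0_nat[OF r(1)] by simp
      have "Q.ord ?c = Q.ord \<beta> div r" by (rule Q.ord_pow[OF b r(2) r0])
      hence oc: "card (generate ?Q {\<beta>}) = r * card (generate ?Q {?c})"
        using Q.generate_pow_card[OF c] o r(2) by (metis dvd_mult_div_cancel)
      let ?D = "\<Union>(generate ?Q {?c})"
      have Bn: "?B \<lhd> G" "?D \<lhd> G" using normal.factgroup_subgroup_union_normal[OF N] less.prems(2) nc by blast+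
      have Bs: "subgroup ?B G" "subgroup ?D G" using Bn normal_sub by blast+
      have cB: "card ?B = r * card ?D" using Mod_preimage(3)[OF N gb] Mod_preimage(3)[OF N gc] oc by simp
      have "generate ?Q {?c} \<subseteq> generate ?Q {\<beta>}"
      proof (rule Q.gen_sub[OF gb])
        show "?c \<in> generate ?Q {\<beta>}" using Q.generate_nat[OF b] by blast
      qed
      hence DB: "?D \<subseteq> ?B" by blast
      have "card (generate ?Q {?c}) < card (generate ?Q {\<beta>})"
        using oc Q.card_pos[OF gc] prime_gt_1_nat[OF r(1)] by simp
      hence IH: "prime_chain G (N <#> A) (?D <#> A)" by (rule less.hyps[OF _ c nc])
      have BA: "subgroup (?B <#> A) G" "subgroup (?D <#> A) G" using mult_normal_subgroup Bn A by blast+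
      have "?B <#> A = ?D <#> A \<or> card (?B <#> A) = r * card (?D <#> A)"
      proof -
        have DBA: "subgroup (?B \<inter> (?D <#> A)) G" using subgroups_Inter_pair[OF Bs(1) BA(2)] .
        have "?B \<inter> (?D <#> A) = ?D \<or> ?B \<inter> (?D <#> A) = ?B"
          by (rule prime_index_between[OF Bs(2,1) r(1) cB DBA Int_greatest[OF DB set_mult_incl(1)[OF Bs(2) A]] Int_lower1])
        thus ?thesis
        proof
          assume "?B \<inter> (?D <#> A) = ?B"
          hence "?B <#> A \<subseteq> ?D <#> A" using set_mult_least[OF BA(2)] set_mult_incl(2)[OF Bs(2) A] by blast
          moreover have "?D <#> A \<subseteq> ?B <#> A" using DB by (simp add: mono_set_mult)
          ultimately show ?thesis by blast
        next
          assume a: "?B \<inter> (?D <#> A) = ?D"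
          have eq: "?B \<inter> A = ?D \<inter> A" using a DB set_mult_incl(2)[OF Bs(2) A] by blast
          have "card (?B <#> A) * card (?D \<inter> A) = (r * card ?D) * card A"
            using card_set_mult[OF Bs(1) A] unfolding eq cB .
          also have "\<dots> = (r * card (?D <#> A)) * card (?D \<inter> A)"
            using card_set_mult[OF Bs(2) A] by (simp only: mult.assoc)
          finally have "card (?B <#> A) = r * card (?D <#> A)"
            using card_pos[OF subgroups_Inter_pair[OF Bs(2) A]] by simp
          thus ?thesis ..
        qed
      qed
      thus ?thesis using r(1) DB by (intro prime_chain_step_le[OF IH BA(1)]) (auto simp: mono_set_mult)
    qed
  qed
qed

lemma supersoluble_prime_chain:
  assumes "supersoluble_group G" and A: "subgroup A G" shows "prime_chain G A (carrier G)"
proof -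
  obtain K n where K: "K 0 = {\<one>}" "K n = carrier G" "\<And>i. i \<le> n \<Longrightarrow> K i \<lhd> G"
    "\<And>i. i < n \<Longrightarrow> K i \<subseteq> K (Suc i)" "\<And>i. i < n \<Longrightarrow> cyclic_group (G\<restriction>K (Suc i) Mod K i)"
    using assms(1) unfolding supersoluble_group_def by meson
  have step: "prime_chain G (K i <#> A) (K (Suc i) <#> A)" if i: "i < n" for i
  proof -
    have Ki: "K i \<lhd> G" "K (Suc i) \<lhd> G" using K(3) i by auto
    have Ks: "subgroup (K (Suc i)) G" using Ki normal_sub by blast
    let ?R = "rcosets\<^bsub>G\<restriction>K (Suc i)\<^esub> (K i)"
    obtain \<beta> where b: "\<beta> \<in> carrier (G Mod K i)" "generate (G Mod K i) {\<beta>} = ?R"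
      using cyclic_factor_iff[OF Ki(1) Ks K(4)[OF i]] K(5)[OF i] by blast
    have Rn: "?R \<lhd> G Mod K i" by (rule normality_factorization[OF Ki(1) K(4)[OF i] Ki(2)])
    interpret KG: group "G\<restriction>K (Suc i)" by (rule subgroup_imp_group[OF Ks])
    have "subgroup (K i) (G\<restriction>K (Suc i))"
      by (rule subgroup_incl[OF normal_sub[OF Ki(1)] Ks K(4)[OF i]])
    hence "\<Union>?R = K (Suc i)" using KG.rcosets_part_G by fastforce
    thus ?thesis using prime_chain_cyclic_factor[OF Ki(1) A b(1)] Rn b(2) by simp
  qed
  have "i \<le> n \<Longrightarrow> prime_chain G (K 0 <#> A) (K i <#> A)" for i
  proof (induction i)
    case 0 show ?case using prime_chain.refl[OF mult_normal_subgroup[OF K(3)[of 0] A]] by simp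
  next
    case (Suc i)
    have "prime_chain G (K 0 <#> A) (K i <#> A)" using Suc by simp
    moreover have "prime_chain G (K i <#> A) (K (Suc i) <#> A)" using step Suc by simp
    ultimately show ?case using prime_chain_trans by blast
  qed
  from this[of n] have "prime_chain G ({\<one>} <#> A) (carrier G <#> A)" using K(1,2) by simp
  moreover have "{\<one>} <#> A = A" using sub_car[OF A] lcos_mult_one[of A] by (simp add: l_coset_eq_set_mult)
  moreover have "carrier G <#> A = carrier G" by (rule set_mult_carrier_idem[OF A])
  ultimately show ?thesis by simp
qed

lemma derived_of_cyclic_extension:
  assumes P: "subgroup P G" and y: "y \<in> carrier G" "conjg G y ` P \<subseteq> P"
  shows "derived G (P <#> generate G {y}) \<subseteq> P"
proof -
  let ?Y = "generate G {y}" let ?H = "P <#> ?Y"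
  have Y: "subgroup ?Y G" "y \<in> ?Y" using generate_cyclic y by auto
  have YN: "?Y \<subseteq> normalizer_of G P" by (rule gen_normalizes[OF P y])
  have H: "subgroup ?H G" by (rule normalized_mult_subgroup[OF P Y(1) YN])
  have PH: "P \<subseteq> ?H" "?Y \<subseteq> ?H" using set_mult_incl[OF P Y(1)] by auto
  interpret HG: finite_group "G\<restriction>?H" using H subgroup_finite_group by blast
  have N: "subgroup (normalizer_of G P) G" by (rule normalizer_subgroup[OF sub_car[OF P]])
  have HN: "?H \<subseteq> normalizer_of G P" by (rule set_mult_least[OF N normalizer_incl[OF P] YN])
  have PsH: "subgroup P (G\<restriction>?H)" by (rule subgroup_incl[OF P H PH(1)])
  have Pn: "P \<lhd> G\<restriction>?H"
    by (rule HG.normal_conjgI[OF PsH]) (use HN conjg_consistent[OF H] in \<open>auto simp: normalizer_of_def\<close>)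
  let ?Q = "G\<restriction>?H Mod P"
  interpret Q: finite_group ?Q by (rule HG.finite_group_Mod[OF Pn])
  interpret f: group_hom "G\<restriction>?H" ?Q "\<lambda>x. P #> x" using HG.group_hom_Mod[OF Pn] by simp
  have yH: "y \<in> carrier (G\<restriction>?H)" using Y PH by auto
  have yQ: "P #> y \<in> carrier ?Q" using f.hom_closed[OF yH] .
  have "carrier ?Q \<subseteq> range (\<lambda>n::int. (P #> y) [^]\<^bsub>?Q\<^esub> n)"
  proof
    fix \<xi> assume "\<xi> \<in> carrier ?Q"
    then obtain h where h: "h \<in> ?H" "\<xi> = P #> h" by (auto simp: carrier_Mod)
    then obtain a z where az: "a \<in> P" "z \<in> ?Y" "h = a \<otimes> z" by (auto simp: set_mult_def)
    obtain n :: int where n: "z = y [^] n" using az(2) generate_pow[OF y(1)] by blast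
    have zG: "z \<in> carrier G" "a \<in> carrier G" using az sub_mem[OF Y(1)] sub_mem[OF P] by auto
    have "P #> h = (P #> a) #> z" unfolding az(3) using coset_mult_assoc[OF sub_car[OF P] zG(2,1)] by simp
    also have "\<dots> = P #> z" using coset_join2[OF zG(2) P az(1)] by simp
    also have "z = y [^]\<^bsub>G\<restriction>?H\<^esub> n" using int_pow_consistent[OF H, of y n] yH n by simp
    also have "P #> (y [^]\<^bsub>G\<restriction>?H\<^esub> n) = (P #> y) [^]\<^bsub>?Q\<^esub> n" using f.hom_int_pow[OF yH] .
    finally show "\<xi> \<in> range (\<lambda>n::int. (P #> y) [^]\<^bsub>?Q\<^esub> n)" using h by blast
  qed
  moreover have "range (\<lambda>n::int. (P #> y) [^]\<^bsub>?Q\<^esub> n) \<subseteq> carrier ?Q" using Q.int_pow_closed[OF yQ] by blast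
  ultimately have "cyclic_group ?Q" unfolding Q.cyclic_group using yQ by blast
  hence "comm_group ?Q" by (rule Q.cyclic_imp_abelian_group)
  thus ?thesis by (rule derived_of_subgroup_minimal[OF Pn H])
qed

lemma supersoluble_imp_chains:
  assumes ss: "\<And>H. subgroup H G \<Longrightarrow> nilpotent_group (G\<restriction>derived G H) \<Longrightarrow> supersoluble_group (G\<restriction>H)"
  shows "chains_over_p_subgroups G"
  unfolding chains_over_p_subgroups_def
proof (intro allI impI)
  fix p P a y
  assume p: "prime p" and P: "subgroup P G" "card P = p ^ a"
    and y: "y \<in> carrier G" "conjg G y ` P \<subseteq> P"
  let ?Y = "generate G {y}" let ?H = "P <#> ?Y"
  have Y: "subgroup ?Y G" using generate_cyclic y by auto
  have H: "subgroup ?H G" by (rule normalized_mult_subgroup[OF P(1) Y gen_normalizes[OF P(1) y]])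
  have D: "subgroup (derived G ?H) G" by (rule derived_is_subgroup[OF sub_car[OF H]])
  interpret DG: finite_group "G\<restriction>derived G ?H" using D subgroup_finite_group by blast
  obtain b where "card (derived G ?H) = p ^ b"
    using p_subgroup_power[OF p D P(1) derived_of_cyclic_extension[OF P(1) y] P(2)] .
  hence "nilpotent_group (G\<restriction>derived G ?H)" using DG.p_group_nilpotent[OF p] by simp
  hence ssH: "supersoluble_group (G\<restriction>?H)" using ss[OF H] by blast
  interpret HG: finite_group "G\<restriction>?H" using H subgroup_finite_group by blast
  have "prime_chain (G\<restriction>?H) ?Y (carrier (G\<restriction>?H))"
    by (rule HG.supersoluble_prime_chain[OF ssH subgroup_incl[OF Y H set_mult_incl(2)[OF P(1) Y]]])
  thus "prime_chain G ?Y ?H" using prime_chain_from_subgroup[OF _ H] by simp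
qed

end

section \<open>Primary cyclic subgroups joined to the top\<close>

text \<open>Condition (1) in terms of elements. The exponent is positive because (1) makes no statement about the trivial subgroup.\<close>

definition primary_chained :: "('a, 'b) monoid_scheme \<Rightarrow> bool" where
  "primary_chained G \<longleftrightarrow> (\<forall>x q b. x \<in> carrier G \<longrightarrow> prime q \<longrightarrow> b \<noteq> 0
      \<longrightarrow> card (generate G {x}) = q ^ b \<longrightarrow> prime_chain G (generate G {x}) (carrier G))"

context finite_group
begin

lemma generate_ord: "x \<in> carrier G \<Longrightarrow> card (generate G {x}) = ord x"
  using generate_pow_card by simp

text \<open>A primary element of a quotient is the image of a primary element: pass from a preimage \<open>x\<close>, of order \<open>q\<^sup>a m\<close> with \<open>m\<close>
prime to \<open>q\<close>, to the power with exponent \<open>m t\<close>, where \<open>m t\<close> is 1 modulo the order of the image.\<close>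

lemma primary_lift:
  assumes M: "M \<lhd> G" and \<xi>: "\<xi> \<in> carrier (G Mod M)" and q: "prime q"
    and card: "card (generate (G Mod M) {\<xi>}) = q ^ b"
  shows "\<exists>z c. z \<in> carrier G \<and> M #> z = \<xi> \<and> card (generate G {z}) = q ^ c"
proof -
  interpret Q: finite_group "G Mod M" by (rule finite_group_Mod[OF M])
  interpret f: group_hom G "G Mod M" "\<lambda>x. M #> x" by (rule group_hom_Mod[OF M])
  obtain x where x: "x \<in> carrier G" "\<xi> = M #> x" using \<xi> by (auto simp: carrier_Mod)
  have "ord x \<noteq> 0" using generate_ord[OF x(1)] card_pos[OF generate_cyclic(1)[OF x(1)]] by simp
  then obtain m where m: "ord x = q ^ multiplicity q (ord x) * m" "\<not> q dvd m"
    using multiplicity_decompose'[of "ord x" q] prime_gt_1_nat[OF q] by force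
  define a where "a = multiplicity q (ord x)"
  have "coprime m (q ^ b)" using prime_imp_coprime[OF q m(2)] by (simp add: coprime_commute)
  then obtain t where t: "[m * t = 1] (mod q ^ b)" using cong_solve_coprime_nat[of m "q ^ b"] by auto
  let ?z = "x [^] (m * t)"
  have z: "?z \<in> carrier G" using x by simp
  have o\<xi>: "Q.ord \<xi> = q ^ b" using Q.generate_ord[OF \<xi>] card by simp
  have "M #> ?z = \<xi> [^]\<^bsub>G Mod M\<^esub> (m * t)" using f.hom_nat_pow[OF x(1)] x(2) by simp
  also have "\<dots> = \<xi> [^]\<^bsub>G Mod M\<^esub> (1::nat)"
  proof -
    have "[int (m * t) = int 1] (mod int (q ^ b))" using t cong_int_iff by blast
    hence "int (q ^ b) dvd int (m * t) - int 1" by (simp only: cong_iff_dvd_diff)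
    hence "int (q ^ b) dvd int 1 - int (m * t)" by (subst dvd_diff_commute)
    thus ?thesis using Q.int_pow_eq[OF \<xi>, of "int (m * t)" "int 1"] o\<xi> by (simp only: int_pow_int)
  qed
  also have "\<dots> = \<xi>" by (rule Q.nat_pow_eone[OF \<xi>])
  finally have Mz: "M #> ?z = \<xi>" .
  have "m * t * q ^ a = ord x * t" unfolding a_def by (subst (2) m(1)) (simp only: ac_simps)
  hence "?z [^] (q ^ a) = x [^] (ord x * t)" using x by (simp only: nat_pow_pow)
  also have "\<dots> = \<one>" using x pow_eq_id by simp
  finally have "ord ?z dvd q ^ a" using pow_eq_id[OF z] by simp
  then obtain c where "ord ?z = q ^ c" using q divides_primepow_nat by blast
  thus ?thesis using z Mz generate_ord[OF z] by metis
qed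

lemma primary_chained_Mod:
  assumes pc: "primary_chained G" and M: "M \<lhd> G" shows "primary_chained (G Mod M)"
  unfolding primary_chained_def
proof (intro allI impI)
  fix \<xi> q b
  assume \<xi>: "\<xi> \<in> carrier (G Mod M)" and q: "prime q" and b: "b \<noteq> 0"
    and card: "card (generate (G Mod M) {\<xi>}) = q ^ b"
  interpret Q: finite_group "G Mod M" by (rule finite_group_Mod[OF M])
  interpret f: group_hom G "G Mod M" "\<lambda>x. M #> x" by (rule group_hom_Mod[OF M])
  obtain z c where z: "z \<in> carrier G" "M #> z = \<xi>" "card (generate G {z}) = q ^ c"
    using primary_lift[OF M \<xi> q card] by blast
  have "c \<noteq> 0"
  proof
    assume "c = 0"
    hence "ord z = 1" using generate_ord[OF z(1)] z(3) by simp
    hence "z = \<one>" using ord_eq_1[OF z(1)] by simp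
    hence "\<xi> = \<one>\<^bsub>G Mod M\<^esub>" using z(2) f.hom_one by simp
    hence "card (generate (G Mod M) {\<xi>}) = 1" using Q.generate_one by simp
    thus False using card b prime_gt_1_nat[OF q] by simp
  qed
  hence "prime_chain G (generate G {z}) (carrier G)" using pc z q unfolding primary_chained_def by blast
  hence "prime_chain (G Mod M) ((\<lambda>x. M #> x) ` generate G {z}) ((\<lambda>x. M #> x) ` carrier G)"
    by (rule prime_chain_image[OF group_hom_Mod[OF M]])
  moreover have "(\<lambda>x. M #> x) ` generate G {z} = generate (G Mod M) {\<xi>}"
    using f.generate_img[of "{z}"] z by simp
  ultimately show "prime_chain (G Mod M) (generate (G Mod M) {\<xi>}) (carrier (G Mod M))"
    by (simp add: carrier_Mod)
qed

text \<open>An element whose order is the greatest prime divisor \<open>p\<close> lies in a normal \<open>p\<close>-subgroup by \<open>prime_chain_p_core\<close>, and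
the centre of that subgroup is nontrivial and normal in \<open>G\<close>.\<close>

lemma primary_chained_abelian_normal:
  assumes pc: "primary_chained G" and ne: "carrier G \<noteq> {\<one>}"
  shows "\<exists>N. N \<lhd> G \<and> N \<noteq> {\<one>} \<and> (\<forall>a\<in>N. \<forall>b\<in>N. a \<otimes> b = b \<otimes> a)"
proof -
  let ?Pr = "{p. prime p \<and> p dvd card (carrier G)}"
  have fPr: "finite ?Pr" by (rule finite_subset[of _ "{..card (carrier G)}"]) (use order_pos in \<open>auto dest: dvd_imp_le\<close>)
  have "card (carrier G) \<noteq> 1" using ne by (metis card_1_singletonE one_closed singletonD)
  hence "?Pr \<noteq> {}" using prime_factor_nat by blast
  define p where "p = Max ?Pr"
  have pPr: "p \<in> ?Pr" unfolding p_def by (rule Max_in[OF fPr \<open>?Pr \<noteq> {}\<close>])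
  hence p: "prime p" "p dvd card (carrier G)" by auto
  have big: "q \<le> p" if "prime q" "q dvd card (carrier G)" for q
    unfolding p_def by (rule Max_ge[OF fPr]) (use that in simp)
  obtain S where S: "subgroup S G" "card S = p ^ 1" using sylow_exists[OF p(1), of 1] p(2) by auto
  have "S \<noteq> {\<one>}" using S p(1) by auto
  then obtain x where x: "x \<in> S" "x \<noteq> \<one>" using subgroup.one_closed[OF S(1)] by blast
  have xG: "x \<in> carrier G" using x S sub_mem by blast
  obtain b where b: "card (generate G {x}) = p ^ b"
    using p_subgroup_power[OF p(1) generate_cyclic(1)[OF xG] S(1) gen_sub[OF S(1) x(1)] S(2)] .
  have "b \<noteq> 0" using b generate_ord[OF xG] ord_eq_1[OF xG] x(2) by auto
  hence "prime_chain G (generate G {x}) (carrier G)" using pc xG p(1) b unfolding primary_chained_def by blast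
  then obtain R m where R: "R \<lhd> G\<restriction>carrier G" "card R = p ^ m" "generate G {x} \<subseteq> R"
    using prime_chain_p_core[OF p(1) big _ b] by blast
  have Rn: "R \<lhd> G" using R(1) by simp
  have Rs: "subgroup R G" using Rn normal_sub by blast
  have RG: "R \<subseteq> carrier G" using Rs sub_car by blast
  have xR: "x \<in> R" using R(3) generate_cyclic(2)[OF xG] by blast
  interpret RG: finite_group "G\<restriction>R" using Rs subgroup_finite_group by blast
  have "carrier (G\<restriction>R) \<noteq> {\<one>\<^bsub>G\<restriction>R\<^esub>}" using xR x(2) by auto
  then obtain Z where Z: "Z \<lhd> G\<restriction>R" "Z \<noteq> {\<one>}" "\<And>z g. z \<in> Z \<Longrightarrow> g \<in> R \<Longrightarrow> z \<otimes> g = g \<otimes> z"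
    using RG.p_group_center[OF p(1), of m] R(2) by auto
  let ?N = "R \<inter> centralizer_of G R"
  have ZR: "Z \<subseteq> R" using normal_imp_subgroup[OF Z(1)] subgroup.subset by fastforce
  have CR: "z \<in> centralizer_of G R \<longleftrightarrow> (\<forall>g\<in>R. z \<otimes> g = g \<otimes> z)" if "z \<in> R" for z
    using that RG conjg_eq_iff_commute[of z] by (auto simp: centralizer_of_def subset_iff)
  have N: "?N \<lhd> G" by (rule normal_subgroup_intersect[OF Rn centralizer_normal[OF Rn]])
  have "Z \<subseteq> ?N" using ZR CR Z(3) by blast
  moreover have "\<one> \<in> Z" using subgroup.one_closed[OF normal_imp_subgroup[OF Z(1)]] by simp
  ultimately have "?N \<noteq> {\<one>}" using Z(2) by blast
  moreover have "\<forall>a\<in>?N. \<forall>b\<in>?N. a \<otimes> b = b \<otimes> a" using CR by blast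
  ultimately show ?thesis using N by blast
qed

section \<open>The words\<close>

lemma u_word_closed:
  "x \<in> carrier G \<Longrightarrow> y \<in> carrier G \<Longrightarrow> u_word G x y k \<in> carrier G"
proof (induction k)
  case (Suc k) thus ?case by (cases k) (simp_all add: commutator_closed)
qed simp

text \<open>The recursion in one formula for all indices, including the step from the conventional value \<open>x\<close> at 0.\<close>

lemma u_word_Suc:
  assumes "x \<in> carrier G" "y \<in> carrier G"
  shows "u_word G x y (Suc k) = inv (u_word G x y k [^] Suc k) \<otimes> conjg G (inv y) (u_word G x y k)"
proof -
  let ?u = "u_word G x y k"
  have u: "?u \<in> carrier G" using u_word_closed assms by blast
  have "u_word G x y (Suc k) = ?u [^] (- int k) \<otimes> commutator G ?u y"
    using assms by (cases k) (simp_all add: commutator_closed)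
  also have "\<dots> = inv (?u [^] k) \<otimes> (inv ?u \<otimes> conjg G (inv y) ?u)"
    using u assms by (simp add: int_pow_neg int_pow_int commutator_def conjg_def m_assoc)
  also have "\<dots> = inv (?u \<otimes> ?u [^] k) \<otimes> conjg G (inv y) ?u"
    using u assms by (simp add: inv_mult_group m_assoc)
  also have "?u \<otimes> ?u [^] k = ?u [^] Suc k" using u nat_pow_Suc2 by simp
  finally show ?thesis .
qed

end

lemma (in group_hom) hom_u_word:
  assumes "finite (carrier G)" "x \<in> carrier G" "y \<in> carrier G"
  shows "h (u_word G x y k) = u_word H (h x) (h y) k"
proof -
  interpret FG: finite_group G using assms(1) by unfold_locales
  show ?thesis
  proof (induction k)
    case 0 show ?case by simp
  next
    case (Suc k)
    have c: "u_word G x y k \<in> carrier G" using FG.u_word_closed assms by blast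
    have "h (u_word G x y (Suc k)) = u_word H (h x) (h y) (Suc k)"
    proof (cases k)
      case 0 thus ?thesis using hom_commutator assms by simp
    next
      case (Suc j)
      thus ?thesis using Suc.IH c assms FG.commutator_closed
        by (simp add: hom_int_pow hom_commutator)
    qed
    thus ?case .
  qed
qed

context finite_group
begin

text \<open>An eigenspace modulo \<open>U\<close>: it is a subgroup because \<open>T\<close> is abelian.\<close>

lemma scalar_step:
  assumes comm: "\<And>a b. a \<in> T \<Longrightarrow> b \<in> T \<Longrightarrow> a \<otimes> b = b \<otimes> a"
    and T: "subgroup T G" and U: "subgroup U G" "U \<subseteq> T"
    and x: "x \<in> carrier G" "conjg G x ` T \<subseteq> T" "conjg G x ` U \<subseteq> U"
  shows "subgroup {t \<in> T. \<exists>v\<in>U. conjg G x t = v \<otimes> t [^] (c::nat)} G"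
    and "U \<subseteq> {t \<in> T. \<exists>v\<in>U. conjg G x t = v \<otimes> t [^] c}"
proof -
  let ?E = "{t \<in> T. \<exists>v\<in>U. conjg G x t = v \<otimes> t [^] c}"
  interpret T: subgroup T G by fact
  interpret U: subgroup U G by (rule U(1))
  interpret f: group_hom G G "conjg G x" by (rule group_hom_conjg[OF x(1)])
  have powT: "t [^] c \<in> T" if "t \<in> T" for t
    using that by (induction c) auto
  have powU: "t [^] c \<in> U" if "t \<in> U" for t
    using that by (induction c) auto
  show UE: "U \<subseteq> ?E"
  proof
    fix t assume t: "t \<in> U"
    have "conjg G x t \<otimes> inv (t [^] c) \<in> U" using t x powU by auto
    moreover have "conjg G x t = (conjg G x t \<otimes> inv (t [^] c)) \<otimes> t [^] c"
      using t x by (simp add: m_assoc)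
    ultimately show "t \<in> ?E" using t U(2) by blast
  qed
  show "subgroup ?E G"
  proof (rule subgroupI)
    show "?E \<subseteq> carrier G" using T.subset by blast
    show "?E \<noteq> {}" using UE U.one_closed by blast
    fix a assume "a \<in> ?E"
    then obtain v where a: "a \<in> T" "v \<in> U" "conjg G x a = v \<otimes> a [^] c" by blast
    have vT: "v \<in> T" using a U(2) by blast
    have "conjg G x (inv a) = inv (v \<otimes> a [^] c)" using a f.hom_inv[of a] by simp
    also have "\<dots> = inv (a [^] c \<otimes> v)" using comm[OF vT powT[OF a(1)]] by simp
    also have "\<dots> = inv v \<otimes> (inv a) [^] c" using a vT by (simp add: inv_mult_group nat_pow_inv)
    finally show "inv a \<in> ?E" using a U.m_inv_closed by blast
    fix b assume "b \<in> ?E"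
    then obtain w where b: "b \<in> T" "w \<in> U" "conjg G x b = w \<otimes> b [^] c" by blast
    have wT: "w \<in> T" using b U(2) by blast
    have cG: "a \<in> carrier G" "b \<in> carrier G" "v \<in> carrier G" "w \<in> carrier G" using a b vT wT by auto
    have "conjg G x (a \<otimes> b) = v \<otimes> a [^] c \<otimes> (w \<otimes> b [^] c)" using a b f.hom_mult[OF cG(1,2)] by simp
    also have "\<dots> = v \<otimes> (a [^] c \<otimes> w) \<otimes> b [^] c" using cG by (simp add: m_assoc)
    also have "\<dots> = v \<otimes> w \<otimes> (a [^] c \<otimes> b [^] c)"
      using comm[OF powT[OF a(1)] wT] cG by (simp add: m_assoc)
    also have "a [^] c \<otimes> b [^] c = (a \<otimes> b) [^] c"
      using pow_mult_distrib[OF comm[OF a(1) b(1)] cG(1,2)] by simp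
    finally show "a \<otimes> b \<in> ?E" using a b by blast
  qed
qed

text \<open>Follow the chain from \<open>\<langle>x\<rangle>\<close> up to the first member that meets \<open>T\<close> outside \<open>U\<close>, say in \<open>t\<close>. If this is \<open>\<langle>x\<rangle>\<close> itself, then \<open>x\<close>
centralizes \<open>t\<close>. Otherwise the intersections of this member and the preceding one with \<open>N\<close> have prime index, so modulo the
smaller one the larger is generated by \<open>t\<close>, and \<open>x\<close> maps \<open>t\<close> to a power of \<open>t\<close>.\<close>

lemma primary_eigenvector:
  assumes N: "N \<lhd> G" and ab: "\<And>a b. a \<in> N \<Longrightarrow> b \<in> N \<Longrightarrow> a \<otimes> b = b \<otimes> a"
    and T: "subgroup T G" "T \<subseteq> N" and U: "subgroup U G" "U \<subset> T"
    and x: "x \<in> carrier G" "conjg G x ` T \<subseteq> T"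
    and chain: "prime_chain G (generate G {x}) (carrier G)"
  shows "\<exists>t\<in>T - U. \<exists>c::nat. \<exists>v\<in>U. conjg G x t = v \<otimes> t [^] c"
proof -
  let ?C = "\<exists>t\<in>T - U. \<exists>c::nat. \<exists>v\<in>U. conjg G x t = v \<otimes> t [^] c"
  have Ns: "subgroup N G" using N normal_sub by blast
  have xx: "x \<in> generate G {x}" using generate_cyclic x by blast
  have "H \<inter> T \<subseteq> U \<or> ?C" if "prime_chain G (generate G {x}) H" for H
    using that
  proof (induction rule: prime_chain.induct)
    case refl
    show ?case
    proof (cases "generate G {x} \<inter> T \<subseteq> U")
      case False
      then obtain t where t: "t \<in> generate G {x}" "t \<in> T" "t \<notin> U" by blast
      obtain k :: nat where k: "t = x [^] k" using t(1) generate_nat[OF x(1)] by blast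
      have tG: "t \<in> carrier G" using t T sub_mem by blast
      have "x \<otimes> t = t \<otimes> x" unfolding k using x(1) by (simp flip: nat_pow_Suc2)
      hence "conjg G x t = t" using conjg_eq_iff_commute[OF x(1) tG] by simp
      hence "conjg G x t = \<one> \<otimes> t [^] (1::nat)" using tG by simp
      thus ?thesis using t subgroup.one_closed[OF U(1)] by blast
    qed simp
  next
    case (step K L q)
    show ?case
    proof (cases "?C \<or> L \<inter> T \<subseteq> U")
      case False
      hence KU: "K \<inter> T \<subseteq> U" using step.IH by blast
      obtain t where t: "t \<in> L" "t \<in> T" "t \<notin> U" using False by blast
      have Ks: "subgroup K G" and Kx: "generate G {x} \<subseteq> K" using prime_chain_subgroups[OF step.hyps(1)] by auto
      have Ls: "subgroup L G" by fact
      have tN: "t \<in> N" using t T by blast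
      have tG: "t \<in> carrier G" using t T sub_mem by blast
      have tK: "t \<notin> K" using t KU by blast
      have LN: "N \<inter> L \<lhd> G\<restriction>L" by (rule normal_Int_subgroup[OF Ls N])
      have KL: "K \<subseteq> L" by fact
      have "N \<inter> L \<subseteq> K \<or> card (N \<inter> L) = q * card (N \<inter> L \<inter> K)"
        by (rule prime_index_normal_inter[OF Ks Ls KL \<open>prime q\<close> \<open>card L = _\<close> LN])
      moreover have "N \<inter> L \<inter> K = N \<inter> K" using KL by blast
      ultimately have cNL: "card (N \<inter> L) = q * card (N \<inter> K)" using t tN tK by auto
      have NK: "subgroup (N \<inter> K) G" and NL: "subgroup (N \<inter> L) G" using subgroups_Inter_pair Ns Ks Ls by blast+
      let ?t = "generate G {t}"
      have ts: "subgroup ?t G" "t \<in> ?t" using generate_cyclic[OF tG] by auto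
      have tsub: "?t \<subseteq> N \<inter> L" by (rule gen_sub[OF NL]) (use t tN in blast)
      have "subgroup ((N \<inter> K) <#> ?t) G"
      proof (rule subgroup_normalized_mult[OF NK ts(1)])
        fix h a assume h: "h \<in> ?t" and a: "a \<in> N \<inter> K"
        have "h \<in> N" using h tsub by blast
        hence "conjg G h a = a" using ab[of h a] a sub_mem[OF Ns] conjg_eq_iff_commute[of h a] by simp
        thus "conjg G h a \<in> N \<inter> K" using a by simp
      qed
      hence "(N \<inter> K) <#> ?t = N \<inter> K \<or> (N \<inter> K) <#> ?t = N \<inter> L"
        by (rule prime_index_between[OF NK NL \<open>prime q\<close> cNL])
           (rule set_mult_incl(1)[OF NK ts(1)], rule set_mult_least[OF NL _ tsub], use KL in blast)
      moreover have "t \<in> (N \<inter> K) <#> ?t" using set_mult_incl(2)[OF NK ts(1)] ts(2) by blast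
      ultimately have NLeq: "(N \<inter> K) <#> ?t = N \<inter> L" using tK by blast
      have "x \<in> L" using xx Kx KL by blast
      hence "conjg G x t \<in> L" using conjg_in_subgroup[OF Ls] t by blast
      moreover have "conjg G x t \<in> N" by (rule conjg_normal[OF N x(1) tN])
      ultimately have "conjg G x t \<in> (N \<inter> K) <#> ?t" using NLeq by blast
      then obtain v h where vh: "v \<in> N \<inter> K" "h \<in> ?t" "conjg G x t = v \<otimes> h"
        by (auto simp: set_mult_def)
      obtain c :: nat where c: "h = t [^] c" using vh(2) generate_nat[OF tG] by blast
      have vG: "v \<in> carrier G" using vh(1) sub_mem[OF Ns] by blast
      have tT: "?t \<subseteq> T" by (rule gen_sub[OF T(1) t(2)])
      have "v = conjg G x t \<otimes> inv h" using vh(3) vG c tG by (simp add: m_assoc)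
      moreover have "conjg G x t \<in> T" using x(2) t(2) by blast
      moreover have "h \<in> T" using tT vh(2) by blast
      ultimately have "v \<in> T" using T(1) by (simp add: subgroup.m_closed subgroup.m_inv_closed)
      hence "v \<in> U" using vh(1) KU by blast
      hence ?C using t vh(3) c by blast
      thus ?thesis ..
    qed blast
  qed
  from this[OF chain] show ?thesis using U(2) sub_car[OF T(1)] by blast
qed

text \<open>\<open>T / U\<close> has no proper nontrivial \<open>y\<close>-invariant subgroup. For a primary \<open>z \<in> \<langle>y\<rangle>\<close> the eigenspace of an eigenvector is
\<open>y\<close>-invariant, since \<open>y\<close> and \<open>z\<close> commute, so \<open>z\<close> acts on \<open>T / U\<close> as a power map. The elements of \<open>\<langle>y\<rangle>\<close> acting in
this way form a subgroup, which contains all primary elements and thus is everything.\<close>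

lemma cyclic_scalar:
  assumes pc: "primary_chained G"
    and N: "N \<lhd> G" and ab: "\<And>a b. a \<in> N \<Longrightarrow> b \<in> N \<Longrightarrow> a \<otimes> b = b \<otimes> a"
    and T: "subgroup T G" "T \<subseteq> N" and U: "subgroup U G" "U \<subset> T"
    and y: "y \<in> carrier G" "conjg G y ` T \<subseteq> T" "conjg G y ` U \<subseteq> U"
    and mx: "\<And>E. subgroup E G \<Longrightarrow> U \<subset> E \<Longrightarrow> E \<subseteq> T \<Longrightarrow> conjg G y ` E \<subseteq> E \<Longrightarrow> E = T"
    and z: "z \<in> generate G {y}"
  shows "\<exists>c::nat. \<forall>t\<in>T. \<exists>v\<in>U. conjg G z t = v \<otimes> t [^] c"
proof -
  let ?Y = "generate G {y}"
  define S where "S z \<longleftrightarrow> (\<exists>c::nat. \<forall>t\<in>T. \<exists>v\<in>U. conjg G z t = v \<otimes> t [^] c)" for z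
  have Y: "subgroup ?Y G" using generate_cyclic y by blast
  have YG: "x \<in> carrier G" if "x \<in> ?Y" for x using that sub_mem[OF Y] by blast
  have YT: "conjg G x ` T \<subseteq> T" if "x \<in> ?Y" for x
    using gen_normalizes[OF T(1) y(1,2)] that by (auto simp: normalizer_of_def)
  have YU: "conjg G x ` U \<subseteq> U" if "x \<in> ?Y" for x
    using gen_normalizes[OF U(1) y(1,3)] that by (auto simp: normalizer_of_def)
  have comm: "a \<otimes> b = b \<otimes> a" if "a \<in> T" "b \<in> T" for a b using that T ab by blast
  have TG: "t \<in> carrier G" if "t \<in> T" for t using that sub_mem[OF T(1)] by blast
  have UG: "t \<in> carrier G" if "t \<in> U" for t using that sub_mem[OF U(1)] by blast
  have prim: "S x" if x: "x \<in> ?Y" and q: "prime q" and b: "b \<noteq> 0" "card (generate G {x}) = q ^ b" for x q b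
  proof -
    have chain: "prime_chain G (generate G {x}) (carrier G)"
      using pc YG[OF x] q b unfolding primary_chained_def by blast
    obtain w c v where w: "w \<in> T - U" "v \<in> U" "conjg G x w = v \<otimes> w [^] (c::nat)"
      using primary_eigenvector[OF N ab T U YG[OF x] YT[OF x] chain] by blast
    let ?E = "{t \<in> T. \<exists>v\<in>U. conjg G x t = v \<otimes> t [^] c}"
    have UT: "U \<subseteq> T" using U by blast
    have Es: "subgroup ?E G" and UE: "U \<subseteq> ?E"
      using scalar_step[OF comm T(1) U(1) UT YG[OF x] YT[OF x] YU[OF x]] by blast+
    have wE: "w \<in> ?E" using w by blast
    have "conjg G y ` ?E \<subseteq> ?E"
    proof (rule image_subsetI)
      fix t assume "t \<in> ?E"
      then obtain v where v: "t \<in> T" "v \<in> U" "conjg G x t = v \<otimes> t [^] c" by blast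
      interpret f: group_hom G G "conjg G y" by (rule group_hom_conjg[OF y(1)])
      obtain k :: nat where k: "x = y [^] k" using x generate_nat[OF y(1)] by blast
      have xy: "x \<otimes> y = y \<otimes> x" unfolding k using y(1) by (simp flip: nat_pow_Suc2)
      have "conjg G x (conjg G y t) = conjg G y (conjg G x t)"
        using YG[OF x] y(1) TG[OF v(1)] xy by (simp add: conjg_conjg)
      also have "\<dots> = conjg G y v \<otimes> (conjg G y t) [^] c"
        using v TG[OF v(1)] UG[OF v(2)] by (simp add: f.hom_nat_pow)
      finally show "conjg G y t \<in> ?E" using v y by blast
    qed
    moreover have "U \<subset> ?E" using UE wE w by blast
    ultimately have "?E = T" using mx[OF Es] by blast
    thus ?thesis unfolding S_def by blast
  qed
  have S_one: "S \<one>"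
    unfolding S_def
  proof (intro exI[of _ "1::nat"] ballI)
    fix t assume t: "t \<in> T"
    have "conjg G \<one> t = \<one> \<otimes> t [^] (1::nat)" using TG[OF t] by simp
    thus "\<exists>v\<in>U. conjg G \<one> t = v \<otimes> t [^] (1::nat)" using subgroup.one_closed[OF U(1)] by blast
  qed
  have S_mult: "S (a \<otimes> b)" if a: "a \<in> ?Y" "S a" and b: "b \<in> ?Y" "S b" for a b
  proof -
    obtain c d :: nat where c: "\<And>t. t \<in> T \<Longrightarrow> \<exists>v\<in>U. conjg G a t = v \<otimes> t [^] c"
      and d: "\<And>t. t \<in> T \<Longrightarrow> \<exists>v\<in>U. conjg G b t = v \<otimes> t [^] d" using a(2) b(2) unfolding S_def by blast
    have "\<exists>v\<in>U. conjg G (a \<otimes> b) t = v \<otimes> t [^] (d * c)" if t: "t \<in> T" for t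
    proof -
      interpret f: group_hom G G "conjg G a" by (rule group_hom_conjg[OF YG[OF a(1)]])
      have td: "t [^] d \<in> T" using t T(1) by (induction d) (auto simp: subgroup.one_closed subgroup.m_closed)
      obtain v where v: "v \<in> U" "conjg G b t = v \<otimes> t [^] d" using d[OF t] by blast
      obtain w where w: "w \<in> U" "conjg G a (t [^] d) = w \<otimes> (t [^] d) [^] c" using c[OF td] by blast
      have "conjg G (a \<otimes> b) t = conjg G a (conjg G b t)" using YG a b TG[OF t] by (simp add: conjg_conjg)
      also have "\<dots> = conjg G a v \<otimes> conjg G a (t [^] d)" using v UG[OF v(1)] TG[OF td] by (simp add: f.hom_mult)
      also have "\<dots> = (conjg G a v \<otimes> w) \<otimes> t [^] (d * c)"
        using w UG[OF v(1)] UG[OF w(1)] TG[OF t] YG[OF a(1)] by (simp add: m_assoc nat_pow_pow)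
      finally have eq: "conjg G (a \<otimes> b) t = (conjg G a v \<otimes> w) \<otimes> t [^] (d * c)" .
      have "conjg G a v \<in> U" using YU[OF a(1)] v(1) by blast
      hence "conjg G a v \<otimes> w \<in> U" using w(1) U(1) subgroup.m_closed by metis
      thus ?thesis using eq by blast
    qed
    thus ?thesis unfolding S_def by blast
  qed
  let ?Z = "{x \<in> ?Y. S x}"
  have Zs: "subgroup ?Z G"
  proof (rule subgroupI)
    show "?Z \<subseteq> carrier G" using YG by blast
    have "\<one> \<in> ?Z" using S_one subgroup.one_closed[OF Y] by blast
    thus "?Z \<noteq> {}" by blast
    fix a assume a: "a \<in> ?Z"
    show mult: "a \<otimes> b \<in> ?Z" if "b \<in> ?Z" for b using S_mult a that subgroup.m_closed[OF Y] by blast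
    have aG: "a \<in> carrier G" using a YG by blast
    have pow: "a [^] (k::nat) \<in> ?Z" for k
    proof (induction k)
      case 0 show ?case using \<open>\<one> \<in> ?Z\<close> by simp
    next
      case (Suc k)
      have "a \<otimes> a [^] k \<in> ?Z" using mult[OF Suc] .
      thus ?case using nat_pow_Suc2[OF aG, of k] by simp
    qed
    have "inv a \<in> generate G {a}" using generate_cyclic[OF aG] subgroup.m_inv_closed by metis
    then obtain k :: nat where "inv a = a [^] k" using generate_nat[OF aG] by blast
    thus "inv a \<in> ?Z" using pow[of k] by simp
  qed
  interpret YG: finite_group "G\<restriction>?Y" using Y subgroup_finite_group by blast
  have "?Z = carrier (G\<restriction>?Y)"
  proof (rule YG.subgroup_eq_carrierI)
    show "subgroup ?Z (G\<restriction>?Y)" by (rule subgroup_incl[OF Zs Y]) blast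
    fix q n assume q: "prime q" and n: "q ^ n dvd card (carrier (G\<restriction>?Y))"
    obtain Sy where Sy: "subgroup Sy G" "Sy \<subseteq> ?Y" "card Sy = q ^ n" using sylow_in_subgroup[OF q Y] n by auto
    have "Sy \<subseteq> ?Z"
    proof
      fix x assume x: "x \<in> Sy"
      have xG: "x \<in> carrier G" using x Sy sub_mem by blast
      obtain b where b: "card (generate G {x}) = q ^ b"
        using p_subgroup_power[OF q generate_cyclic(1)[OF xG] Sy(1) gen_sub[OF Sy(1) x] Sy(3)] .
      have "S x"
      proof (cases "b = 0")
        case True
        hence "x = \<one>" using b generate_ord[OF xG] ord_eq_1[OF xG] by simp
        thus ?thesis using S_one by simp
      next
        case False thus ?thesis using prim[of x q b] x Sy q b by blast
      qed
      thus "x \<in> ?Z" using x Sy by blast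
    qed
    thus "q ^ n dvd card ?Z" using card_subgroup_dvd[OF Sy(1) Zs] Sy(3) by simp
  qed
  hence "S z" using z by auto
  thus ?thesis unfolding S_def .
qed

text \<open>Let \<open>T\<close> be a least \<open>y\<close>-invariant subgroup of \<open>N\<close> reached by the words and \<open>U\<close> a maximal \<open>y\<close>-invariant proper subgroup of it.
The inverse of \<open>y\<close> acts on \<open>T / U\<close> as a power map with some exponent \<open>c\<close>, so the step from \<open>u\<^sub>j\<close> multiplies by \<open>c - (j + 1)\<close> modulo \<open>U\<close> in
additive notation. Some \<open>j\<close> makes this factor a multiple of the group order, and then the word falls into \<open>U\<close>.\<close>

lemma word_trivial_on_abelian:
  assumes pc: "primary_chained G"
    and N: "N \<lhd> G" and ab: "\<And>a b. a \<in> N \<Longrightarrow> b \<in> N \<Longrightarrow> a \<otimes> b = b \<otimes> a"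
    and x: "x \<in> carrier G" and y: "y \<in> carrier G" and k: "k \<ge> 1" "u_word G x y k \<in> N"
  shows "\<exists>j\<ge>1. u_word G x y j = \<one>"
proof -
  let ?u = "u_word G x y"
  let ?P = "\<lambda>T. subgroup T G \<and> T \<subseteq> N \<and> conjg G y ` T \<subseteq> T \<and> (\<exists>k\<ge>1. ?u k \<in> T)"
  have "conjg G y ` N \<subseteq> N" using conjg_normal[OF N y] by blast
  hence "?P N" using N normal_sub k by blast
  then obtain T where "?P T" and least: "\<And>V. ?P V \<Longrightarrow> card T \<le> card V"
    using ex_has_least_nat[of ?P N card] by blast
  then obtain k where T: "subgroup T G" "T \<subseteq> N" "conjg G y ` T \<subseteq> T" and k: "k \<ge> 1" "?u k \<in> T" by blast
  show ?thesis
  proof (cases "T = {\<one>}")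
    case True thus ?thesis using k by auto
  next
    case False
    let ?V = "{U. subgroup U G \<and> U \<subset> T \<and> conjg G y ` U \<subseteq> U}"
    have TG: "T \<subseteq> carrier G" using T sub_car by blast
    have "?V \<subseteq> Pow (carrier G)" using TG by blast
    hence "finite ?V" by (rule finite_subset) (simp add: fin)
    moreover have "{\<one>} \<in> ?V" using False subgroup.one_closed[OF T(1)] triv_subgroup y by (auto simp: conjg_def)
    ultimately obtain U where "U \<in> ?V" and mxU: "\<And>E. E \<in> ?V \<Longrightarrow> card E \<le> card U"
      using finite_max_card by (metis (no_types, lifting))
    hence U: "subgroup U G" "U \<subset> T" "conjg G y ` U \<subseteq> U" by auto
    have mx: "E = T" if E: "subgroup E G" "U \<subset> E" "E \<subseteq> T" "conjg G y ` E \<subseteq> E" for E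
    proof (rule ccontr)
      assume "E \<noteq> T"
      hence "E \<in> ?V" using E by blast
      hence "card E \<le> card U" by (rule mxU)
      moreover have "card U < card E" by (rule psubset_card_mono[OF finite_subgroup[OF E(1)] E(2)])
      ultimately show False by simp
    qed
    have iy: "inv y \<in> generate G {y}" using generate_cyclic[OF y] subgroup.m_inv_closed by metis
    obtain c :: nat where c: "\<And>t. t \<in> T \<Longrightarrow> \<exists>v\<in>U. conjg G (inv y) t = v \<otimes> t [^] c"
      using cyclic_scalar[OF pc N ab T(1,2) U(1,2) y T(3) U(3) mx iy] by blast
    have uG: "?u j \<in> carrier G" for j using u_word_closed x y by blast
    have comm: "a \<otimes> b = b \<otimes> a" if "a \<in> T" "b \<in> T" for a b using that T ab by blast
    have powT: "t [^] (n::nat) \<in> T" if "t \<in> T" for t n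
      using that T(1) by (induction n) (auto simp: subgroup.one_closed subgroup.m_closed)
    have "inv y \<in> normalizer_of G T" using gen_normalizes[OF T(1) y T(3)] iy by blast
    hence iyT: "conjg G (inv y) t \<in> T" if "t \<in> T" for t using that by (auto simp: normalizer_of_def)
    have inT: "?u j \<in> T" if "j \<ge> k" for j
      using that
    proof (induction j rule: dec_induct)
      case base show ?case by (rule k(2))
    next
      case (step n)
      have "inv (?u n [^] Suc n) \<in> T" using powT[OF step.IH] T(1) subgroup.m_inv_closed by metis
      thus ?case unfolding u_word_Suc[OF x y] using iyT[OF step.IH] T(1) subgroup.m_closed by metis
    qed
    let ?n = "card (carrier G)"
    \<comment> \<open>\<open>j + 1\<close> is congruent to \<open>c\<close> modulo the group order, and \<open>j \<ge> k\<close>.\<close>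
    define j where "j = c + ?n * (k + 1) - 1"
    have "?n * (k + 1) \<ge> k + 1" using mult_le_mono1[of 1 ?n "k + 1"] order_pos by simp
    hence j: "Suc j = c + ?n * (k + 1)" "j \<ge> k" unfolding j_def by linarith+
    let ?w = "?u j"
    have wT: "?w \<in> T" using inT[OF j(2)] .
    have wG: "?w \<in> carrier G" by (rule uG)
    obtain v where v: "v \<in> U" "conjg G (inv y) ?w = v \<otimes> ?w [^] c" using c[OF wT] by blast
    have vT: "v \<in> T" using v U by blast
    have vG: "v \<in> carrier G" using vT TG by blast
    have "?w [^] (?n * (k + 1)) = (?w [^] ?n) [^] (k + 1)" using wG by (simp only: nat_pow_pow)
    also have "\<dots> = \<one>" using pow_order_eq_1[OF wG] by (simp add: order_def)
    finally have "?w [^] Suc j = ?w [^] c" using wG unfolding j(1) by (simp add: nat_pow_mult[symmetric])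
    hence "?u (Suc j) = inv (?w [^] c) \<otimes> (v \<otimes> ?w [^] c)" using u_word_Suc[OF x y, of j] v(2) by simp
    also have "\<dots> = inv (?w [^] c) \<otimes> (?w [^] c \<otimes> v)" using comm[OF vT powT[OF wT]] by simp
    also have "\<dots> = v" using wG vG by (simp flip: m_assoc)
    finally have "?u (Suc j) \<in> U" using v(1) by simp
    hence "?P U" using U T(2) by (intro conjI exI[of _ "Suc j"]) auto
    hence "card T \<le> card U" by (rule least)
    moreover have "card U < card T" by (rule psubset_card_mono[OF finite_subgroup[OF T(1)] U(2)])
    ultimately show ?thesis by simp
  qed
qed

lemma primary_chained_imp_word:
  assumes pc: "primary_chained G" and x: "x \<in> carrier G" and y: "y \<in> carrier G"
  shows "\<exists>k\<ge>1. u_word G x y k = \<one>"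
proof -
  have "\<exists>k\<ge>1. u_word G x y k \<in> M" if "M \<lhd> G" for M
    using that
  proof (induction "card (carrier G) - card M" arbitrary: M rule: less_induct)
    case less
    note M = less.prems
    show ?case
    proof (cases "M = carrier G")
      case True thus ?thesis using u_word_closed[OF x y] by blast
    next
      case False
      interpret Q: finite_group "G Mod M" by (rule finite_group_Mod[OF M])
      interpret f: group_hom G "G Mod M" "\<lambda>x. M #> x" by (rule group_hom_Mod[OF M])
      have "carrier (G Mod M) \<noteq> {\<one>\<^bsub>G Mod M\<^esub>}" using Mod_trivial_iff M False by blast
      then obtain A where A: "A \<lhd> G Mod M" "A \<noteq> {\<one>\<^bsub>G Mod M\<^esub>}"
        "\<And>a b. a \<in> A \<Longrightarrow> b \<in> A \<Longrightarrow> a \<otimes>\<^bsub>G Mod M\<^esub> b = b \<otimes>\<^bsub>G Mod M\<^esub> a"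
        using Q.primary_chained_abelian_normal[OF primary_chained_Mod[OF pc M]] by blast
      have As: "subgroup A (G Mod M)" using A Q.normal_sub by blast
      have sub: "M \<subset> \<Union>A" by (rule Mod_preimage_psubset[OF M As A(2)])
      have AG: "subgroup (\<Union>A) G" by (rule Mod_preimage(1)[OF M As])
      have "card M < card (\<Union>A)" by (rule psubset_card_mono[OF finite_subgroup[OF AG] sub])
      moreover have "card (\<Union>A) \<le> card (carrier G)" by (rule card_mono[OF fin sub_car[OF AG]])
      ultimately have lt: "card (carrier G) - card (\<Union>A) < card (carrier G) - card M" by linarith
      obtain k where k: "k \<ge> 1" "u_word G x y k \<in> \<Union>A"
        using less.hyps[OF lt normal.factgroup_subgroup_union_normal[OF M A(1)]] by blast
      have "M #> u_word G x y k \<in> A" using k(2) Mod_preimage(4)[OF M As] by blast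
      hence "u_word (G Mod M) (M #> x) (M #> y) k \<in> A" using f.hom_u_word[OF fin x y] by simp
      then obtain j where j: "j \<ge> 1" "u_word (G Mod M) (M #> x) (M #> y) j = \<one>\<^bsub>G Mod M\<^esub>"
        using Q.word_trivial_on_abelian[OF primary_chained_Mod[OF pc M] A(1,3) f.hom_closed[OF x] f.hom_closed[OF y] k(1)] by blast
      hence "M #> u_word G x y j = \<one>\<^bsub>G Mod M\<^esub>" using f.hom_u_word[OF fin x y] by simp
      hence "u_word G x y j \<in> M" using Mod_one_iff[OF M u_word_closed[OF x y]] by blast
      thus ?thesis using j(1) by blast
    qed
  qed
  from this[OF one_is_normal] show ?thesis by simp
qed

section \<open>Supersolubility from the words\<close>

lemma commutator_in_derived:
  assumes "a \<in> carrier G" "b \<in> carrier G" shows "commutator G a b \<in> derived G (carrier G)"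
proof -
  have "inv a \<otimes> inv b \<otimes> inv (inv a) \<otimes> inv (inv b) \<in> derived_set G (carrier G)"
    by (intro UN_I[of "inv a"] UN_I[of "inv b"] singletonI inv_closed assms)
  thus ?thesis using assms unfolding derived_def commutator_def by (auto intro: generate.incl)
qed

lemma commutator_normal:
  assumes N: "N \<lhd> G" and n: "n \<in> N" and g: "g \<in> carrier G" shows "commutator G n g \<in> N"
proof -
  have Ns: "subgroup N G" using N normal_sub by blast
  have nG: "n \<in> carrier G" using sub_mem[OF Ns n] .
  have "commutator G n g = inv n \<otimes> conjg G (inv g) n" using nG g by (simp add: commutator_def conjg_def m_assoc)
  moreover have "conjg G (inv g) n \<in> N" using conjg_normal[OF N _ n] g by simp
  ultimately show ?thesis using Ns n by (simp add: subgroup.m_closed subgroup.m_inv_closed)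
qed

text \<open>A minimal normal subgroup \<open>N\<close> is centralized by the derived subgroup \<open>D\<close>: if it meets \<open>D\<close> trivially, because the
commutators lie in the intersection; if it lies in \<open>D\<close>, because the first term of the central series meeting \<open>N\<close>
nontrivially consists, within \<open>N\<close>, of elements centralized by \<open>D\<close>. By the same distinction \<open>N\<close> is abelian. The words
starting in \<open>N\<close> then show that every element acts on \<open>N\<close> as a power map.\<close>

lemma nontrivial_cyclic_normal:
  assumes nil: "nilpotent_group (G\<restriction>derived G (carrier G))" and ne: "carrier G \<noteq> {\<one>}"
    and word: "\<And>x y. x \<in> carrier G \<Longrightarrow> y \<in> carrier G \<Longrightarrow> \<exists>k\<ge>1. u_word G x y k = \<one>"
  shows "\<exists>w\<in>carrier G. w \<noteq> \<one> \<and> generate G {w} \<lhd> G"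
proof -
  let ?D = "derived G (carrier G)"
  have Dn: "?D \<lhd> G" by (rule derived_self_is_normal)
  have Ds: "subgroup ?D G" using Dn normal_sub by blast
  have DG: "?D \<subseteq> carrier G" using Ds sub_car by blast
  let ?P = "\<lambda>N. N \<lhd> G \<and> N \<noteq> {\<one>}"
  obtain N where N: "N \<lhd> G" "N \<noteq> {\<one>}" and least: "\<And>L. ?P L \<Longrightarrow> card N \<le> card L"
    using ex_has_least_nat[of ?P "carrier G" card] normal_self ne by blast
  have Ns: "subgroup N G" using N normal_sub by blast
  have NG: "n \<in> carrier G" if "n \<in> N" for n using that sub_mem[OF Ns] by blast
  have minimal: "L = N" if L: "L \<lhd> G" "L \<subseteq> N" "L \<noteq> {\<one>}" for L
    using subgroup_eqI[OF normal_sub[OF L(1)] Ns L(2)] least L by blast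
  have neL: "\<exists>x\<in>L. x \<noteq> \<one>" if "L \<lhd> G" "L \<noteq> {\<one>}" for L
    using that subgroup.one_closed[OF normal_sub] by blast
  let ?Z = "N \<inter> centralizer_of G ?D"
  have Zn: "?Z \<lhd> G" by (rule normal_subgroup_intersect[OF N(1) centralizer_normal[OF Dn]])
  have inZ: "n \<in> ?Z" if n: "n \<in> N" and c: "\<And>d. d \<in> ?D \<Longrightarrow> commutator G n d = \<one>" for n
  proof -
    have "conjg G n d = d" if d: "d \<in> ?D" for d
    proof -
      have dG: "d \<in> carrier G" using d DG by blast
      show ?thesis
        using conjg_eq_iff_commute[OF NG[OF n] dG] commutator_one_iff[OF NG[OF n] dG] c[OF d] by simp
    qed
    thus ?thesis using n NG by (simp add: centralizer_of_def)
  qed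
  have "?Z \<noteq> {\<one>}"
  proof (cases "N \<inter> ?D = {\<one>}")
    case True
    obtain n where n: "n \<in> N" "n \<noteq> \<one>" using neL N by blast
    have "n \<in> ?Z"
    proof (rule inZ[OF n(1)])
      fix d assume d: "d \<in> ?D"
      have dG: "d \<in> carrier G" using d DG by blast
      have "commutator G n d \<in> N \<inter> ?D" using commutator_normal[OF N(1) n(1) dG] commutator_in_derived[OF NG[OF n(1)] dG] by blast
      thus "commutator G n d = \<one>" using True by blast
    qed
    thus ?thesis using n(2) by blast
  next
    case False
    have "N \<inter> ?D = N" by (rule minimal[OF normal_subgroup_intersect[OF N(1) Dn] Int_lower1 False])
    hence ND: "N \<subseteq> ?D" by blast
    obtain K :: "nat \<Rightarrow> 'a set" and n where K: "K 0 = {\<one>}" "K n = ?D"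
      "\<And>i x g. i < n \<Longrightarrow> x \<in> K (Suc i) \<Longrightarrow> g \<in> ?D \<Longrightarrow> commutator (G\<restriction>?D) x g \<in> K i"
      "\<And>i. i \<le> n \<Longrightarrow> K i \<lhd> G\<restriction>?D"
      using nil unfolding nilpotent_group_def by auto
    have "N \<inter> K n = N" using ND K(2) by blast
    hence Kn: "N \<inter> K n \<noteq> {\<one>}" using N(2) by simp
    define i where "i = (LEAST i. N \<inter> K i \<noteq> {\<one>})"
    have i: "N \<inter> K i \<noteq> {\<one>}" "i \<le> n"
      unfolding i_def by (rule LeastI[of "\<lambda>i. N \<inter> K i \<noteq> {\<one>}", OF Kn],
        rule Least_le[of "\<lambda>i. N \<inter> K i \<noteq> {\<one>}", OF Kn])
    have small: "N \<inter> K j = {\<one>}" if "j < i" for j using that not_less_Least unfolding i_def by blast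
    have "i \<noteq> 0" using i(1) K(1) subgroup.one_closed[OF Ns] by (intro notI) auto
    then obtain j where j: "i = Suc j" by (cases i) auto
    have "\<one> \<in> K i" using subgroup.one_closed[OF normal_imp_subgroup[OF K(4)[OF i(2)]]] by simp
    hence "\<exists>a\<in>N \<inter> K i. a \<noteq> \<one>" using i(1) subgroup.one_closed[OF Ns] by blast
    then obtain a where a: "a \<in> N" "a \<in> K i" "a \<noteq> \<one>" by blast
    have "a \<in> ?Z"
    proof (rule inZ[OF a(1)])
      fix d assume d: "d \<in> ?D"
      have dG: "d \<in> carrier G" using d DG by blast
      have aD: "a \<in> ?D" using a ND by blast
      have "commutator (G\<restriction>?D) a d = commutator G a d"
        using m_inv_consistent[OF Ds aD] m_inv_consistent[OF Ds d] by (simp add: commutator_def)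
      hence "commutator G a d \<in> K j" using K(3)[of j a d] a(2) j i(2) d by simp
      moreover have "commutator G a d \<in> N" by (rule commutator_normal[OF N(1) a(1) dG])
      ultimately show "commutator G a d = \<one>" using small[of j] j by blast
    qed
    thus ?thesis using a(3) by blast
  qed
  hence ZN: "?Z = N" by (rule minimal[OF Zn Int_lower1])
  have cent: "conjg G d n = n" if n: "n \<in> N" and d: "d \<in> ?D" for n d
  proof -
    have dG: "d \<in> carrier G" using d DG by blast
    have "n \<in> centralizer_of G ?D" using n ZN by blast
    hence "conjg G n d = d" using d by (simp add: centralizer_of_def)
    thus ?thesis using conjg_eq_iff_commute[OF NG[OF n] dG] conjg_eq_iff_commute[OF dG NG[OF n]] by simp
  qed
  have ab: "a \<otimes> b = b \<otimes> a" if a: "a \<in> N" and b: "b \<in> N" for a b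
  proof (cases "N \<inter> ?D = {\<one>}")
    case True
    have "commutator G a b \<in> N \<inter> ?D" using commutator_normal[OF N(1) a NG[OF b]] commutator_in_derived[OF NG[OF a] NG[OF b]] by blast
    hence "commutator G a b = \<one>" using True by blast
    thus ?thesis using commutator_one_iff[OF NG[OF a] NG[OF b]] by simp
  next
    case False
    have "N \<inter> ?D = N" by (rule minimal[OF normal_subgroup_intersect[OF N(1) Dn] Int_lower1 False])
    hence "a \<in> ?D" using a by blast
    hence "conjg G a b = b" by (rule cent[OF b])
    thus ?thesis using conjg_eq_iff_commute[OF NG[OF a] NG[OF b]] by simp
  qed
  obtain w where w: "w \<in> N" "w \<noteq> \<one>" using neL N by blast
  have wG: "w \<in> carrier G" using NG w by blast
  have scalar: "\<exists>k::nat. conjg G (inv y) w = w [^] k" if y: "y \<in> carrier G" for y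
  proof -
    let ?u = "u_word G w y"
    obtain k0 where "k0 \<ge> 1" "?u k0 = \<one>" using word[OF wG y] by blast
    \<comment> \<open>The word at 0 is \<open>w \<noteq> \<one>\<close>, so the last nontrivial word exists already when the first one vanishes.\<close>
    define k where "k = (LEAST k. ?u k = \<one>)"
    have uk: "?u k = \<one>" unfolding k_def using \<open>?u k0 = \<one>\<close> by (rule LeastI)
    have "k \<noteq> 0" using uk w(2) by (intro notI) simp
    then obtain j where j: "k = Suc j" by (cases k) auto
    have uj: "?u j \<noteq> \<one>" using not_less_Least[of j "\<lambda>k. ?u k = \<one>"] j unfolding k_def by simp
    have uN: "?u i \<in> N" for i
    proof (induction i)
      case 0 show ?case using w by simp
    next
      case (Suc i)
      have "?u i [^] m \<in> N" for m :: nat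
        by (induction m) (use Suc subgroup.one_closed[OF Ns] subgroup.m_closed[OF Ns] in auto)
      hence "inv (?u i [^] Suc i) \<in> N" using Ns subgroup.m_inv_closed by metis
      moreover have "conjg G (inv y) (?u i) \<in> N" using conjg_normal[OF N(1) _ Suc, of "inv y"] y by simp
      ultimately show ?case unfolding u_word_Suc[OF wG y] using Ns subgroup.m_closed by metis
    qed
    let ?v = "?u j"
    have vG: "?v \<in> carrier G" using NG uN by blast
    have "inv (?v [^] k) \<otimes> conjg G (inv y) ?v = \<one>" using u_word_Suc[OF wG y, of j] uk j by simp
    hence eig: "conjg G (inv y) ?v = ?v [^] k"
      using vG y inv_solve_left'[of "\<one>" "?v [^] k" "conjg G (inv y) ?v"] by simp
    let ?E = "{n \<in> N. \<exists>v\<in>{\<one>}. conjg G (inv y) n = v \<otimes> n [^] k}"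
    have iyN: "conjg G (inv y) ` N \<subseteq> N" using conjg_normal[OF N(1), of "inv y"] y by auto
    have Es: "subgroup ?E G"
      by (rule scalar_step(1)[OF ab Ns triv_subgroup]) (use y iyN subgroup.one_closed[OF Ns] in \<open>auto simp: conjg_def\<close>)
    have "?E \<lhd> G"
    proof (rule normal_conjgI[OF Es])
      fix g n assume g: "g \<in> carrier G" and "n \<in> ?E"
      hence n: "n \<in> N" "conjg G (inv y) n = n [^] k" using NG by auto
      interpret f: group_hom G G "conjg G g" by (rule group_hom_conjg[OF g])
      let ?d = "commutator G (inv y) g"
      have dD: "?d \<in> ?D" using commutator_in_derived[of "inv y" g] y g by simp
      have dG: "?d \<in> carrier G" using dD DG by blast
      have "commutator G (inv y) g = y \<otimes> inv g \<otimes> inv y \<otimes> g" using y g by (simp add: commutator_def)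
      hence "g \<otimes> inv y \<otimes> ?d = inv y \<otimes> g" using y g by (simp add: m_assoc inv_solve_left) (simp flip: m_assoc)
      hence "conjg G (inv y) (conjg G g n) = conjg G (g \<otimes> inv y \<otimes> ?d) n" using y g NG[OF n(1)] by (simp add: conjg_conjg)
      also have "\<dots> = conjg G (g \<otimes> inv y) (conjg G ?d n)" using y g dG NG[OF n(1)] by (simp add: conjg_conjg)
      also have "\<dots> = conjg G (g \<otimes> inv y) n" using cent[OF n(1) dD] by simp
      also have "\<dots> = conjg G g (conjg G (inv y) n)" using y g NG[OF n(1)] by (simp add: conjg_conjg)
      also have "\<dots> = (conjg G g n) [^] k" using n NG[OF n(1)] by (simp add: f.hom_nat_pow)
      finally show "conjg G g n \<in> ?E" using conjg_normal[OF N(1) g n(1)] NG by simp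
    qed
    moreover have "?v \<in> ?E" using uN eig vG by simp
    ultimately have "?E = N" using minimal uj by blast
    hence "w \<in> ?E" using w(1) by simp
    hence "conjg G (inv y) w = \<one> \<otimes> w [^] k" by blast
    thus ?thesis using wG by auto
  qed
  have "generate G {w} \<lhd> G"
  proof (rule normal_conjgI[OF generate_cyclic(1)[OF wG]])
    fix g x assume g: "g \<in> carrier G" and "x \<in> generate G {w}"
    then obtain k :: nat where k: "x = w [^] k" using generate_nat[OF wG] by blast
    interpret f: group_hom G G "conjg G g" by (rule group_hom_conjg[OF g])
    obtain c :: nat where c: "conjg G g w = w [^] c" using scalar[of "inv g"] g by auto
    have "conjg G g x = w [^] (c * k)" using wG by (simp add: k f.hom_nat_pow c nat_pow_pow)
    thus "conjg G g x \<in> generate G {w}" using generate_nat[OF wG] by blast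
  qed
  thus ?thesis using w wG by blast
qed

end

lemma (in group_hom) nilpotent_image:
  assumes surj: "h ` carrier G = carrier H" and nil: "nilpotent_group G"
  shows "nilpotent_group H"
proof -
  obtain K :: "nat \<Rightarrow> 'a set" and n where K: "K 0 = {\<one>}" "K n = carrier G" "\<And>i. i \<le> n \<Longrightarrow> K i \<lhd> G"
    "\<And>i. i < n \<Longrightarrow> K i \<subseteq> K (Suc i)"
    "\<And>i x g. i < n \<Longrightarrow> x \<in> K (Suc i) \<Longrightarrow> g \<in> carrier G \<Longrightarrow> commutator G x g \<in> K i"
    using nil unfolding nilpotent_group_def by meson
  have "commutator H a b \<in> h ` K i" if i: "i < n" and a: "a \<in> h ` K (Suc i)" and b: "b \<in> carrier H" for i a b
  proof -
    obtain x where x: "x \<in> K (Suc i)" "a = h x" using a by blast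
    obtain g where g: "g \<in> carrier G" "b = h g" using b surj by blast
    have "x \<in> carrier G" using x(1) K(3)[of "Suc i"] i subgroup.mem_carrier[OF normal_imp_subgroup] by simp
    hence "commutator H a b = h (commutator G x g)" using hom_commutator x g by simp
    thus ?thesis using K(5)[OF i x(1) g(1)] by blast
  qed
  moreover have "h ` K i \<lhd> H" if "i \<le> n" for i
    using normal.surj_hom_normal_subgroup[OF K(3)[OF that] group_hom_axioms surj] .
  ultimately show ?thesis unfolding nilpotent_group_def
    using K(1,2) H.is_group surj
    by (intro conjI exI[of _ "\<lambda>i. h ` K i"] exI[of _ n] allI impI image_mono[OF K(4)] ballI) auto
qed

lemma (in finite_group) word_imp_supersoluble:
  assumes nil: "nilpotent_group (G\<restriction>derived G (carrier G))"
    and word: "\<And>x y. x \<in> carrier G \<Longrightarrow> y \<in> carrier G \<Longrightarrow> \<exists>k\<ge>1. u_word G x y k = \<one>"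
  shows "supersoluble_group G"
proof -
  have "\<exists>N. N \<lhd> G \<and> M \<subset> N \<and> cyclic_group (G\<restriction>N Mod M)" if M: "M \<lhd> G" "M \<noteq> carrier G" for M
  proof -
    let ?Q = "G Mod M"
    interpret Q: finite_group ?Q by (rule finite_group_Mod[OF M(1)])
    interpret f: group_hom G ?Q "\<lambda>x. M #> x" by (rule group_hom_Mod[OF M(1)])
    let ?D = "derived G (carrier G)"
    have Ds: "subgroup ?D G" by (rule derived_is_subgroup) simp
    interpret fD: group_hom "G\<restriction>?D" "?Q\<lparr>carrier := (\<lambda>x. M #> x) ` ?D\<rparr>" "\<lambda>x. M #> x"
      by (rule f.group_hom_restrict[OF Ds])
    have "nilpotent_group (?Q\<lparr>carrier := (\<lambda>x. M #> x) ` ?D\<rparr>)"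
      by (rule fD.nilpotent_image[OF _ nil]) simp
    moreover have "(\<lambda>x. M #> x) ` ?D = derived ?Q (carrier ?Q)"
      using f.derived_img[of "carrier G"] by (simp add: carrier_Mod)
    ultimately have nilQ: "nilpotent_group (?Q\<lparr>carrier := derived ?Q (carrier ?Q)\<rparr>)" by simp
    have neQ: "carrier ?Q \<noteq> {\<one>\<^bsub>?Q\<^esub>}" using Mod_trivial_iff M by blast
    have wordQ: "\<exists>k\<ge>1. u_word ?Q \<xi> \<eta> k = \<one>\<^bsub>?Q\<^esub>" if \<xi>: "\<xi> \<in> carrier ?Q" and \<eta>: "\<eta> \<in> carrier ?Q" for \<xi> \<eta>
    proof -
      obtain x where x: "x \<in> carrier G" "\<xi> = M #> x" using \<xi> by (auto simp: carrier_Mod)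
      obtain y where y: "y \<in> carrier G" "\<eta> = M #> y" using \<eta> by (auto simp: carrier_Mod)
      obtain k where k: "k \<ge> 1" "u_word G x y k = \<one>" using word x y by blast
      have "u_word ?Q \<xi> \<eta> k = M #> u_word G x y k" using f.hom_u_word[OF fin x(1) y(1)] x y by simp
      also have "\<dots> = \<one>\<^bsub>?Q\<^esub>" unfolding k(2) by (rule f.hom_one)
      finally show ?thesis using k(1) by blast
    qed
    obtain \<beta> where b: "\<beta> \<in> carrier ?Q" "\<beta> \<noteq> \<one>\<^bsub>?Q\<^esub>" "generate ?Q {\<beta>} \<lhd> ?Q"
      using Q.nontrivial_cyclic_normal[OF nilQ neQ wordQ] by blast
    let ?A = "generate ?Q {\<beta>}"
    have As: "subgroup ?A ?Q" using b Q.normal_sub by blast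
    have "?A \<noteq> {\<one>\<^bsub>?Q\<^esub>}" using Q.generate_cyclic(2)[OF b(1)] b(2) by blast
    hence sub: "M \<subset> \<Union>?A" by (rule Mod_preimage_psubset[OF M(1) As])
    have N: "\<Union>?A \<lhd> G" by (rule normal.factgroup_subgroup_union_normal[OF M(1) b(3)])
    have "?A = rcosets\<^bsub>G\<lparr>carrier := \<Union>?A\<rparr>\<^esub> M" by (rule normal.factgroup_subgroup_union_factor[OF M(1) As])
    hence "cyclic_group (G\<lparr>carrier := \<Union>?A\<rparr> Mod M)"
      using cyclic_factor_iff[OF M(1) normal_sub[OF N]] sub b(1) by blast
    thus ?thesis using N sub by blast
  qed
  from normal_series_exists[of "\<lambda>M N. cyclic_group (G\<restriction>N Mod M)", OF this]
  show ?thesis unfolding supersoluble_group_def using is_group by blast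
qed

theorem mainTheorem1:
  fixes G :: "('a, 'b) monoid_scheme" (structure)
  assumes "group G" and "finite (carrier G)"
  shows "((\<forall>H. subgroup H G \<and> cyclic_group (G\<lparr>carrier := H\<rparr>) \<and> primepow (card H)
              \<longrightarrow> P_subnormal G H)
          \<longleftrightarrow>
          (\<forall>H. subgroup H G \<and> nilpotent_group (G\<lparr>carrier := derived G H\<rparr>)
              \<longrightarrow> supersoluble_group (G\<lparr>carrier := H\<rparr>)))
       \<and>
         ((\<forall>H. subgroup H G \<and> nilpotent_group (G\<lparr>carrier := derived G H\<rparr>)
              \<longrightarrow> supersoluble_group (G\<lparr>carrier := H\<rparr>))
          \<longleftrightarrow>
          (\<forall>x\<in>carrier G. \<forall>y\<in>carrier G. \<exists>k\<ge>1. u_word G x y k = \<one>))"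
proof -
  interpret finite_group G using assms by (simp add: finite_group_def finite_group_axioms_def)
  let ?S1 = "\<forall>H. subgroup H G \<and> cyclic_group (G\<restriction>H) \<and> primepow (card H) \<longrightarrow> P_subnormal G H"
  let ?S2 = "\<forall>H. subgroup H G \<and> nilpotent_group (G\<restriction>derived G H) \<longrightarrow> supersoluble_group (G\<restriction>H)"
  let ?S3 = "\<forall>x\<in>carrier G. \<forall>y\<in>carrier G. \<exists>k\<ge>1. u_word G x y k = \<one>"
  have 21: ?S1 if S2: ?S2
  proof (intro allI impI, elim conjE)
    fix H assume H: "subgroup H G" "cyclic_group (G\<restriction>H)" "primepow (card H)"
    obtain x where x: "x \<in> H" "subgroup_generated (G\<restriction>H) {x} = G\<restriction>H"
      using H(2) unfolding cyclic_group_def by auto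
    have "generate (G\<restriction>H) {x} = H"
      using x carrier_subgroup_generated[of "G\<restriction>H" "{x}"] by simp
    hence gx: "generate G {x} = H" using gen_in[OF H(1) x(1)] by simp
    obtain q b where q: "prime q" "card H = q ^ b" using H(3) unfolding primepow_def by blast
    have "chains_over_p_subgroups G" by (rule supersoluble_imp_chains) (use S2 in blast)
    hence "prime_chain G (generate G {x}) (carrier G)"
      by (rule primary_prime_chain[OF finite_group_axioms _ sub_mem[OF H(1) x(1)] q(1)]) (use gx q(2) in simp)
    thus "P_subnormal G H" using gx P_subnormal_iff_prime_chain by simp
  qed
  have 13: ?S3 if S1: ?S1
  proof -
    have "primary_chained G"
      unfolding primary_chained_def
    proof (intro allI impI)
      fix x q b assume x: "x \<in> carrier G" and q: "prime q" "b \<noteq> 0" "card (generate G {x}) = q ^ b"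
      have "subgroup_generated G {x} = G\<restriction>generate G {x}" using x by (simp add: subgroup_generated_def)
      hence "cyclic_group (G\<restriction>generate G {x})" using cyclic_group_generated[of x] by simp
      moreover have "primepow (card (generate G {x}))" unfolding primepow_def using q by blast
      ultimately have "P_subnormal G (generate G {x})" using S1 generate_cyclic(1)[OF x] by blast
      thus "prime_chain G (generate G {x}) (carrier G)" using P_subnormal_iff_prime_chain by simp
    qed
    thus ?thesis using primary_chained_imp_word by blast
  qed
  have 32: ?S2 if S3: ?S3
  proof (intro allI impI, elim conjE)
    fix H assume H: "subgroup H G" and nil: "nilpotent_group (G\<restriction>derived G H)"
    interpret HG: finite_group "G\<restriction>H" using H subgroup_finite_group by blast
    interpret incl: group_hom "G\<restriction>H" G "\<lambda>x. x"
      by (intro group_hom.intro group_hom_axioms.intro homI HG.is_group is_group) (use sub_mem[OF H] in auto)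
    show "supersoluble_group (G\<restriction>H)"
    proof (rule HG.word_imp_supersoluble)
      have "derived (G\<restriction>H) H = derived G H" by (rule derived_consistent[OF order_refl H])
      thus "nilpotent_group ((G\<restriction>H)\<lparr>carrier := derived (G\<restriction>H) (carrier (G\<restriction>H))\<rparr>)"
        using nil by simp
      fix x y assume "x \<in> carrier (G\<restriction>H)" "y \<in> carrier (G\<restriction>H)"
      thus "\<exists>k\<ge>1. u_word (G\<restriction>H) x y k = \<one>\<^bsub>G\<restriction>H\<^esub>"
        using incl.hom_u_word[OF HG.fin] S3 sub_mem[OF H] by simp
    qed
  qed
  show ?thesis using 21 13 32 by blast
qed

end
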